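(* (Difference Newton Lemma) Let $(K,v,\sigma)$ be a multiplicative valued difference field of characteristic zero that is spherically complete. Assume that the difference residue field $(\mathbf{k},\bar\sigma)$ of $K$ is an ACFA of characteristic zero, and that the value group $\Gamma$ is a subgroup of $\mathbb{R}$ that is a $\mathbb{Q}(\rho)$-module, where $\rho>0$, the scaling exponent of $\sigma$, is transcendental over $\mathbb{Q}$. Let $f\in K_\sigma[x]$ be a nonconstant difference polynomial in one variable and let $b\in K$ be such that $f(b)\neq 0$. Define $$\varepsilon:=\max_{J,\ |J|\ge 1}\varepsilon_J,\qquad \varepsilon_J:=\frac{1}{|J|_\rho}\bigl(v(f(b))-v(f_{(J)}(b))\bigr).$$ Then there exists a root $a\in K$ of $f$ such that $v(a-b)=\varepsilon$.
   Context: A difference field is a field together with a field automorphism $\sigma$. An ACFA is a difference field $(k,\sigma)$ such that every finite system of difference polynomial equations over $k$ having a solution in some difference field extension of $k$ has a solution in $k$. A valued difference field is a valued field $K$ with an automorphism $\sigma$ such that $\sigma(\mathcal{O}_K)=\mathcal{O}_K$ ($\mathcal{O}_K$ the valuation ring); the residue field $\mathbf{k}$ carries the induced automorphism $\bar\sigma(\bar a)=\overline{\sigma(a)}$. It is multiplicative with scaling exponent $\rho$ (a positive real) if $v(\sigma(x))=\rho\cdot v(x)$ for all $x\in K^\times$. $K$ is spherically complete if every nonempty family of balls in $K$ totally ordered by inclusion has nonempty intersection. $K_\sigma[x]$ is the polynomial ring over $K$ in the formal variables $x=\sigma^0(x),\sigma(x),\sigma^2(x),\dots$. Every $f\in K_\sigma[x]$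 can be written $f(x)=P(x,\sigma(x),\dots,\sigma^m(x))$ for some $m$ and an ordinary polynomial $P\in K[x_0,\dots,x_m]$. A multi-index is $J=(j_0,\dots,j_m)\in\mathbb{N}^{m+1}$ ($0\in\mathbb{N}$), with $|J|=j_0+\dots+j_m$ and $|J|_\rho=j_0+\rho j_1+\dots+\rho^m j_m$, $J!=j_0!\cdots j_m!$, and $$f_{(J)}(a)=\frac{1}{J!}\,\frac{\partial^{|J|}P}{\partial x_0^{j_0}\cdots\partial x_m^{j_m}}\bigl(a,\sigma(a),\dots,\sigma^m(a)\bigr).$$ Convention: $v(0)=\infty$, so indices $J$ with $f_{(J)}(b)=0$ have $\varepsilon_J=-\infty$ and do not contribute to the maximum. *)

theory Defs
  imports
    "HOL-Algebra.Algebra"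
    "HOL-Algebra.Indexed_Polynomials"
    "HOL-Computational_Algebra.Polynomial"
    "HOL-Library.Extended_Real"
begin

section \<open>Difference fields\<close>

locale difference_field = field R for R (structure) +
  fixes \<sigma> :: "'a \<Rightarrow> 'a"
  assumes automorphism: "\<sigma> \<in> ring_iso R R"

definition char_zero :: "('a, 'm) ring_scheme \<Rightarrow> bool" where
  "char_zero R \<longleftrightarrow> (\<forall>n::nat. n > 0 \<longrightarrow> [n] \<cdot>\<^bsub>R\<^esub> \<one>\<^bsub>R\<^esub> \<noteq> \<zero>\<^bsub>R\<^esub>)"

text \<open>
  A homomorphism of fields (preserving one) is injective, so an extension of a difference field
  is given up to isomorphism by a homomorphism \<open>h\<close> that commutes with the automorphisms.
\<close>

definition difference_field_extension ::
    "('b, 'm) ring_scheme \<Rightarrow> ('b \<Rightarrow> 'b) \<Rightarrow> ('c, 'n) ring_scheme \<Rightarrow> ('c \<Rightarrow> 'c) \<Rightarrow> ('b \<Rightarrow> 'c) \<Rightarrow> bool" where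
  "difference_field_extension k s L t h \<longleftrightarrow>
     difference_field k s \<and> difference_field L t \<and> h \<in> ring_hom k L \<and>
     (\<forall>a\<in>carrier k. h (s a) = t (h a))"


section \<open>Difference polynomials\<close>

text \<open>
  Polynomials are the indexed polynomials of \<^theory>\<open>HOL-Algebra.Indexed_Polynomials\<close>: functions from
  monomials (multisets of indeterminates) to coefficients.
\<close>

definition mpoly_carrier :: "('a, 'm) ring_scheme \<Rightarrow> 'i set \<Rightarrow> ('i multiset \<Rightarrow> 'a) set" where
  "mpoly_carrier R I = ring.indexed_pset R I (carrier R)"

definition mpoly_eval :: "('a, 'm) ring_scheme \<Rightarrow> ('i \<Rightarrow> 'a) \<Rightarrow> ('i multiset \<Rightarrow> 'a) \<Rightarrow> 'a" where
  "mpoly_eval R x P =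
     (\<Oplus>\<^bsub>R\<^esub>M\<in>{M. P M \<noteq> \<zero>\<^bsub>R\<^esub>}. P M \<otimes>\<^bsub>R\<^esub> (\<Otimes>\<^bsub>R\<^esub>i\<in>set_mset M. x i [^]\<^bsub>R\<^esub> count M i))"

text \<open>
  \<open>\<partial>P / \<partial>x\<^sub>i\<close>: the coefficient of the monomial \<open>M\<close> comes from that of \<open>x\<^sub>i M\<close>, multiplied by the
  exponent of \<open>x\<^sub>i\<close> in \<open>x\<^sub>i M\<close>.
\<close>

definition partial_deriv ::
    "('a, 'm) ring_scheme \<Rightarrow> 'i \<Rightarrow> ('i multiset \<Rightarrow> 'a) \<Rightarrow> ('i multiset \<Rightarrow> 'a)" where
  "partial_deriv R i P = (\<lambda>M. [Suc (count M i)] \<cdot>\<^bsub>R\<^esub> P (add_mset i M))"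

text \<open>
  Difference polynomials in one variable \<open>x\<close> use the natural number \<open>i\<close> as index of the
  indeterminate \<open>\<sigma>\<^sup>i(x)\<close>.  Since every polynomial involves only finitely many indeterminates, no
  bound \<open>m\<close> has to be fixed: a multi-index is a multiset \<open>J\<close> of natural numbers, with
  \<open>j\<^sub>i = count J i\<close>, and \<open>|J| = size J\<close>.
\<close>

abbreviation diff_polys :: "('a, 'm) ring_scheme \<Rightarrow> (nat multiset \<Rightarrow> 'a) set" where
  "diff_polys R \<equiv> mpoly_carrier R UNIV"

definition diff_eval ::
    "('a, 'm) ring_scheme \<Rightarrow> ('a \<Rightarrow> 'a) \<Rightarrow> (nat multiset \<Rightarrow> 'a) \<Rightarrow> 'a \<Rightarrow> 'a" where
  "diff_eval R \<sigma> f a = mpoly_eval R (\<lambda>i. (\<sigma> ^^ i) a) f"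

definition multi_fact :: "nat multiset \<Rightarrow> nat" where
  "multi_fact J = (\<Prod>i\<in>set_mset J. fact (count J i))"

definition multi_weight :: "real \<Rightarrow> nat multiset \<Rightarrow> real" where
  "multi_weight \<rho> J = (\<Sum>i\<in>set_mset J. \<rho> ^ i * real (count J i))"

definition multi_deriv ::
    "('a, 'm) ring_scheme \<Rightarrow> nat multiset \<Rightarrow> (nat multiset \<Rightarrow> 'a) \<Rightarrow> (nat multiset \<Rightarrow> 'a)" where
  "multi_deriv R J P = foldr (partial_deriv R) (sorted_list_of_multiset J) P"

text \<open>The Taylor coefficient \<open>f\<^sub>(\<^sub>J\<^sub>)(a)\<close>.\<close>

definition diff_taylor ::
    "('a, 'm) ring_scheme \<Rightarrow> ('a \<Rightarrow> 'a) \<Rightarrow> (nat multiset \<Rightarrow> 'a) \<Rightarrow> nat multiset \<Rightarrow> 'a \<Rightarrow> 'a" where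
  "diff_taylor R \<sigma> f J a =
     inv\<^bsub>R\<^esub> ([multi_fact J] \<cdot>\<^bsub>R\<^esub> \<one>\<^bsub>R\<^esub>) \<otimes>\<^bsub>R\<^esub> diff_eval R \<sigma> (multi_deriv R J f) a"


section \<open>ACFA\<close>

text \<open>
  A difference polynomial in \<open>x\<^sub>0, \<dots>, x\<^sub>n\<^sub>-\<^sub>1\<close> is a polynomial in the indeterminates
  \<open>(j, i)\<close> with \<open>j < n\<close>, where \<open>(j, i)\<close> stands for \<open>\<sigma>\<^sup>i(x\<^sub>j)\<close>.

  Quantification over all difference field extensions of \<open>k\<close> has to be restricted to a type.
  The type \<^typ>\<open>'b list\<close> is large enough: a system with a solution in some extension already has it in
  the subfield generated by \<open>k\<close> and all \<open>\<sigma>\<^sup>i(x\<^sub>j)\<close>, \<open>i\<close> an integer, whose cardinality is at most that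
  of \<^typ>\<open>'b list\<close>.
\<close>

definition solves_system ::
    "('a, 'm) ring_scheme \<Rightarrow> ('a \<Rightarrow> 'a) \<Rightarrow> nat \<Rightarrow> ((nat \<times> nat) multiset \<Rightarrow> 'a) set \<Rightarrow> (nat \<Rightarrow> 'a) \<Rightarrow> bool"
  where
  "solves_system R \<sigma> n S x \<longleftrightarrow>
     x \<in> {..<n} \<rightarrow> carrier R \<and>
     (\<forall>P\<in>S. mpoly_eval R (\<lambda>(j, i). (\<sigma> ^^ i) (x j)) P = \<zero>\<^bsub>R\<^esub>)"

definition ACFA :: "('b, 'm) ring_scheme \<Rightarrow> ('b \<Rightarrow> 'b) \<Rightarrow> bool" where
  "ACFA k s \<longleftrightarrow>
     difference_field k s \<and>
     (\<forall>n S. finite S \<and> S \<subseteq> mpoly_carrier k ({..<n} \<times> UNIV) \<and>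
        (\<exists>(L :: 'b list ring) t h.
           difference_field_extension k s L t h \<and>
           (\<exists>x. solves_system L t n ((\<lambda>P. h \<circ> P) ` S) x)) \<longrightarrow>
        (\<exists>x. solves_system k s n S x))"


section \<open>Valued difference fields\<close>

text \<open>
  Only valuations whose value group is contained in the real numbers are considered; as usual
  \<open>v(0) = \<infinity>\<close>.
\<close>

locale real_valued_field = field K for K (structure) +
  fixes v :: "'a \<Rightarrow> ereal"
  assumes val_not_MInf: "x \<in> carrier K \<Longrightarrow> v x \<noteq> -\<infinity>"
    and val_eq_PInf_iff: "x \<in> carrier K \<Longrightarrow> v x = \<infinity> \<longleftrightarrow> x = \<zero>"
    and val_mult: "\<lbrakk>x \<in> carrier K; y \<in> carrier K\<rbrakk> \<Longrightarrow> v (x \<otimes> y) = v x + v y"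
    and val_add: "\<lbrakk>x \<in> carrier K; y \<in> carrier K\<rbrakk> \<Longrightarrow> min (v x) (v y) \<le> v (x \<oplus> y)"

definition value_group :: "('a, 'm) ring_scheme \<Rightarrow> ('a \<Rightarrow> ereal) \<Rightarrow> real set" where
  "value_group K v = {\<gamma>. ereal \<gamma> \<in> v ` (carrier K - {\<zero>\<^bsub>K\<^esub>})}"

definition valuation_set :: "('a, 'm) ring_scheme \<Rightarrow> ('a \<Rightarrow> ereal) \<Rightarrow> 'a set" where
  "valuation_set K v = {x \<in> carrier K. 0 \<le> v x}"

definition valuation_ideal :: "('a, 'm) ring_scheme \<Rightarrow> ('a \<Rightarrow> ereal) \<Rightarrow> 'a set" where
  "valuation_ideal K v = {x \<in> carrier K. 0 < v x}"

definition residue_field :: "('a, 'm) ring_scheme \<Rightarrow> ('a \<Rightarrow> ereal) \<Rightarrow> 'a set ring" where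
  "residue_field K v = (K\<lparr>carrier := valuation_set K v\<rparr>) Quot (valuation_ideal K v)"

locale valued_difference_field = real_valued_field K v + difference_field K \<sigma>
  for K (structure) and v and \<sigma> +
  assumes val_ring_invariant: "\<sigma> ` valuation_set K v = valuation_set K v"

text \<open>
  Elements of the residue field are cosets, and the induced automorphism sends the coset of \<open>a\<close> to
  its image under \<open>\<sigma>\<close>, which is the coset of \<open>\<sigma>(a)\<close>; see \<open>residue_map_coset\<close> below.
\<close>

definition residue_map :: "('a \<Rightarrow> 'a) \<Rightarrow> 'a set \<Rightarrow> 'a set" where
  "residue_map \<sigma> C = \<sigma> ` C"

locale multiplicative_valued_difference_field = valued_difference_field +
  fixes \<rho> :: real
  assumes scaling_pos: "\<rho> > 0"
    and scaling: "x \<in> carrier K - {\<zero>} \<Longrightarrow> v (\<sigma> x) = ereal \<rho> * v x"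

lemma (in valued_difference_field) val_one: "v \<one> = 0"
proof -
  have "v \<one> + v \<one> = v \<one>" using val_mult[of \<one> \<one>] by simp
  moreover have "v \<one> \<noteq> \<infinity>" "v \<one> \<noteq> -\<infinity>"
    using val_eq_PInf_iff[of \<one>] val_not_MInf[of \<one>] by auto
  ultimately show ?thesis by (cases "v \<one>") auto
qed

lemma (in valued_difference_field) val_ideal_iff:
  assumes "x \<in> carrier K"
  shows "x \<in> valuation_ideal K v \<longleftrightarrow>
    x \<in> valuation_set K v \<and> \<not> (\<exists>y\<in>valuation_set K v. x \<otimes> y = \<one>)"
proof
  assume x: "x \<in> valuation_ideal K v"
  { fix y assume y: "y \<in> valuation_set K v" "x \<otimes> y = \<one>"
    have "v x + v y = 0" using val_mult[of x y] y assms val_one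
      by (auto simp: valuation_set_def)
    moreover have "0 < v x" "0 \<le> v y" using x y
      by (auto simp: valuation_set_def valuation_ideal_def)
    ultimately have False by (cases "v x"; cases "v y") auto }
  with x show "x \<in> valuation_set K v \<and> \<not> (\<exists>y\<in>valuation_set K v. x \<otimes> y = \<one>)"
    by (auto simp: valuation_set_def valuation_ideal_def)
next
  assume *: "x \<in> valuation_set K v \<and> \<not> (\<exists>y\<in>valuation_set K v. x \<otimes> y = \<one>)"
  show "x \<in> valuation_ideal K v"
  proof (rule ccontr)
    assume "x \<notin> valuation_ideal K v"
    hence v0: "v x = 0" using * by (auto simp: valuation_set_def valuation_ideal_def)
    hence "x \<noteq> \<zero>" using val_eq_PInf_iff[of x] assms by auto
    hence u: "inv x \<in> carrier K" "x \<otimes> inv x = \<one>"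
      using assms field_Units by auto
    have "v (inv x) = 0" using val_mult[of x "inv x"] u assms val_one v0 by simp
    with * u show False by (auto simp: valuation_set_def)
  qed
qed

lemma (in valued_difference_field) residue_map_coset:
  assumes "a \<in> valuation_set K v"
  defines "V \<equiv> K\<lparr>carrier := valuation_set K v\<rparr>"
  shows "residue_map \<sigma> (valuation_ideal K v +>\<^bsub>V\<^esub> a) = valuation_ideal K v +>\<^bsub>V\<^esub> \<sigma> a"
proof -
  have hom: "\<sigma> \<in> ring_hom K K" and bij: "bij_betw \<sigma> (carrier K) (carrier K)"
    using automorphism by (auto simp: ring_iso_def)
  have sub: "valuation_set K v \<subseteq> carrier K" "valuation_ideal K v \<subseteq> carrier K"
    by (auto simp: valuation_set_def valuation_ideal_def)
  have inj: "\<sigma> x = \<sigma> y \<longleftrightarrow> x = y" if "x \<in> carrier K" "y \<in> carrier K" for x y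
    using bij_betw_imp_inj_on[OF bij] that by (rule inj_on_eq_iff)
  have mem: "\<sigma> x \<in> valuation_set K v \<longleftrightarrow> x \<in> valuation_set K v" if x: "x \<in> carrier K" for x
  proof
    assume "\<sigma> x \<in> valuation_set K v"
    then obtain y where y: "y \<in> valuation_set K v" "\<sigma> x = \<sigma> y"
      using val_ring_invariant by blast
    moreover have "y \<in> carrier K" using y sub(1) by blast
    ultimately show "x \<in> valuation_set K v" using inj[OF x] by simp
  next
    assume "x \<in> valuation_set K v"
    then show "\<sigma> x \<in> valuation_set K v" using val_ring_invariant by blast
  qed
  have unit: "(\<exists>y\<in>valuation_set K v. \<sigma> x \<otimes> y = \<one>) \<longleftrightarrow> (\<exists>y\<in>valuation_set K v. x \<otimes> y = \<one>)"
    if x: "x \<in> carrier K" for x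
  proof -
    have "(\<exists>y\<in>valuation_set K v. \<sigma> x \<otimes> y = \<one>) \<longleftrightarrow>
        (\<exists>y\<in>\<sigma> ` valuation_set K v. \<sigma> x \<otimes> y = \<one>)"
      by (simp only: val_ring_invariant)
    also have "\<dots> \<longleftrightarrow> (\<exists>y\<in>valuation_set K v. \<sigma> x \<otimes> \<sigma> y = \<one>)" by blast
    also have "\<dots> \<longleftrightarrow> (\<exists>y\<in>valuation_set K v. x \<otimes> y = \<one>)"
    proof (rule bex_cong[OF refl])
      fix y assume "y \<in> valuation_set K v"
      hence y: "y \<in> carrier K" using sub(1) by blast
      have "\<sigma> x \<otimes> \<sigma> y = \<one> \<longleftrightarrow> \<sigma> (x \<otimes> y) = \<sigma> \<one>"
        by (simp only: ring_hom_mult[OF hom x y] ring_hom_one[OF hom])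
      also have "\<dots> \<longleftrightarrow> x \<otimes> y = \<one>" using x y by (intro inj) auto
      finally show "\<sigma> x \<otimes> \<sigma> y = \<one> \<longleftrightarrow> x \<otimes> y = \<one>" .
    qed
    finally show ?thesis .
  qed
  have cl: "\<sigma> x \<in> carrier K" if "x \<in> carrier K" for x using ring_hom_closed[OF hom that] .
  have memI: "\<sigma> x \<in> valuation_ideal K v \<longleftrightarrow> x \<in> valuation_ideal K v" if "x \<in> carrier K" for x
    using val_ideal_iff[OF that] val_ideal_iff[OF cl[OF that]] mem[OF that] unit[OF that] by simp
  have img: "\<sigma> ` valuation_ideal K v = valuation_ideal K v"
  proof
    show "\<sigma> ` valuation_ideal K v \<subseteq> valuation_ideal K v" using memI sub(2) by auto
    show "valuation_ideal K v \<subseteq> \<sigma> ` valuation_ideal K v"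
    proof
      fix y assume y: "y \<in> valuation_ideal K v"
      then obtain x where "x \<in> carrier K" "y = \<sigma> x"
        using bij sub(2) by (metis bij_betw_imp_surj_on imageE subsetD)
      with y memI show "y \<in> \<sigma> ` valuation_ideal K v" by auto
    qed
  qed
  have coset: "valuation_ideal K v +>\<^bsub>V\<^esub> c = (\<lambda>x. x \<oplus> c) ` valuation_ideal K v" for c
    by (auto simp: a_r_coset_def' V_def)
  have "residue_map \<sigma> (valuation_ideal K v +>\<^bsub>V\<^esub> a)
      = (\<lambda>x. \<sigma> x \<oplus> \<sigma> a) ` valuation_ideal K v"
    unfolding residue_map_def coset image_image
    using ring_hom_add[OF hom] sub assms(1) by (intro image_cong) auto
  also have "\<dots> = (\<lambda>x. x \<oplus> \<sigma> a) ` (\<sigma> ` valuation_ideal K v)" by (simp add: image_image)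
  finally show ?thesis by (simp add: img coset)
qed

text \<open>Both closed and open balls, with radius in the value group, are considered.\<close>

definition valuation_balls :: "('a, 'm) ring_scheme \<Rightarrow> ('a \<Rightarrow> ereal) \<Rightarrow> 'a set set" where
  "valuation_balls K v =
     {{x \<in> carrier K. ereal \<gamma> \<le> v (x \<ominus>\<^bsub>K\<^esub> c)} | c \<gamma>. c \<in> carrier K \<and> \<gamma> \<in> value_group K v} \<union>
     {{x \<in> carrier K. ereal \<gamma> < v (x \<ominus>\<^bsub>K\<^esub> c)} | c \<gamma>. c \<in> carrier K \<and> \<gamma> \<in> value_group K v}"

definition spherically_complete :: "('a, 'm) ring_scheme \<Rightarrow> ('a \<Rightarrow> ereal) \<Rightarrow> bool" where
  "spherically_complete K v \<longleftrightarrow>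
     (\<forall>F. F \<noteq> {} \<and> subset.chain (valuation_balls K v) F \<longrightarrow> \<Inter>F \<noteq> {})"

text \<open>The field \<open>\<rat>(\<rho>)\<close>, as a subfield of the real numbers.\<close>

definition rat_adjoin :: "real \<Rightarrow> real set" where
  "rat_adjoin \<rho> =
     {poly p \<rho> / poly q \<rho> | p q.
        (\<forall>i. Polynomial.coeff p i \<in> \<rat>) \<and> (\<forall>i. Polynomial.coeff q i \<in> \<rat>) \<and> poly q \<rho> \<noteq> 0}"

definition rat_adjoin_module :: "real \<Rightarrow> real set \<Rightarrow> bool" where
  "rat_adjoin_module \<rho> \<Gamma> \<longleftrightarrow>
     0 \<in> \<Gamma> \<and> (\<forall>x\<in>\<Gamma>. \<forall>y\<in>\<Gamma>. x + y \<in> \<Gamma>) \<and> (\<forall>x\<in>\<Gamma>. - x \<in> \<Gamma>) \<and>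
     (\<forall>c\<in>rat_adjoin \<rho>. \<forall>x\<in>\<Gamma>. c * x \<in> \<Gamma>)"


section \<open>The Newton radius\<close>

text \<open>
  Extended real arithmetic gives \<open>\<epsilon>\<^sub>J = -\<infinity>\<close> when \<open>f\<^sub>(\<^sub>J\<^sub>)(b) = 0\<close> and \<open>f(b) \<noteq> 0\<close>.  As
  \<open>f\<^sub>(\<^sub>J\<^sub>)(b) = 0\<close> for all but finitely many \<open>J\<close>, the maximum is taken over a finite set of values.
\<close>

definition newton_exponent ::
    "('a, 'm) ring_scheme \<Rightarrow> ('a \<Rightarrow> ereal) \<Rightarrow> ('a \<Rightarrow> 'a) \<Rightarrow> real \<Rightarrow> (nat multiset \<Rightarrow> 'a) \<Rightarrow> 'a
      \<Rightarrow> nat multiset \<Rightarrow> ereal" where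
  "newton_exponent K v \<sigma> \<rho> f b J =
     ereal (1 / multi_weight \<rho> J) * (v (diff_eval K \<sigma> f b) - v (diff_taylor K \<sigma> f J b))"

definition newton_radius ::
    "('a, 'm) ring_scheme \<Rightarrow> ('a \<Rightarrow> ereal) \<Rightarrow> ('a \<Rightarrow> 'a) \<Rightarrow> real \<Rightarrow> (nat multiset \<Rightarrow> 'a) \<Rightarrow> 'a
      \<Rightarrow> ereal" where
  "newton_radius K v \<sigma> \<rho> f b = Max (newton_exponent K v \<sigma> \<rho> f b ` {J. 1 \<le> size J})"

end

(*
  For each a with f(a) nonzero, let r(a) be the Newton radius at a and B(a) the closed ball around a
  of radius r(a).  Taylor expansion shows that c in B(a) implies v(f(c)) >= v(f(a)) and
  r(c) >= r(a), that f has no root c with v(c - a) > r(a), and that, after rescaling, the equation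
  f = 0 on B(a) reduces to a nonconstant difference equation over the residue field.  A root of the
  reduction gives c in B(a) with v(f(c)) > v(f(a)).  If f had no root in B(b), Zorn's lemma and
  spherical completeness would give a minimal ball B(a) inside B(b), a contradiction.

  That a nonconstant difference polynomial g over an ACFA k has a root needs an extension of k with a
  root of g.  Over k take algebraically independent elements t_0, t_1, ... in an algebraically closed
  field (they exist in a quotient of a ring of functions).  Let j be the smallest index that occurs
  in g, and let a be a root of g regarded as an ordinary polynomial with t_i in the place of the
  i-th indeterminate for i > j.  The automorphism of k together with the shift a, t_(j+1), t_(j+2),
  ... extends to an automorphism of an algebraically closed field of finite transcendence degree, by
  the exchange property.
*)
theory Submission
  imports Defs
begin

section \<open>Evaluation of indexed polynomials\<close>

text \<open>The automorphism of the extension must be onto, but the shift of infinitely many generic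
  elements is not. It is therefore built on an algebraically closed field of finite transcendence
  degree: \<open>a\<close> is algebraic over t_(j+1), ..., t_s, and s is taken minimal, so that a,
  t_(j+1), ..., t_(s-1) remain independent. Then only the iterates of the root with exponents j,
  ..., s are the chosen elements, and the later ones are forced by the automorphism. The equation
  survives, because a t_l that is transcendental over all other arguments may be replaced by any
  element. The independent elements come from a ring of functions because the functions that do not
  depend on one coordinate form, modulo the maximal ideal, a field over which that coordinate is
  transcendental. The definition of ACFA admits only extensions whose elements are lists over the
  type of k, so the extension, found on a larger type, is cut down to a difference subfield
  generated by k and the root. On the valuation side, the Q(rho)-module structure puts the Newton
  radii into the value group: there is a u with v(u) = r(a) for the rescaling, and each B(a) is a
  ball to which spherical completeness applies.\<close>

definition mono_val :: "('a, 'm) ring_scheme \<Rightarrow> ('i \<Rightarrow> 'a) \<Rightarrow> 'i multiset \<Rightarrow> 'a" where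
  "mono_val R x M = (\<Otimes>\<^bsub>R\<^esub>i\<in>set_mset M. x i [^]\<^bsub>R\<^esub> count M i)"

lemma mpoly_eval_mono_val:
  "mpoly_eval R x P = (\<Oplus>\<^bsub>R\<^esub>M\<in>{M. P M \<noteq> \<zero>\<^bsub>R\<^esub>}. P M \<otimes>\<^bsub>R\<^esub> mono_val R x M)"
  by (simp add: mpoly_eval_def mono_val_def)

text \<open>Slices, derivatives and reductions are given by coefficient functions, for which finite
  support is the condition that can be checked, rather than a derivation in the inductive set.
  Conversely, a function with finite support is the sum of its monomials, split off one at a time,
  and a monomial arises from its coefficient one indeterminate at a time.\<close>

lemma (in ring) mpoly_carrier_iff:
  "P \<in> mpoly_carrier R I \<longleftrightarrow>
     finite {M. P M \<noteq> \<zero>} \<and> (\<forall>M. P M \<in> carrier R) \<and> (\<forall>M. P M \<noteq> \<zero> \<longrightarrow> set_mset M \<subseteq> I)"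
proof
  assume "P \<in> mpoly_carrier R I"
  then have "P \<in> indexed_pset I (carrier R)" by (simp add: mpoly_carrier_def)
  then show "finite {M. P M \<noteq> \<zero>} \<and> (\<forall>M. P M \<in> carrier R) \<and> (\<forall>M. P M \<noteq> \<zero> \<longrightarrow> set_mset M \<subseteq> I)"
  proof induction
    case (indexed_const k)
    have "{M. indexed_const k M \<noteq> \<zero>} \<subseteq> {{#}}" by (auto simp: indexed_const_def)
    then show ?case using indexed_const
      by (auto simp: indexed_const_def intro: finite_subset[of _ "{{#}}"])
  next
    case (indexed_padd P Q)
    have "{M. (P \<Oplus> Q) M \<noteq> \<zero>} \<subseteq> {M. P M \<noteq> \<zero>} \<union> {M. Q M \<noteq> \<zero>}"
      by (auto simp: indexed_padd_def)
    then have "finite {M. (P \<Oplus> Q) M \<noteq> \<zero>}" using indexed_padd finite_subset by blast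
    moreover have "\<forall>M. (P \<Oplus> Q) M \<in> carrier R" using indexed_padd by (simp add: indexed_padd_def)
    moreover have "\<forall>M. (P \<Oplus> Q) M \<noteq> \<zero> \<longrightarrow> P M \<noteq> \<zero> \<or> Q M \<noteq> \<zero>"
      by (auto simp: indexed_padd_def)
    ultimately show ?case using indexed_padd by blast
  next
    case (indexed_pmult P i)
    have "{M. (P \<Otimes> i) M \<noteq> \<zero>} \<subseteq> add_mset i ` {M. P M \<noteq> \<zero>}"
    proof
      fix M assume "M \<in> {M. (P \<Otimes> i) M \<noteq> \<zero>}"
      then have "i \<in># M" "P (M - {#i#}) \<noteq> \<zero>" by (auto simp: indexed_pmult_def split: if_splits)
      then have "M = add_mset i (M - {#i#})" "M - {#i#} \<in> {M. P M \<noteq> \<zero>}" by auto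
      then show "M \<in> add_mset i ` {M. P M \<noteq> \<zero>}" by blast
    qed
    then have "finite {M. (P \<Otimes> i) M \<noteq> \<zero>}" using indexed_pmult finite_subset by blast
    moreover have "\<forall>M. (P \<Otimes> i) M \<in> carrier R" using indexed_pmult by (simp add: indexed_pmult_def)
    moreover have "set_mset M \<subseteq> I" if nz: "(P \<Otimes> i) M \<noteq> \<zero>" for M
    proof -
      from nz have "i \<in># M" "P (M - {#i#}) \<noteq> \<zero>" by (auto simp: indexed_pmult_def split: if_splits)
      then have "set_mset (M - {#i#}) \<subseteq> I" "M = add_mset i (M - {#i#})" using indexed_pmult by auto
      then show ?thesis using indexed_pmult(2) by (metis insert_subset set_mset_add_mset_insert)
    qed
    ultimately show ?case by blast
  qed
next
  assume *: "finite {M. P M \<noteq> \<zero>} \<and> (\<forall>M. P M \<in> carrier R) \<and> (\<forall>M. P M \<noteq> \<zero> \<longrightarrow> set_mset M \<subseteq> I)"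
  have mono: "(\<lambda>N. if N = M then c else \<zero>) \<in> indexed_pset I (carrier R)"
    if "c \<in> carrier R" "set_mset M \<subseteq> I" for c M
    using that
  proof (induction M)
    case empty
    have "(\<lambda>N. if N = {#} then c else \<zero>) = indexed_const c" by (auto simp: indexed_const_def)
    then show ?case using empty indexed_pset.indexed_const by metis
  next
    case (add i M)
    have "(\<lambda>N. if N = add_mset i M then c else \<zero>) = (\<lambda>N. if N = M then c else \<zero>) \<Otimes> i"
      by (auto simp: indexed_pmult_def fun_eq_iff)
    then show ?case using add indexed_pset.indexed_pmult
      by (metis (no_types, lifting) insert_subset set_mset_add_mset_insert)
  qed
  have "P \<in> indexed_pset I (carrier R)"
    if "finite S" "{M. P M \<noteq> \<zero>} = S" "\<forall>M. P M \<in> carrier R" "\<forall>M. P M \<noteq> \<zero> \<longrightarrow> set_mset M \<subseteq> I" for S P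
    using that
  proof (induction S arbitrary: P rule: finite_induct)
    case empty
    then have "P = indexed_const \<zero>" by (auto simp: indexed_const_def)
    then show ?case by (metis indexed_pset.indexed_const zero_closed)
  next
    case (insert M S)
    define Q where "Q = P(M := \<zero>)"
    have "Q \<in> indexed_pset I (carrier R)"
    proof (rule insert.IH)
      show "{M. Q M \<noteq> \<zero>} = S" using insert.prems(1) insert.hyps(2) by (auto simp: Q_def)
    qed (use insert.prems in \<open>auto simp: Q_def\<close>)
    moreover have "(\<lambda>N. if N = M then P M else \<zero>) \<in> indexed_pset I (carrier R)"
      using insert.prems by (intro mono) auto
    moreover have "P = Q \<Oplus> (\<lambda>N. if N = M then P M else \<zero>)"
      using insert.prems by (auto simp: Q_def indexed_padd_def fun_eq_iff)
    ultimately show ?case using indexed_pset.indexed_padd by metis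
  qed
  from this[OF _ refl] show "P \<in> mpoly_carrier R I" using * by (simp add: mpoly_carrier_def)
qed

context cring
begin

lemma mono_val_superset:
  assumes "finite A" "set_mset M \<subseteq> A" "x \<in> A \<rightarrow> carrier R"
  shows "mono_val R x M = (\<Otimes>i\<in>A. x i [^] count M i)"
  unfolding mono_val_def
proof (rule finprod_mono_neutral_cong_left)
  show "x i [^] count M i = \<one>" if "i \<in> A - set_mset M" for i
    using that by (simp add: not_in_iff)
qed (use assms in auto)

lemma mono_val_empty [simp]: "mono_val R x {#} = \<one>"
  by (simp add: mono_val_def)

lemma mono_val_closed [simp, intro]:
  assumes "x \<in> set_mset M \<rightarrow> carrier R"
  shows "mono_val R x M \<in> carrier R"
  unfolding mono_val_def using assms by (intro finprod_closed) auto

lemma mono_val_union: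
  assumes "x \<in> set_mset M \<rightarrow> carrier R" "x \<in> set_mset N \<rightarrow> carrier R"
  shows "mono_val R x (M + N) = mono_val R x M \<otimes> mono_val R x N"
proof -
  let ?A = "set_mset M \<union> set_mset N"
  have x: "x \<in> ?A \<rightarrow> carrier R" using assms by auto
  have "mono_val R x (M + N) = (\<Otimes>i\<in>?A. x i [^] count M i \<otimes> x i [^] count N i)"
  proof -
    have "mono_val R x (M + N) = (\<Otimes>i\<in>?A. x i [^] count (M + N) i)"
      using x by (intro mono_val_superset) auto
    also have "\<dots> = (\<Otimes>i\<in>?A. x i [^] count M i \<otimes> x i [^] count N i)"
      by (rule finprod_cong') (use x in \<open>auto simp: nat_pow_mult Pi_iff\<close>)
    finally show ?thesis .
  qed
  also have "\<dots> = (\<Otimes>i\<in>?A. x i [^] count M i) \<otimes> (\<Otimes>i\<in>?A. x i [^] count N i)"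
    using x by (intro finprod_multf) auto
  also have "\<dots> = mono_val R x M \<otimes> mono_val R x N"
    using x by (subst (1 2) mono_val_superset[of ?A]) auto
  finally show ?thesis .
qed

lemma mono_val_single:
  assumes "x i \<in> carrier R"
  shows "mono_val R x (replicate_mset n i) = x i [^] n"
  using assms by (subst mono_val_superset[of "{i}"]) auto

lemma mono_val_add_mset:
  assumes "x \<in> set_mset (add_mset i M) \<rightarrow> carrier R"
  shows "mono_val R x (add_mset i M) = x i \<otimes> mono_val R x M"
proof -
  have "mono_val R x {#i#} = x i" using mono_val_single[of x i 1] assms by simp
  then show ?thesis using mono_val_union[of x "{#i#}" M] assms by simp
qed

lemma mono_val_cong:
  assumes "\<And>i. i \<in># M \<Longrightarrow> x i = y i" "y \<in> set_mset M \<rightarrow> carrier R"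
  shows "mono_val R x M = mono_val R y M"
  unfolding mono_val_def using assms by (intro finprod_cong') auto

lemma mono_val_mult:
  assumes "x \<in> set_mset M \<rightarrow> carrier R" "y \<in> set_mset M \<rightarrow> carrier R"
  shows "mono_val R (\<lambda>i. x i \<otimes> y i) M = mono_val R x M \<otimes> mono_val R y M"
  using assms
proof (induction M)
  case (add i M)
  have x: "x i \<in> carrier R" "x \<in> set_mset M \<rightarrow> carrier R"
    and y: "y i \<in> carrier R" "y \<in> set_mset M \<rightarrow> carrier R" using add.prems by auto
  have "(\<lambda>i. x i \<otimes> y i) \<in> set_mset (add_mset i M) \<rightarrow> carrier R" using add.prems by auto
  then have "mono_val R (\<lambda>i. x i \<otimes> y i) (add_mset i M) = (x i \<otimes> y i) \<otimes> (mono_val R x M \<otimes> mono_val R y M)"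
    using add.IH x y by (subst mono_val_add_mset) auto
  also have "\<dots> = (x i \<otimes> mono_val R x M) \<otimes> (y i \<otimes> mono_val R y M)"
    using x y mono_val_closed[of x M] mono_val_closed[of y M] by (simp add: m_ac)
  finally show ?case using add.prems by (subst (1 2) mono_val_add_mset) auto
qed simp

text \<open>The support can shrink under homomorphisms, derivatives and reductions, so evaluation is
  computed over any finite set that contains it.\<close>

lemma mpoly_evalI:
  assumes "finite A" "\<And>M. M \<notin> A \<Longrightarrow> P M = \<zero>" "\<And>M. M \<in> A \<Longrightarrow> P M \<in> carrier R"
    "\<And>M. M \<in> A \<Longrightarrow> x \<in> set_mset M \<rightarrow> carrier R"
  shows "mpoly_eval R x P = (\<Oplus>M\<in>A. P M \<otimes> mono_val R x M)"
  unfolding mpoly_eval_mono_val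
  by (rule add.finprod_mono_neutral_cong_left) (use assms in \<open>auto intro!: m_closed\<close>)

lemma mpoly_eval_closed:
  assumes "P \<in> mpoly_carrier R I" "x \<in> I \<rightarrow> carrier R"
  shows "mpoly_eval R x P \<in> carrier R"
  unfolding mpoly_eval_mono_val
  using assms unfolding mpoly_carrier_iff
  by (intro finsum_closed) (auto intro!: m_closed mono_val_closed)

lemma mpoly_eval_cong:
  assumes "P \<in> mpoly_carrier R I" "\<And>i. i \<in> I \<Longrightarrow> x i = y i" "y \<in> I \<rightarrow> carrier R"
  shows "mpoly_eval R x P = mpoly_eval R y P"
  unfolding mpoly_eval_mono_val
proof (rule add.finprod_cong')
  fix M assume "M \<in> {M. P M \<noteq> \<zero>}"
  then have "set_mset M \<subseteq> I" using assms(1) unfolding mpoly_carrier_iff by auto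
  then have "mono_val R x M = mono_val R y M" using assms by (intro mono_val_cong) auto
  then show "P M \<otimes> mono_val R x M = P M \<otimes> mono_val R y M" by simp
next
  show "(\<lambda>M. P M \<otimes> mono_val R y M) \<in> {M. P M \<noteq> \<zero>} \<rightarrow> carrier R"
  proof
    fix M assume "M \<in> {M. P M \<noteq> \<zero>}"
    then have "set_mset M \<subseteq> I" "P M \<in> carrier R" using assms(1) unfolding mpoly_carrier_iff by auto
    then have "y \<in> set_mset M \<rightarrow> carrier R" "P M \<in> carrier R" using assms(3) by auto
    then show "P M \<otimes> mono_val R y M \<in> carrier R" by simp
  qed
qed simp

end

lemma mono_val_hom:
  assumes "cring R" "cring S" "h \<in> ring_hom R S" "x \<in> set_mset M \<rightarrow> carrier R"
  shows "h (mono_val R x M) = mono_val S (h \<circ> x) M"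
proof -
  interpret R: cring R by fact
  interpret S: cring S by fact
  interpret h: ring_hom_cring R S h using assms by (intro ring_hom_cring.intro ring_hom_cring_axioms.intro)
  show ?thesis using assms(4)
  proof (induction M)
    case (add i M)
    have hx: "h \<circ> x \<in> set_mset (add_mset i M) \<rightarrow> carrier S" using add.prems by (auto simp: Pi_iff)
    have "x i \<in> carrier R" "x \<in> set_mset M \<rightarrow> carrier R" using add.prems by auto
    then show ?case using add
      by (simp add: R.mono_val_add_mset[OF add.prems] S.mono_val_add_mset[OF hx, unfolded o_def] R.mono_val_closed)
  qed simp
qed

lemma mpoly_eval_hom:
  assumes "cring R" "cring S" "h \<in> ring_hom R S" "P \<in> mpoly_carrier R I" "x \<in> I \<rightarrow> carrier R"
  shows "mpoly_eval S (h \<circ> x) (h \<circ> P) = h (mpoly_eval R x P)"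
proof -
  interpret R: cring R by fact
  interpret S: cring S by fact
  interpret h: ring_hom_cring R S h using assms by (intro ring_hom_cring.intro ring_hom_cring_axioms.intro)
  let ?A = "{M. P M \<noteq> \<zero>\<^bsub>R\<^esub>}"
  note P = assms(4)[unfolded R.mpoly_carrier_iff]
  have x: "x \<in> set_mset M \<rightarrow> carrier R" if "M \<in> ?A" for M using that P assms(5) by blast
  have "mpoly_eval S (h \<circ> x) (h \<circ> P) = (\<Oplus>\<^bsub>S\<^esub>M\<in>?A. (h \<circ> P) M \<otimes>\<^bsub>S\<^esub> mono_val S (h \<circ> x) M)"
  proof (rule S.mpoly_evalI)
    fix M assume "M \<in> ?A"
    then show "h \<circ> x \<in> set_mset M \<rightarrow> carrier S" using x[of M] by (auto simp: Pi_iff)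
  qed (use P in auto)
  also have "\<dots> = (\<Oplus>\<^bsub>S\<^esub>M\<in>?A. h (P M \<otimes>\<^bsub>R\<^esub> mono_val R x M))"
  proof (rule S.add.finprod_cong')
    fix M assume M: "M \<in> ?A"
    show "(h \<circ> P) M \<otimes>\<^bsub>S\<^esub> mono_val S (h \<circ> x) M = h (P M \<otimes>\<^bsub>R\<^esub> mono_val R x M)"
      using P x[OF M] by (simp add: R.mono_val_closed mono_val_hom[OF assms(1-3) x[OF M]])
  qed (use P x in \<open>auto simp: R.mono_val_closed\<close>)
  also have "\<dots> = h (mpoly_eval R x P)"
    unfolding mpoly_eval_mono_val using P x
    by (subst h.hom_finsum) (auto intro!: R.m_closed R.mono_val_closed simp: o_def)
  finally show ?thesis .
qed

text \<open>The coefficient of the \<open>d\<close>-th power of the indeterminate \<open>i\<close>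
  when \<open>P\<close> is read as a polynomial in \<open>i\<close> over the other indeterminates.
  Monomials containing \<open>i\<close> get coefficient zero, so \<open>i\<close> no longer occurs
  in a slice.\<close>

definition poly_slice :: "('a, 'm) ring_scheme \<Rightarrow> 'i \<Rightarrow> nat \<Rightarrow> ('i multiset \<Rightarrow> 'a) \<Rightarrow> 'i multiset \<Rightarrow> 'a" where
  "poly_slice R i d P = (\<lambda>M. if i \<in># M then \<zero>\<^bsub>R\<^esub> else P (M + replicate_mset d i))"

context cring
begin

lemma poly_slice_supp:
  "{M. poly_slice R i d P M \<noteq> \<zero>} = (\<lambda>M. M - replicate_mset d i) ` {M. P M \<noteq> \<zero> \<and> count M i = d}"
proof safe
  fix M assume "poly_slice R i d P M \<noteq> \<zero>"
  then have M: "i \<notin># M" "P (M + replicate_mset d i) \<noteq> \<zero>" by (auto simp: poly_slice_def split: if_splits)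
  then show "M \<in> (\<lambda>M. M - replicate_mset d i) ` {M. P M \<noteq> \<zero> \<and> count M i = d}"
    by (intro image_eqI[of _ _ "M + replicate_mset d i"]) (auto simp: not_in_iff)
next
  fix M assume M: "P M \<noteq> \<zero>" "d = count M i" "poly_slice R i (count M i) P (M - replicate_mset (count M i) i) = \<zero>"
  have "i \<notin># M - replicate_mset (count M i) i" by (simp add: not_in_iff)
  moreover have "M - replicate_mset (count M i) i + replicate_mset (count M i) i = M"
    by (intro multiset_eqI) auto
  ultimately show False using M by (simp add: poly_slice_def)
qed

lemma poly_slice_carrier:
  assumes "P \<in> mpoly_carrier R I"
  shows "poly_slice R i d P \<in> mpoly_carrier R (I - {i})"
  unfolding mpoly_carrier_iff
proof (intro conjI allI impI)
  note P = assms[unfolded mpoly_carrier_iff]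
  show "finite {M. poly_slice R i d P M \<noteq> \<zero>}"
    unfolding poly_slice_supp using P by auto
  show "poly_slice R i d P M \<in> carrier R" for M using P by (simp add: poly_slice_def)
  fix M assume "poly_slice R i d P M \<noteq> \<zero>"
  then have "i \<notin># M" "P (M + replicate_mset d i) \<noteq> \<zero>" by (auto simp: poly_slice_def split: if_splits)
  then have "set_mset (M + replicate_mset d i) \<subseteq> I" "i \<notin># M" using P by blast+
  then show "set_mset M \<subseteq> I - {i}" by auto
qed

lemma mpoly_degree_bound:
  assumes "P \<in> mpoly_carrier R I"
  obtains D where "\<And>M. P M \<noteq> \<zero> \<Longrightarrow> count M i \<le> D"
proof -
  have "finite ((\<lambda>M. count M i) ` {M. P M \<noteq> \<zero>})" using assms by (auto simp: mpoly_carrier_iff)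
  then have "count M i \<le> Max ((\<lambda>M. count M i) ` {M. P M \<noteq> \<zero>})" if "P M \<noteq> \<zero>" for M
    using that by (intro Max_ge) auto
  then show ?thesis by (rule that)
qed

text \<open>Grouping the monomials by their exponent of \<open>i\<close> turns a statement about
  several indeterminates into one about a single indeterminate, to which the notions algebraic and
  transcendental apply.\<close>

lemma mpoly_eval_slices:
  assumes P: "P \<in> mpoly_carrier R I" and x: "x \<in> I \<rightarrow> carrier R" "x i \<in> carrier R"
    and D: "\<And>M. P M \<noteq> \<zero> \<Longrightarrow> count M i \<le> D"
  shows "mpoly_eval R x P = (\<Oplus>d\<in>{..D}. mpoly_eval R x (poly_slice R i d P) \<otimes> x i [^] d)"
proof -
  note P' = P[unfolded mpoly_carrier_iff]
  define S where "S d = {M. P M \<noteq> \<zero> \<and> count M i = d}" for d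
  have fin: "finite (S d)" for d using P' by (auto simp: S_def)
  have xS: "x \<in> set_mset M \<rightarrow> carrier R" if "M \<in> S d" for M d using that P' x by (auto simp: S_def)
  have un: "{M. P M \<noteq> \<zero>} = (\<Union>d\<in>{..D}. S d)" using D by (auto simp: S_def)
  have "mpoly_eval R x P = (\<Oplus>d\<in>{..D}. \<Oplus>M\<in>S d. P M \<otimes> mono_val R x M)"
    unfolding mpoly_eval_mono_val un
    by (rule add.finprod_UN_disjoint)
       (use fin xS P' in \<open>auto simp: pairwise_def disjnt_def S_def\<close>)
  also have "\<dots> = (\<Oplus>d\<in>{..D}. mpoly_eval R x (poly_slice R i d P) \<otimes> x i [^] d)"
  proof (rule add.finprod_cong')
    show "(\<lambda>d. mpoly_eval R x (poly_slice R i d P) \<otimes> x i [^] d) \<in> {..D} \<rightarrow> carrier R"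
      using mpoly_eval_closed[OF poly_slice_carrier[OF P]] x by (auto intro!: m_closed)
    fix d assume "d \<in> {..D}"
    let ?f = "\<lambda>M. M - replicate_mset d i"
    have inj: "inj_on ?f (S d)"
    proof (rule inj_onI)
      fix M N assume "M \<in> S d" "N \<in> S d" and eq: "?f M = ?f N"
      then have "replicate_mset d i \<subseteq># M" "replicate_mset d i \<subseteq># N"
        by (simp_all add: S_def count_le_replicate_mset_subset_eq[symmetric])
      then show "M = N" using eq by (metis subset_mset.diff_add)
    qed
    have slice: "poly_slice R i d P (?f M) = P M" "x \<in> set_mset (?f M) \<rightarrow> carrier R"
        "mono_val R x M = mono_val R x (?f M) \<otimes> x i [^] d" if "M \<in> S d" for M
    proof -
      have sub: "replicate_mset d i \<subseteq># M" and c: "count M i = d"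
        using that by (simp_all add: S_def count_le_replicate_mset_subset_eq[symmetric])
      have M: "?f M + replicate_mset d i = M" using sub by (rule subset_mset.diff_add)
      have "i \<notin># ?f M" using c by (simp add: not_in_iff)
      then show "poly_slice R i d P (?f M) = P M" using M by (simp add: poly_slice_def)
      show xs: "x \<in> set_mset (?f M) \<rightarrow> carrier R" using xS[OF that] by (auto dest: in_diffD)
      have "mono_val R x (?f M + replicate_mset d i) = mono_val R x (?f M) \<otimes> x i [^] d"
        using xs x by (subst mono_val_union) (auto simp: mono_val_single split: if_splits)
      then show "mono_val R x M = mono_val R x (?f M) \<otimes> x i [^] d" using M by simp
    qed
    have "mpoly_eval R x (poly_slice R i d P) \<otimes> x i [^] d
        = (\<Oplus>M\<in>?f ` S d. poly_slice R i d P M \<otimes> mono_val R x M) \<otimes> x i [^] d"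
      unfolding mpoly_eval_mono_val poly_slice_supp S_def ..
    also have "\<dots> = (\<Oplus>M\<in>S d. poly_slice R i d P (?f M) \<otimes> mono_val R x (?f M)) \<otimes> x i [^] d"
      using slice P' by (subst add.finprod_reindex[OF _ inj]) (auto intro!: m_closed simp: S_def)
    also have "\<dots> = (\<Oplus>M\<in>S d. (P M \<otimes> mono_val R x (?f M)) \<otimes> x i [^] d)"
    proof -
      have "(\<Oplus>M\<in>S d. poly_slice R i d P (?f M) \<otimes> mono_val R x (?f M)) = (\<Oplus>M\<in>S d. P M \<otimes> mono_val R x (?f M))"
        using slice P' by (intro add.finprod_cong') (auto intro!: m_closed)
      then show ?thesis using slice P' x fin by (simp add: finsum_ldistr Pi_iff)
    qed
    also have "\<dots> = (\<Oplus>M\<in>S d. P M \<otimes> mono_val R x M)"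
      using slice P' x xS by (intro add.finprod_cong') (auto intro!: m_closed simp: m_assoc)
    finally show "(\<Oplus>M\<in>S d. P M \<otimes> mono_val R x M) = mpoly_eval R x (poly_slice R i d P) \<otimes> x i [^] d" ..
  qed simp
  finally show ?thesis .
qed

end

section \<open>Algebraic elements of a field\<close>

lemma (in abelian_monoid) finsum_swap:
  assumes "finite A" "finite B" "\<And>i j. i \<in> A \<Longrightarrow> j \<in> B \<Longrightarrow> f i j \<in> carrier G"
  shows "(\<Oplus>i\<in>A. \<Oplus>j\<in>B. f i j) = (\<Oplus>j\<in>B. \<Oplus>i\<in>A. f i j)"
  using assms(1,3)
proof (induction A rule: finite_induct)
  case empty
  then show ?case by simp
next
  case (insert a A)
  have "(\<Oplus>i\<in>insert a A. \<Oplus>j\<in>B. f i j) = (\<Oplus>j\<in>B. f a j) \<oplus> (\<Oplus>j\<in>B. \<Oplus>i\<in>A. f i j)"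
    using insert by (subst finsum_insert) (auto intro!: finsum_closed)
  also have "\<dots> = (\<Oplus>j\<in>B. f a j \<oplus> (\<Oplus>i\<in>A. f i j))"
    using insert by (intro finsum_addf[symmetric]) (auto intro!: finsum_closed)
  also have "\<dots> = (\<Oplus>j\<in>B. \<Oplus>i\<in>insert a A. f i j)"
    using insert by (intro add.finprod_cong') (auto intro!: finsum_closed)
  finally show ?case .
qed

lemma (in ring) subring_finsum:
  assumes "subring K R" "\<And>i. i \<in> A \<Longrightarrow> f i \<in> K"
  shows "finsum R f A \<in> K"
proof (cases "finite A")
  case True
  then show ?thesis using assms(2)
  proof (induction A rule: finite_induct)
    case empty
    then show ?case using subringE(2)[OF assms(1)] by simp
  next
    case (insert a A)
    have "f \<in> insert a A \<rightarrow> carrier R" using insert.prems subringE(1)[OF assms(1)] by auto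
    then show ?case using insert subringE(7)[OF assms(1)] by simp
  qed
next
  case False
  then show ?thesis using subringE(2)[OF assms(1)] by (simp add: finsum_infinite)
qed

lemma (in ring) subring_nat_pow:
  assumes "subring K R" "x \<in> K"
  shows "x [^] (n::nat) \<in> K"
  using subringE(3,6)[OF assms(1)] assms(2) by (induction n) auto

context ring
begin

text \<open>Coefficient lists start with the leading coefficient, whereas the exchange property
  rearranges double sums indexed by exponents; hence the \<open>rev\<close>.\<close>

lemma eval_coeff_list:
  assumes "\<And>i. i < n \<Longrightarrow> c i \<in> carrier R" "x \<in> carrier R"
  shows "eval (rev (map c [0..<n])) x = (\<Oplus>i\<in>{..<n}. c i \<otimes> x [^] i)"
  using assms(1)
proof (induction n)
  case (Suc n)
  have c: "c n \<in> carrier R" "\<And>i. i < n \<Longrightarrow> c i \<in> carrier R" using Suc.prems by auto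
  have "eval (rev (map c [0..<Suc n])) x = c n \<otimes> x [^] n \<oplus> (\<Oplus>i\<in>{..<n}. c i \<otimes> x [^] i)"
    using Suc.IH c by simp
  also have "\<dots> = (\<Oplus>i\<in>{..<Suc n}. c i \<otimes> x [^] i)"
    using c assms(2) by (subst lessThan_Suc, subst finsum_insert) auto
  finally show ?case .
qed simp

lemma eval_as_finsum:
  assumes "set p \<subseteq> carrier R" "x \<in> carrier R" "length p \<le> n"
  shows "eval p x = (\<Oplus>i\<in>{..<n}. coeff p i \<otimes> x [^] i)"
proof -
  have "eval p x = eval (rev (map (coeff p) [0..<length p])) x"
    using coeff_list[of p] by (simp add: rev_map)
  also have "\<dots> = (\<Oplus>i\<in>{..<length p}. coeff p i \<otimes> x [^] i)"
    using assms by (intro eval_coeff_list) auto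
  also have "\<dots> = (\<Oplus>i\<in>{..<n}. coeff p i \<otimes> x [^] i)"
    using assms coeff_length[of p] by (intro add.finprod_mono_neutral_cong_left) auto
  finally show ?thesis .
qed

lemma normalize_eq_Nil: "normalize p = [] \<Longrightarrow> set p \<subseteq> {\<zero>}"
  by (induction p) (auto split: if_splits)

lemma coeff_in_subring:
  assumes "subring K R" "set p \<subseteq> K"
  shows "coeff p i \<in> K"
proof -
  have "coeff p i \<in> set p \<union> {\<zero>}" using coeff_img(3)[of p] by (metis rangeI)
  then show ?thesis using assms(2) subringE(2)[OF assms(1)] by auto
qed

end

context field
begin

text \<open>No leading coefficient is singled out: \<open>normalize\<close> drops leading zeros, and
  the nonzero \<open>c j\<close> keeps the list from becoming empty.\<close>

lemma algebraic_coeffsI: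
  assumes K: "subring K R" and x: "x \<in> carrier R" and c: "\<And>i. i < (n::nat) \<Longrightarrow> c i \<in> K"
    and nz: "j < n" "c j \<noteq> \<zero>" and z: "(\<Oplus>i\<in>{..<n}. c i \<otimes> x [^] i) = \<zero>"
  shows "(algebraic over K) x"
proof -
  let ?l = "rev (map c [0..<n])"
  have l: "set ?l \<subseteq> K" using c by auto
  then have lc: "set ?l \<subseteq> carrier R" using subringE(1)[OF K] by auto
  show ?thesis
  proof (rule algebraicI[of "normalize ?l"])
    show "normalize ?l \<in> carrier (K[X])"
      using normalize_gives_polynomial[OF l] by (simp add: univ_poly_carrier)
    show "normalize ?l \<noteq> []"
    proof
      assume "normalize ?l = []"
      then have "set ?l \<subseteq> {\<zero>}" by (rule normalize_eq_Nil)
      moreover have "c j \<in> set ?l" using nz(1) by auto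
      ultimately show False using nz(2) by blast
    qed
    have "eval ?l x = \<zero>"
      using z c x subringE(1)[OF K] by (subst eval_coeff_list) auto
    then show "eval (normalize ?l) x = \<zero>" using eval_normalize[OF lc x] by simp
  qed
qed

lemma algebraic_coeffsE:
  assumes "subring K R" "x \<in> carrier R" "(algebraic over K) x"
  obtains n and c :: "nat \<Rightarrow> 'a" and j where "\<And>i. c i \<in> K" "j < n" "c j \<noteq> \<zero>" "(\<Oplus>i\<in>{..<n}. c i \<otimes> x [^] i) = \<zero>"
proof -
  obtain p where p: "p \<in> carrier (K[X])" "p \<noteq> []" "eval p x = \<zero>"
    using algebraicE[OF assms] by blast
  then have pK: "set p \<subseteq> K" and lead: "hd p \<noteq> \<zero>"
    by (auto simp: univ_poly_carrier[symmetric] polynomial_def)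
  then have pc: "set p \<subseteq> carrier R" using subringE(1)[OF assms(1)] by auto
  show ?thesis
  proof (rule that[of "coeff p" "length p - 1" "length p"])
    show "coeff p i \<in> K" for i by (rule coeff_in_subring[OF assms(1) pK])
    show "coeff p (length p - 1) \<noteq> \<zero>" using lead p(2) by (metis lead_coeff_simp)
    show "length p - 1 < length p" using p(2) by (cases p) auto
    show "(\<Oplus>i\<in>{..<length p}. coeff p i \<otimes> x [^] i) = \<zero>"
      using p(3) eval_as_finsum[OF pc assms(2) order_refl] by simp
  qed
qed

lemma transcendental_coeffsD:
  fixes n :: nat
  assumes "subring K R" "x \<in> carrier R" "(transcendental over K) x" "\<And>i. i < n \<Longrightarrow> c i \<in> K"
    "(\<Oplus>i\<in>{..<n}. c i \<otimes> x [^] i) = \<zero>" "i < n"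
  shows "c i = \<zero>"
  using algebraic_coeffsI[of K x n c i] assms by (auto simp: over_def)

definition alg_cl :: "'a set \<Rightarrow> 'a set" where
  "alg_cl K = {x \<in> carrier R. (algebraic over K) x}"

lemma alg_cl_subfield: "subfield K R \<Longrightarrow> subfield (alg_cl K) R"
  unfolding alg_cl_def by (rule subfield_of_algebraics)

lemma alg_cl_incl: "subfield K R \<Longrightarrow> K \<subseteq> alg_cl K"
  unfolding alg_cl_def using algebraic_self subfieldE(1,3) by blast

text \<open>The coefficients of a relation for \<open>x\<close> generate an extension of
  \<open>K\<close> of finite dimension, over which \<open>x\<close> is algebraic. Dimensions are
  multiplicative in towers, so \<open>x\<close> lies in an extension of finite dimension over
  \<open>K\<close>.\<close>

lemma alg_cl_idem:
  assumes K: "subfield K R" and x: "x \<in> carrier R" "(algebraic over (alg_cl K)) x"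
  shows "x \<in> alg_cl K"
proof -
  obtain p where p: "p \<in> carrier ((alg_cl K)[X])" "p \<noteq> []" "eval p x = \<zero>"
    using algebraicE[OF subfieldE(1)[OF alg_cl_subfield[OF K]] x] by blast
  then have pK: "set p \<subseteq> alg_cl K" and lead: "hd p \<noteq> \<zero>"
    by (auto simp: univ_poly_carrier[symmetric] polynomial_def)
  then have pc: "set p \<subseteq> carrier R" and pa: "\<And>y. y \<in> set p \<Longrightarrow> (algebraic over K) y"
    by (auto simp: alg_cl_def)
  let ?A = "finite_extension K p"
  have A: "subfield ?A R" by (rule finite_extension_is_subfield[OF K pc pa])
  have finA: "finite_dimension K ?A" by (rule finite_extension_finite_dimension(1)[OF K pc pa])
  have "p \<in> carrier (?A[X])"
    using finite_extension_mem[OF subfieldE(1)[OF K] pc] lead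
    by (auto simp: univ_poly_carrier[symmetric] polynomial_def)
  then have xA: "(algebraic over ?A) x" using p(2,3) by (intro algebraicI)
  have "finite_dimension ?A (simple_extension ?A x)"
    using finite_dimension_simple_extension[OF A x(1)] xA by simp
  then have "finite_dimension K (simple_extension ?A x)"
    by (rule telescopic_base_dim(1)[OF K A finA])
  then have "(algebraic over K) x"
    by (rule finite_dimension_imp_algebraic[OF K simple_extension_is_subring[OF subfieldE(1)[OF A] x(1)]
          _ simple_extension_mem[OF subfieldE(1)[OF A] x(1)]])
  then show ?thesis using x(1) by (simp add: alg_cl_def)
qed

lemma alg_cl_mono: "K \<subseteq> K' \<Longrightarrow> alg_cl K \<subseteq> alg_cl K'"
  unfolding alg_cl_def using algebraic_mono by blast

lemma alg_cl_least:
  assumes "subfield K' R" "K \<subseteq> alg_cl K'"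
  shows "alg_cl K \<subseteq> alg_cl K'"
proof
  fix x assume "x \<in> alg_cl K"
  then have "x \<in> carrier R" "(algebraic over (alg_cl K')) x"
    using algebraic_mono[OF assms(2)] by (auto simp: alg_cl_def)
  then show "x \<in> alg_cl K'" by (rule alg_cl_idem[OF assms(1)])
qed

section \<open>Fields of fractions inside a given field\<close>

definition fracs :: "'a set \<Rightarrow> 'a set" where
  "fracs D = {a \<otimes> inv b | a b. a \<in> D \<and> b \<in> D \<and> b \<noteq> \<zero>}"

lemma inv_closed_nz [simp]: "x \<in> carrier R \<Longrightarrow> x \<noteq> \<zero> \<Longrightarrow> inv x \<in> carrier R"
  and inv_nz [simp]: "x \<in> carrier R \<Longrightarrow> x \<noteq> \<zero> \<Longrightarrow> inv x \<noteq> \<zero>"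
  and r_inv_nz [simp]: "x \<in> carrier R \<Longrightarrow> x \<noteq> \<zero> \<Longrightarrow> x \<otimes> inv x = \<one>"
  and l_inv_nz [simp]: "x \<in> carrier R \<Longrightarrow> x \<noteq> \<zero> \<Longrightarrow> inv x \<otimes> x = \<one>"
proof -
  assume x: "x \<in> carrier R" "x \<noteq> \<zero>"
  then have u: "x \<in> Units R" by (simp add: field_Units)
  then show "inv x \<in> carrier R" "x \<otimes> inv x = \<one>" "inv x \<otimes> x = \<one>" by simp_all
  then show "inv x \<noteq> \<zero>" using x by auto
qed

lemma inv_mult_nz:
  assumes "b \<in> carrier R" "d \<in> carrier R" "b \<noteq> \<zero>" "d \<noteq> \<zero>"
  shows "inv (b \<otimes> d) = inv b \<otimes> inv d"
proof -
  have "(b \<otimes> d) \<otimes> (inv b \<otimes> inv d) = (b \<otimes> inv b) \<otimes> (d \<otimes> inv d)"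
    using assms by (simp add: m_ac del: r_inv_nz l_inv_nz)
  then have "(b \<otimes> d) \<otimes> (inv b \<otimes> inv d) = \<one>" using assms by simp
  then show ?thesis using assms by (intro comm_inv_char) auto
qed

lemma frac_add:
  assumes "a \<in> carrier R" "b \<in> carrier R" "c \<in> carrier R" "d \<in> carrier R" "b \<noteq> \<zero>" "d \<noteq> \<zero>"
  shows "a \<otimes> inv b \<oplus> c \<otimes> inv d = (a \<otimes> d \<oplus> c \<otimes> b) \<otimes> inv (b \<otimes> d)"
proof -
  have "(a \<otimes> d \<oplus> c \<otimes> b) \<otimes> (inv b \<otimes> inv d) = (a \<otimes> d) \<otimes> (inv b \<otimes> inv d) \<oplus> (c \<otimes> b) \<otimes> (inv b \<otimes> inv d)"
    using assms by (intro l_distr) auto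
  also have "(a \<otimes> d) \<otimes> (inv b \<otimes> inv d) = a \<otimes> inv b \<otimes> (d \<otimes> inv d)"
    using assms by (simp add: m_ac del: r_inv_nz l_inv_nz)
  also have "(c \<otimes> b) \<otimes> (inv b \<otimes> inv d) = c \<otimes> inv d \<otimes> (b \<otimes> inv b)"
    using assms by (simp add: m_ac del: r_inv_nz l_inv_nz)
  finally show ?thesis using assms by (simp add: inv_mult_nz)
qed

lemma frac_mult:
  assumes "a \<in> carrier R" "b \<in> carrier R" "c \<in> carrier R" "d \<in> carrier R" "b \<noteq> \<zero>" "d \<noteq> \<zero>"
  shows "(a \<otimes> inv b) \<otimes> (c \<otimes> inv d) = (a \<otimes> c) \<otimes> inv (b \<otimes> d)"
  using assms by (simp add: inv_mult_nz m_ac)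

lemma inv_frac:
  assumes "a \<in> carrier R" "b \<in> carrier R" "a \<noteq> \<zero>" "b \<noteq> \<zero>"
  shows "inv (a \<otimes> inv b) = b \<otimes> inv a"
proof -
  have "inv (inv b) = b" using assms by (intro comm_inv_char) auto
  then show ?thesis using assms by (simp add: inv_mult_nz m_comm)
qed

lemma fracs_subfield:
  assumes D: "subring D R"
  shows "subfield (fracs D) R" "D \<subseteq> fracs D"
proof -
  note E = subringE[OF D]
  have car: "\<And>x. x \<in> D \<Longrightarrow> x \<in> carrier R" using E(1) by auto
  have fI: "a \<otimes> inv b \<in> fracs D" if "a \<in> D" "b \<in> D" "b \<noteq> \<zero>" for a b
    using that by (auto simp: fracs_def)
  show sub: "D \<subseteq> fracs D"
  proof
    fix x assume "x \<in> D"
    moreover have "inv \<one> = \<one>" by simp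
    ultimately show "x \<in> fracs D" using fI[of x \<one>] E(3) car by simp
  qed
  show "subfield (fracs D) R"
  proof (rule subfieldI'[OF subringI])
    show "fracs D \<subseteq> carrier R" using car by (auto simp: fracs_def)
    show "\<one> \<in> fracs D" using sub E(3) by auto
    fix x assume "x \<in> fracs D"
    then obtain a b where x: "x = a \<otimes> inv b" "a \<in> D" "b \<in> D" "b \<noteq> \<zero>" by (auto simp: fracs_def)
    have "\<ominus> x = (\<ominus> a) \<otimes> inv b" using x car by (simp add: l_minus)
    then show "\<ominus> x \<in> fracs D" using fI x E(5) by simp
    fix y assume "y \<in> fracs D"
    then obtain c d where y: "y = c \<otimes> inv d" "c \<in> D" "d \<in> D" "d \<noteq> \<zero>" by (auto simp: fracs_def)
    have bd: "b \<otimes> d \<in> D" "b \<otimes> d \<noteq> \<zero>" using x y car E(6) by (auto simp: integral_iff)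
    show "x \<otimes> y \<in> fracs D"
      unfolding x(1) y(1) using x y bd car E(6) by (subst frac_mult) (auto intro!: fI)
    show "x \<oplus> y \<in> fracs D"
      unfolding x(1) y(1) using x y bd car E(6,7) by (subst frac_add) (auto intro!: fI)
  next
    fix k assume "k \<in> fracs D - {\<zero>}"
    then obtain a b where k: "k = a \<otimes> inv b" "a \<in> D" "b \<in> D" "b \<noteq> \<zero>" "k \<noteq> \<zero>" by (auto simp: fracs_def)
    have "a \<noteq> \<zero>" using k car by auto
    then show "inv k \<in> fracs D" unfolding k(1) using k car by (subst inv_frac) (auto intro!: fI)
  qed
qed

text \<open>A relation is multiplied by a common denominator of its coefficients, which is built up
  for the first \<open>m\<close> coefficients by induction.\<close>

lemma algebraic_fracs:
  assumes D: "subring D R" and x: "x \<in> carrier R" "(algebraic over (fracs D)) x"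
  shows "(algebraic over D) x"
proof -
  note E = subringE[OF D]
  obtain n j :: nat and c where c: "\<And>i. c i \<in> fracs D" "j < n" "c j \<noteq> \<zero>" "(\<Oplus>i\<in>{..<n}. c i \<otimes> x [^] i) = \<zero>"
    using algebraic_coeffsE[OF subfieldE(1)[OF fracs_subfield(1)[OF D]] x] by metis
  have cc: "c i \<in> carrier R" for i using c(1) fracs_subfield(1)[OF D] subfieldE(3) by blast
  have "\<exists>b\<in>D. b \<noteq> \<zero> \<and> (\<forall>i<m. b \<otimes> c i \<in> D)" for m
  proof (induction m)
    case 0
    then show ?case using E(3) by (intro bexI[of _ \<one>]) auto
  next
    case (Suc m)
    then obtain b where b: "b \<in> D" "b \<noteq> \<zero>" "\<forall>i<m. b \<otimes> c i \<in> D" by blast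
    obtain u w where uw: "c m = u \<otimes> inv w" "u \<in> D" "w \<in> D" "w \<noteq> \<zero>"
      using c(1)[of m] by (auto simp: fracs_def)
    note car = b(1)[THEN subsetD[OF E(1)]] uw(2,3)[THEN subsetD[OF E(1)]]
    have "(b \<otimes> w) \<otimes> c i \<in> D" if "i < Suc m" for i
    proof (cases "i = m")
      case True
      have "(b \<otimes> w) \<otimes> (u \<otimes> inv w) = (b \<otimes> u) \<otimes> (w \<otimes> inv w)"
        using car uw(4) by (simp add: m_ac del: r_inv_nz l_inv_nz)
      then have "(b \<otimes> w) \<otimes> c m = b \<otimes> u" using car uw by simp
      then show ?thesis using True b uw E(6) by simp
    next
      case False
      then have "b \<otimes> c i \<in> D" using that b by simp
      moreover have "(b \<otimes> w) \<otimes> c i = w \<otimes> (b \<otimes> c i)" using car cc by (simp add: m_ac)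
      ultimately show ?thesis using E(6) uw by simp
    qed
    moreover have "b \<otimes> w \<in> D" "b \<otimes> w \<noteq> \<zero>" using b uw car E(6) by (auto simp: integral_iff)
    ultimately show ?case by blast
  qed
  then obtain b where b: "b \<in> D" "b \<noteq> \<zero>" "\<forall>i<n. b \<otimes> c i \<in> D" by blast
  have bc: "b \<in> carrier R" using b E(1) by auto
  have "(\<Oplus>i\<in>{..<n}. (b \<otimes> c i) \<otimes> x [^] i) = b \<otimes> (\<Oplus>i\<in>{..<n}. c i \<otimes> x [^] i)"
    using bc cc x by (subst finsum_rdistr) (auto simp: m_assoc intro!: add.finprod_cong')
  then have "(\<Oplus>i\<in>{..<n}. (b \<otimes> c i) \<otimes> x [^] i) = \<zero>" using c(4) bc by simp
  moreover have "b \<otimes> c j \<noteq> \<zero>" using b c bc cc by (simp add: integral_iff)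
  ultimately show ?thesis using b c(2) by (intro algebraic_coeffsI[OF D x(1)]) auto
qed

lemma generate_field_subset_fracs:
  assumes E: "subfield E R" and t: "t \<in> carrier R"
  shows "generate_field R (insert t E) \<subseteq> fracs (simple_extension E t)"
proof -
  have S: "subring (simple_extension E t) R"
    using simple_extension_is_subring[OF subfieldE(1)[OF E] t] .
  have "insert t E \<subseteq> simple_extension E t"
    using simple_extension_mem[OF subfieldE(1)[OF E] t] simple_extension_incl[OF subfieldE(3)[OF E] t] by auto
  then have "insert t E \<subseteq> fracs (simple_extension E t)" using fracs_subfield(2)[OF S] by blast
  then show ?thesis by (intro generate_field_min_subfield1 fracs_subfield(1)[OF S])
    (use t subfieldE(3)[OF E] in auto)
qed

text \<open>A polynomial relation between \<open>y\<close> and \<open>t\<close> over \<open>E\<close>, read as a polynomial in \<open>t\<close>, is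
  nonzero because \<open>y\<close> is transcendental over \<open>E\<close>.\<close>

lemma algebraic_exchange:
  assumes E: "subfield E R" and y: "y \<in> carrier R" "(transcendental over E) y"
    and t: "t \<in> carrier R" and alg: "(algebraic over (generate_field R (insert t E))) y"
  shows "(algebraic over (generate_field R (insert y E))) t"
proof -
  let ?D = "simple_extension E t" and ?K = "generate_field R (insert y E)"
  have EK: "insert y E \<subseteq> carrier R" using y subfieldE(3)[OF E] by auto
  have D: "subring ?D R" using simple_extension_is_subring[OF subfieldE(1)[OF E] t] .
  have K: "subfield ?K R" by (rule generate_field_is_subfield[OF EK])
  have "(algebraic over ?D) y"
    using algebraic_mono[OF generate_field_subset_fracs[OF E t] alg] by (rule algebraic_fracs[OF D y(1)])
  then obtain n j0 :: nat and c where c: "\<And>i. c i \<in> ?D" "j0 < n" "c j0 \<noteq> \<zero>" "(\<Oplus>i\<in>{..<n}. c i \<otimes> y [^] i) = \<zero>"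
    using algebraic_coeffsE[OF D y(1)] by metis
  have "\<exists>p. p \<in> carrier (E[X]) \<and> c i = eval p t" for i
    using c(1)[of i] simple_extension_as_eval_img[OF subfieldE(3)[OF E] t] by auto
  then obtain u where u: "\<And>i. u i \<in> carrier (E[X])" "\<And>i. c i = eval (u i) t" by metis
  have uE: "set (u i) \<subseteq> E" for i
    using u(1)[of i] by (auto simp: univ_poly_carrier[symmetric] polynomial_def)
  then have uc: "set (u i) \<subseteq> carrier R" for i using subfieldE(3)[OF E] by blast
  \<comment> \<open>A common bound for the degrees in \<open>t\<close> makes the double sum over
    \<open>e i j\<close> rectangular. It can then be rearranged by powers of \<open>t\<close>, with
    the coefficients \<open>d j\<close>, polynomials in \<open>y\<close> over
    \<open>E\<close>.\<close>
  define m where "m = Max ((\<lambda>i. length (u i)) ` {..<n})"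
  have lm: "length (u i) \<le> m" if "i < n" for i using that by (auto simp: m_def)
  define e where "e i j = coeff (u i) j" for i j
  have eE: "e i j \<in> E" for i j unfolding e_def by (rule coeff_in_subring[OF subfieldE(1)[OF E] uE])
  have ec: "e i j \<in> carrier R" for i j using eE subfieldE(3)[OF E] by auto
  have ce: "c i = (\<Oplus>j\<in>{..<m}. e i j \<otimes> t [^] j)" if "i < n" for i
    unfolding e_def using u(2)[of i] eval_as_finsum[OF uc t lm[OF that]] by simp
  define d where "d j = (\<Oplus>i\<in>{..<n}. e i j \<otimes> y [^] i)" for j
  have dK: "d j \<in> ?K" for j
  proof -
    have "insert y E \<subseteq> ?K" by (intro subsetI generate_field.incl)
    then have "e i j \<in> ?K" "y \<in> ?K" for i using eE by auto
    then show ?thesis unfolding d_def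
      by (intro subring_finsum[OF subfieldE(1)[OF K]] subringE(6)[OF subfieldE(1)[OF K]]
          subring_nat_pow[OF subfieldE(1)[OF K]])
  qed
  have "(\<Oplus>j\<in>{..<m}. d j \<otimes> t [^] j) = (\<Oplus>j\<in>{..<m}. \<Oplus>i\<in>{..<n}. (e i j \<otimes> y [^] i) \<otimes> t [^] j)"
    unfolding d_def using ec y t by (intro add.finprod_cong') (auto intro!: finsum_ldistr)
  also have "\<dots> = (\<Oplus>i\<in>{..<n}. \<Oplus>j\<in>{..<m}. (e i j \<otimes> y [^] i) \<otimes> t [^] j)"
    using ec y t by (intro finsum_swap) auto
  also have "\<dots> = (\<Oplus>i\<in>{..<n}. c i \<otimes> y [^] i)"
  proof (rule add.finprod_cong')
    fix i assume i: "i \<in> {..<n}"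
    have "(\<Oplus>j\<in>{..<m}. (e i j \<otimes> y [^] i) \<otimes> t [^] j) = (\<Oplus>j\<in>{..<m}. (e i j \<otimes> t [^] j) \<otimes> y [^] i)"
      using ec y t by (intro add.finprod_cong') (auto simp: m_ac)
    also have "\<dots> = c i \<otimes> y [^] i"
      using ce[of i] i ec y t by (simp add: finsum_ldistr)
    finally show "(\<Oplus>j\<in>{..<m}. (e i j \<otimes> y [^] i) \<otimes> t [^] j) = c i \<otimes> y [^] i" .
  qed (use c(1) subringE(1)[OF D] y in auto)
  finally have sum0: "(\<Oplus>j\<in>{..<m}. d j \<otimes> t [^] j) = \<zero>" using c(4) by simp
  have "\<exists>j<m. d j \<noteq> \<zero>"
  proof (rule ccontr)
    assume "\<not> (\<exists>j<m. d j \<noteq> \<zero>)"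
    then have "e i j = \<zero>" if "i < n" "j < m" for i j
      using transcendental_coeffsD[OF subfieldE(1)[OF E] y, of n "\<lambda>i. e i j" i] eE that
      by (auto simp: d_def)
    then have "(\<Oplus>j\<in>{..<m}. e j0 j \<otimes> t [^] j) = \<zero>"
      using c(2) t by (intro add.finprod_one_eqI) auto
    then have "c j0 = \<zero>" using ce[OF c(2)] by simp
    then show False using c(3) by simp
  qed
  then show ?thesis using algebraic_coeffsI[OF subfieldE(1)[OF K] t, of m d] dK sum0 by blast
qed

end

section \<open>Extending partial isomorphisms\<close>

text \<open>A partial isomorphism is represented by its graph.\<close>

definition (in ring) partial_iso :: "('a \<times> 'a) set \<Rightarrow> bool" where
  "partial_iso G \<longleftrightarrow> G \<subseteq> carrier R \<times> carrier R \<and> (\<one>, \<one>) \<in> G \<and>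
     (\<forall>a a' b b'. (a, a') \<in> G \<longrightarrow> (b, b') \<in> G \<longrightarrow> (a \<ominus> b, a' \<ominus> b') \<in> G \<and> (a \<otimes> b, a' \<otimes> b') \<in> G) \<and>
     (\<forall>a a'. (a, a') \<in> G \<longrightarrow> (a = \<zero> \<longleftrightarrow> a' = \<zero>))"

text \<open>Horner's scheme run at \<open>c\<close> and \<open>c'\<close> simultaneously, with
  coefficients paired by \<open>G\<close>. This is only a relation; that it is single-valued and
  injective depends on the choice of \<open>c'\<close>.\<close>

inductive_set (in ring) adjoin_pair :: "('a \<times> 'a) set \<Rightarrow> 'a \<Rightarrow> 'a \<Rightarrow> ('a \<times> 'a) set" for G c c' where
  zero: "(\<zero>, \<zero>) \<in> adjoin_pair G c c'"
| lin: "\<lbrakk>(a, a') \<in> adjoin_pair G c c'; (g, g') \<in> G\<rbrakk> \<Longrightarrow> (a \<otimes> c \<oplus> g, a' \<otimes> c' \<oplus> g') \<in> adjoin_pair G c c'"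

context field
begin

lemma partial_isoD:
  assumes "partial_iso G"
  shows "(\<one>, \<one>) \<in> G" "(\<zero>, \<zero>) \<in> G"
    and "(a, a') \<in> G \<Longrightarrow> a \<in> carrier R" "(a, a') \<in> G \<Longrightarrow> a' \<in> carrier R"
    and "(a, a') \<in> G \<Longrightarrow> a = \<zero> \<longleftrightarrow> a' = \<zero>"
    and "\<lbrakk>(a, a') \<in> G; (b, b') \<in> G\<rbrakk> \<Longrightarrow> (a \<ominus> b, a' \<ominus> b') \<in> G"
    and "\<lbrakk>(a, a') \<in> G; (b, b') \<in> G\<rbrakk> \<Longrightarrow> (a \<otimes> b, a' \<otimes> b') \<in> G"
    and "(a, a') \<in> G \<Longrightarrow> (\<ominus> a, \<ominus> a') \<in> G"
    and "\<lbrakk>(a, a') \<in> G; (b, b') \<in> G\<rbrakk> \<Longrightarrow> (a \<oplus> b, a' \<oplus> b') \<in> G"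
proof -
  note d = assms[unfolded partial_iso_def]
  show one: "(\<one>, \<one>) \<in> G" using d by blast
  have car: "a \<in> carrier R \<and> a' \<in> carrier R" if "(a, a') \<in> G" for a a' using d that by blast
  show "(a, a') \<in> G \<Longrightarrow> a \<in> carrier R" "(a, a') \<in> G \<Longrightarrow> a' \<in> carrier R" using car by auto
  show "(a, a') \<in> G \<Longrightarrow> a = \<zero> \<longleftrightarrow> a' = \<zero>" using d by blast
  have minus: "(a \<ominus> b, a' \<ominus> b') \<in> G" if "(a, a') \<in> G" "(b, b') \<in> G" for a a' b b'
    using d that by blast
  then show "\<lbrakk>(a, a') \<in> G; (b, b') \<in> G\<rbrakk> \<Longrightarrow> (a \<ominus> b, a' \<ominus> b') \<in> G" .
  show "\<lbrakk>(a, a') \<in> G; (b, b') \<in> G\<rbrakk> \<Longrightarrow> (a \<otimes> b, a' \<otimes> b') \<in> G" using d by blast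
  show zero: "(\<zero>, \<zero>) \<in> G" using minus[OF one one] by (simp add: minus_eq r_neg)
  have neg: "(\<ominus> a, \<ominus> a') \<in> G" if "(a, a') \<in> G" for a a'
    using minus[OF zero that] car[OF that] by (simp add: minus_eq)
  then show "(a, a') \<in> G \<Longrightarrow> (\<ominus> a, \<ominus> a') \<in> G" .
  show "(a \<oplus> b, a' \<oplus> b') \<in> G" if "(a, a') \<in> G" "(b, b') \<in> G"
    using minus[OF that(1) neg[OF that(2)]] car[OF that(1)] car[OF that(2)] by (simp add: minus_eq)
qed

lemma partial_isoI:
  assumes "G \<subseteq> carrier R \<times> carrier R" "(\<one>, \<one>) \<in> G"
    and "\<And>a a' b b'. \<lbrakk>(a, a') \<in> G; (b, b') \<in> G\<rbrakk> \<Longrightarrow> (a \<ominus> b, a' \<ominus> b') \<in> G"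
    and "\<And>a a' b b'. \<lbrakk>(a, a') \<in> G; (b, b') \<in> G\<rbrakk> \<Longrightarrow> (a \<otimes> b, a' \<otimes> b') \<in> G"
    and "\<And>a a'. (a, a') \<in> G \<Longrightarrow> a = \<zero> \<longleftrightarrow> a' = \<zero>"
  shows "partial_iso G"
  unfolding partial_iso_def using assms by blast

text \<open>The condition on zero, applied to a difference, expresses single-valuedness and
  injectivity at once.\<close>

lemma partial_iso_inj:
  assumes "partial_iso G" "(a, a') \<in> G" "(b, b') \<in> G"
  shows "a = b \<longleftrightarrow> a' = b'"
proof -
  note D = partial_isoD[OF assms(1)]
  have "(a \<ominus> b, a' \<ominus> b') \<in> G" by (rule D(6)[OF assms(2,3)])
  then have "a \<ominus> b = \<zero> \<longleftrightarrow> a' \<ominus> b' = \<zero>" by (rule D(5))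
  moreover have "a \<in> carrier R" "b \<in> carrier R" "a' \<in> carrier R" "b' \<in> carrier R"
    using D(3,4) assms(2,3) by auto
  ultimately show ?thesis by simp
qed

text \<open>The notion is symmetric in the two coordinates, so every statement about domains also
  serves for ranges.\<close>

lemma partial_iso_converse: "partial_iso G \<Longrightarrow> partial_iso (G\<inverse>)"
  unfolding partial_iso_def by blast

lemma partial_iso_fst_subring:
  assumes "partial_iso G"
  shows "subring (fst ` G) R"
proof (rule subringI)
  note D = partial_isoD[OF assms]
  show "fst ` G \<subseteq> carrier R" using D(3) by fastforce
  show "\<one> \<in> fst ` G" using D(1) by force
  fix x y assume "x \<in> fst ` G" "y \<in> fst ` G"
  then obtain x' y' where xy: "(x, x') \<in> G" "(y, y') \<in> G" by auto
  show "\<ominus> x \<in> fst ` G" using D(8)[OF xy(1)] by force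
  show "x \<otimes> y \<in> fst ` G" using D(7)[OF xy] by force
  show "x \<oplus> y \<in> fst ` G" using D(9)[OF xy] by force
qed

lemma snd_image_converse: "snd ` G = fst ` (G\<inverse>)"
  by force

text \<open>It forces a maximal partial isomorphism to have a field as its domain, as the adjunction
  of an algebraic element requires.\<close>

lemma partial_iso_fracs:
  assumes "partial_iso G"
  shows "\<exists>G'. partial_iso G' \<and> G \<subseteq> G' \<and> fst ` G' = fracs (fst ` G) \<and> snd ` G' = fracs (snd ` G)"
proof (intro exI conjI)
  note D = partial_isoD[OF assms]
  let ?G = "{(a \<otimes> inv b, a' \<otimes> inv b') | a a' b b'. (a, a') \<in> G \<and> (b, b') \<in> G \<and> b \<noteq> \<zero>}"
  have I: "(a \<otimes> inv b, a' \<otimes> inv b') \<in> ?G" if "(a, a') \<in> G" "(b, b') \<in> G" "b \<noteq> \<zero>" for a a' b b'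
    using that by blast
  show sub: "G \<subseteq> ?G"
  proof
    fix z assume "z \<in> G"
    then obtain a a' where z: "z = (a, a')" "(a, a') \<in> G" by (cases z) auto
    show "z \<in> ?G" using I[OF z(2) D(1)] D(3,4)[OF z(2)] z(1) by simp
  qed
  show "fst ` ?G = fracs (fst ` G)"
  proof
    show "fst ` ?G \<subseteq> fracs (fst ` G)" by (force simp: fracs_def)
    show "fracs (fst ` G) \<subseteq> fst ` ?G"
    proof
      fix x assume "x \<in> fracs (fst ` G)"
      then obtain a a' b b' where "x = a \<otimes> inv b" "(a, a') \<in> G" "(b, b') \<in> G" "b \<noteq> \<zero>"
        by (auto simp: fracs_def)
      then show "x \<in> fst ` ?G" using I[of a a' b b'] by force
    qed
  qed
  show "snd ` ?G = fracs (snd ` G)"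
  proof
    show "snd ` ?G \<subseteq> fracs (snd ` G)" using D(5) by (force simp: fracs_def)
    show "fracs (snd ` G) \<subseteq> snd ` ?G"
    proof
      fix x assume "x \<in> fracs (snd ` G)"
      then obtain a a' b b' where "x = a' \<otimes> inv b'" "(a, a') \<in> G" "(b, b') \<in> G" "b' \<noteq> \<zero>"
        by (auto simp: fracs_def)
      then show "x \<in> snd ` ?G" using I[of a a' b b'] D(5)[of b b'] by force
    qed
  qed
  show "partial_iso ?G"
  proof (rule partial_isoI)
    show "?G \<subseteq> carrier R \<times> carrier R"
    proof
      fix z assume "z \<in> ?G"
      then obtain a a' b b' where z: "z = (a \<otimes> inv b, a' \<otimes> inv b')" "(a, a') \<in> G" "(b, b') \<in> G" "b \<noteq> \<zero>"
        by blast
      have "b' \<noteq> \<zero>" using D(5)[OF z(3)] z(4) by simp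
      then show "z \<in> carrier R \<times> carrier R" using z D(3,4)[OF z(2)] D(3,4)[OF z(3)] by simp
    qed
    show "(\<one>, \<one>) \<in> ?G" using sub D(1) by blast
  next
    fix x x' y y' assume "(x, x') \<in> ?G" "(y, y') \<in> ?G"
    then obtain a a' b b' c c' d d' where
        x: "x = a \<otimes> inv b" "x' = a' \<otimes> inv b'" "(a, a') \<in> G" "(b, b') \<in> G" "b \<noteq> \<zero>" and
        y: "y = c \<otimes> inv d" "y' = c' \<otimes> inv d'" "(c, c') \<in> G" "(d, d') \<in> G" "d \<noteq> \<zero>" by blast
    have nz: "b' \<noteq> \<zero>" "d' \<noteq> \<zero>" using D(5)[OF x(4)] D(5)[OF y(4)] x y by auto
    note car = D(3,4)[OF x(3)] D(3,4)[OF x(4)] D(3,4)[OF y(3)] D(3,4)[OF y(4)]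
    have bd: "(b \<otimes> d, b' \<otimes> d') \<in> G" "b \<otimes> d \<noteq> \<zero>" using D(7)[OF x(4) y(4)] x(5) y(5) car by (auto simp: integral_iff)
    show "(x \<otimes> y, x' \<otimes> y') \<in> ?G"
    proof -
      have "(x \<otimes> y, x' \<otimes> y') = ((a \<otimes> c) \<otimes> inv (b \<otimes> d), (a' \<otimes> c') \<otimes> inv (b' \<otimes> d'))"
        unfolding x(1,2) y(1,2) using car nz x(5) y(5) by (simp add: frac_mult)
      also have "\<dots> \<in> ?G" by (rule I[OF D(7)[OF x(3) y(3)] bd])
      finally show ?thesis .
    qed
    have m: "u \<ominus> w \<otimes> inv z = u \<oplus> (\<ominus> w) \<otimes> inv z" if "u \<in> carrier R" "w \<in> carrier R" "z \<in> carrier R" "z \<noteq> \<zero>" for u w z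
      using that by (simp add: minus_eq l_minus)
    have "(x \<ominus> y, x' \<ominus> y') = (a \<otimes> inv b \<oplus> (\<ominus> c) \<otimes> inv d, a' \<otimes> inv b' \<oplus> (\<ominus> c') \<otimes> inv d')"
      unfolding x(1,2) y(1,2) using car nz x(5) y(5) by (simp add: m)
    also have "\<dots> = ((a \<otimes> d \<oplus> (\<ominus> c) \<otimes> b) \<otimes> inv (b \<otimes> d), (a' \<otimes> d' \<oplus> (\<ominus> c') \<otimes> b') \<otimes> inv (b' \<otimes> d'))"
      using car nz x(5) y(5) by (simp add: frac_add)
    also have "\<dots> \<in> ?G"
      using I[OF D(9)[OF D(7)[OF x(3) y(4)] D(7)[OF D(8)[OF y(3)] x(4)]] bd] .
    finally show "(x \<ominus> y, x' \<ominus> y') \<in> ?G" .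
  next
    fix x x' assume "(x, x') \<in> ?G"
    then obtain a a' b b' where
        x: "x = a \<otimes> inv b" "x' = a' \<otimes> inv b'" "(a, a') \<in> G" "(b, b') \<in> G" "b \<noteq> \<zero>" by blast
    note car = D(3,4)[OF x(3)] D(3,4)[OF x(4)]
    have "b' \<noteq> \<zero>" using D(5)[OF x(4)] x by auto
    then show "x = \<zero> \<longleftrightarrow> x' = \<zero>" using x car D(5)[OF x(3)] by (simp add: integral_iff)
  qed
qed

section \<open>Adjunction of one element to a partial isomorphism\<close>

context
  fixes G c c' assumes G: "partial_iso G" and c: "c \<in> carrier R" "c' \<in> carrier R"
begin

private lemma D: "(a, a') \<in> G \<Longrightarrow> a \<in> carrier R" "(a, a') \<in> G \<Longrightarrow> a' \<in> carrier R"
  by (rule partial_isoD[OF G]; assumption)+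

lemma adjoin_pair_carrier:
  assumes "(a, a') \<in> adjoin_pair G c c'"
  shows "a \<in> carrier R" "a' \<in> carrier R"
  using assms by (induction rule: adjoin_pair.induct) (use c D in auto)

lemma adjoin_pair_incl: "(g, g') \<in> G \<Longrightarrow> (g, g') \<in> adjoin_pair G c c'"
  using adjoin_pair.lin[OF adjoin_pair.zero, of g g' G c c'] c D by simp

lemma adjoin_pair_mem: "(c, c') \<in> adjoin_pair G c c'"
  using adjoin_pair.lin[OF adjoin_pair_incl[OF partial_isoD(1)[OF G]] partial_isoD(2)[OF G]] c by simp

lemma adjoin_pair_add:
  assumes "(a, a') \<in> adjoin_pair G c c'" "(b, b') \<in> adjoin_pair G c c'"
  shows "(a \<oplus> b, a' \<oplus> b') \<in> adjoin_pair G c c'"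
  using assms
proof (induction arbitrary: b b' rule: adjoin_pair.induct)
  case zero
  then show ?case using adjoin_pair_carrier by simp
next
  case (lin a a' g g')
  note car = adjoin_pair_carrier[OF lin.hyps(1)] D[OF lin.hyps(2)]
  from lin.prems show ?case
  proof cases
    case zero
    then show ?thesis using adjoin_pair.lin[OF lin.hyps] car c by simp
  next
    case (lin d d' h h')
    note car' = adjoin_pair_carrier[OF lin(3)] D[OF lin(4)]
    have "(a \<otimes> c \<oplus> g) \<oplus> b = (a \<oplus> d) \<otimes> c \<oplus> (g \<oplus> h)" "(a' \<otimes> c' \<oplus> g') \<oplus> b' = (a' \<oplus> d') \<otimes> c' \<oplus> (g' \<oplus> h')"
      using lin(1,2) car car' c by (simp_all add: l_distr a_ac)
    then show ?thesis
      using adjoin_pair.lin[OF lin.IH[OF lin(3)] partial_isoD(9)[OF G lin.hyps(2) lin(4)]] by simp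
  qed
qed

lemma adjoin_pair_smult:
  assumes "(a, a') \<in> adjoin_pair G c c'" "(h, h') \<in> G"
  shows "(h \<otimes> a, h' \<otimes> a') \<in> adjoin_pair G c c'"
  using assms
proof (induction rule: adjoin_pair.induct)
  case zero
  then show ?case using D adjoin_pair.zero by simp
next
  case (lin a a' g g')
  note car = adjoin_pair_carrier[OF lin.hyps(1)] D[OF lin.hyps(2)] D[OF lin.prems]
  have "h \<otimes> (a \<otimes> c \<oplus> g) = (h \<otimes> a) \<otimes> c \<oplus> h \<otimes> g" "h' \<otimes> (a' \<otimes> c' \<oplus> g') = (h' \<otimes> a') \<otimes> c' \<oplus> h' \<otimes> g'"
    using car c by (simp_all add: r_distr m_assoc)
  then show ?case
    using adjoin_pair.lin[OF lin.IH[OF lin.prems] partial_isoD(7)[OF G lin.prems lin.hyps(2)]] by simp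
qed

lemma adjoin_pair_mult:
  assumes "(a, a') \<in> adjoin_pair G c c'" "(b, b') \<in> adjoin_pair G c c'"
  shows "(a \<otimes> b, a' \<otimes> b') \<in> adjoin_pair G c c'"
  using assms
proof (induction rule: adjoin_pair.induct)
  case zero
  then show ?case using adjoin_pair_carrier adjoin_pair.zero by simp
next
  case (lin a a' g g')
  note car = adjoin_pair_carrier[OF lin.hyps(1)] D[OF lin.hyps(2)] adjoin_pair_carrier[OF lin.prems]
  have eq: "(a \<otimes> c \<oplus> g) \<otimes> b = ((a \<otimes> b) \<otimes> c \<oplus> \<zero>) \<oplus> g \<otimes> b" "(a' \<otimes> c' \<oplus> g') \<otimes> b' = ((a' \<otimes> b') \<otimes> c' \<oplus> \<zero>) \<oplus> g' \<otimes> b'"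
  proof -
    have "(a \<otimes> c) \<otimes> b = (a \<otimes> b) \<otimes> c" "(a' \<otimes> c') \<otimes> b' = (a' \<otimes> b') \<otimes> c'"
      using car c by (simp_all add: m_ac)
    then show "(a \<otimes> c \<oplus> g) \<otimes> b = ((a \<otimes> b) \<otimes> c \<oplus> \<zero>) \<oplus> g \<otimes> b" "(a' \<otimes> c' \<oplus> g') \<otimes> b' = ((a' \<otimes> b') \<otimes> c' \<oplus> \<zero>) \<oplus> g' \<otimes> b'"
      using car c by (simp_all add: l_distr)
  qed
  show ?case unfolding eq
    by (intro adjoin_pair_add adjoin_pair.lin lin.IH lin.prems partial_isoD(2)[OF G]
        adjoin_pair_smult lin.hyps)
qed

lemma adjoin_pair_lists:
  assumes "(a, a') \<in> adjoin_pair G c c'"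
  shows "\<exists>gs. set gs \<subseteq> G \<and> a = eval (map fst gs) c \<and> a' = eval (map snd gs) c'"
  using assms
proof (induction rule: adjoin_pair.induct)
  case zero
  then show ?case by (intro exI[of _ "[]"]) simp
next
  case (lin a a' g g')
  then obtain gs where gs: "set gs \<subseteq> G" "a = eval (map fst gs) c" "a' = eval (map snd gs) c'" by blast
  have "set (map fst gs) \<subseteq> carrier R" "set (map snd gs) \<subseteq> carrier R" using gs(1) D by auto
  then have "eval (map fst (gs @ [(g, g')])) c = a \<otimes> c \<oplus> g" "eval (map snd (gs @ [(g, g')])) c' = a' \<otimes> c' \<oplus> g'"
    using gs D[OF lin.hyps(2)] c by (simp_all add: eval_append_aux)
  then show ?case using gs(1) lin.hyps(2) by (intro exI[of _ "gs @ [(g, g')]"]) auto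
qed

lemma adjoin_pair_subset:
  assumes "subring S R" "subring S' R" "G \<subseteq> S \<times> S'" "c \<in> S" "c' \<in> S'"
  shows "adjoin_pair G c c' \<subseteq> S \<times> S'"
proof -
  have "a \<in> S \<and> a' \<in> S'" if "(a, a') \<in> adjoin_pair G c c'" for a a'
    using that
  proof (induction rule: adjoin_pair.induct)
    case zero
    then show ?case using subringE(2) assms(1,2) by auto
  next
    case (lin a a' g g')
    then have "g \<in> S" "g' \<in> S'" using assms(3) by auto
    then show ?case using lin subringE(6,7)[OF assms(1)] subringE(6,7)[OF assms(2)] assms(4,5) by auto
  qed
  then show ?thesis by auto
qed

text \<open>Closure under the ring operations holds for any \<open>c\<close> and \<open>c'\<close>.
  What remains is that a polynomial over the domain vanishes at \<open>c\<close> exactly if its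
  image under \<open>G\<close> vanishes at \<open>c'\<close>.\<close>

lemma adjoin_pair_partial_iso:
  assumes "\<And>gs. set gs \<subseteq> G \<Longrightarrow> eval (map fst gs) c = \<zero> \<longleftrightarrow> eval (map snd gs) c' = \<zero>"
  shows "partial_iso (adjoin_pair G c c')"
proof (rule partial_isoI)
  show "adjoin_pair G c c' \<subseteq> carrier R \<times> carrier R" using adjoin_pair_carrier by auto
  show "(\<one>, \<one>) \<in> adjoin_pair G c c'" by (rule adjoin_pair_incl[OF partial_isoD(1)[OF G]])
  fix a a' assume a: "(a, a') \<in> adjoin_pair G c c'"
  show "a = \<zero> \<longleftrightarrow> a' = \<zero>" using adjoin_pair_lists[OF a] assms by auto
  fix b b' assume b: "(b, b') \<in> adjoin_pair G c c'"
  show "(a \<otimes> b, a' \<otimes> b') \<in> adjoin_pair G c c'" by (rule adjoin_pair_mult[OF a b])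
  have "(\<ominus> \<one>, \<ominus> \<one>) \<in> G" by (intro partial_isoD(8,1)[OF G])
  then have "(\<ominus> \<one> \<otimes> b, \<ominus> \<one> \<otimes> b') \<in> adjoin_pair G c c'" by (rule adjoin_pair_smult[OF b])
  then have "(\<ominus> b, \<ominus> b') \<in> adjoin_pair G c c'"
    using adjoin_pair_carrier[OF b] by (simp add: l_minus)
  then show "(a \<ominus> b, a' \<ominus> b') \<in> adjoin_pair G c c'"
    unfolding minus_eq by (rule adjoin_pair_add[OF a])
qed

text \<open>At a transcendental element only the zero polynomial vanishes, and \<open>G\<close>
  matches zero coefficients with zero coefficients.\<close>

lemma adjoin_pair_transcendental:
  assumes "(transcendental over (fst ` G)) c" "(transcendental over (snd ` G)) c'"
  shows "partial_iso (adjoin_pair G c c')"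
proof (rule adjoin_pair_partial_iso)
  fix gs assume gs: "set gs \<subseteq> G"
  have nz: "eval p x = \<zero> \<longleftrightarrow> set p \<subseteq> {\<zero>}"
    if K: "subring K R" "set p \<subseteq> K" "x \<in> carrier R" "(transcendental over K) x" for p K x
  proof
    assume e: "eval p x = \<zero>"
    have pc: "set p \<subseteq> carrier R" using K subringE(1) by blast
    have "normalize p \<in> carrier (K[X])"
      using normalize_gives_polynomial[OF K(2)] by (simp add: univ_poly_carrier)
    moreover have "eval (normalize p) x = \<zero>" using e eval_normalize[OF pc K(3)] by simp
    ultimately have "normalize p = []" using eval_transcendental[OF K(4)] by blast
    then show "set p \<subseteq> {\<zero>}" by (rule normalize_eq_Nil)
  next
    assume z: "set p \<subseteq> {\<zero>}"
    then show "eval p x = \<zero>" using K(3) by (induction p) auto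
  qed
  have "subring (fst ` G) R" "subring (snd ` G) R"
    using partial_iso_fst_subring[OF G] partial_iso_fst_subring[OF partial_iso_converse[OF G]]
    by (simp_all add: snd_image_converse)
  then have "eval (map fst gs) c = \<zero> \<longleftrightarrow> fst ` set gs \<subseteq> {\<zero>}"
      "eval (map snd gs) c' = \<zero> \<longleftrightarrow> snd ` set gs \<subseteq> {\<zero>}"
    using nz[of "fst ` G" "map fst gs" c] nz[of "snd ` G" "map snd gs" c'] gs assms c
    by (simp_all add: image_mono)
  moreover have "fst ` set gs \<subseteq> {\<zero>} \<longleftrightarrow> snd ` set gs \<subseteq> {\<zero>}"
    using gs partial_isoD(5)[OF G] by fastforce
  ultimately show "eval (map fst gs) c = \<zero> \<longleftrightarrow> eval (map snd gs) c' = \<zero>" by simp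
qed

end

end

section \<open>Division with remainder on coefficient lists\<close>

context ring
begin

lemma eval_map2_minus:
  assumes "length p = length q" "set p \<subseteq> carrier R" "set q \<subseteq> carrier R" "x \<in> carrier R"
  shows "eval (map2 (\<lambda>a b. a \<ominus> b) p q) x = eval p x \<ominus> eval q x"
  using assms
proof (induction p q rule: list_induct2)
  case (Cons a p b q)
  have car: "a \<in> carrier R" "b \<in> carrier R" "eval p x \<in> carrier R" "eval q x \<in> carrier R" "x [^] length q \<in> carrier R"
    using Cons.prems eval_in_carrier by auto
  have "(a \<ominus> b) \<otimes> x [^] length q \<oplus> (eval p x \<ominus> eval q x)
      = (a \<otimes> x [^] length q \<oplus> eval p x) \<ominus> (b \<otimes> x [^] length q \<oplus> eval q x)"
    using car by algebra
  then show ?case using Cons by simp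
qed (simp add: minus_eq)

lemma eval_scalar:
  assumes "set p \<subseteq> carrier R" "a \<in> carrier R" "x \<in> carrier R"
  shows "eval (map (\<lambda>b. a \<otimes> b) p) x = a \<otimes> eval p x"
  using assms(1)
proof (induction p)
  case (Cons b p)
  then show ?case using assms(2,3) eval_in_carrier[of p x] by (simp add: r_distr m_assoc)
qed (use assms in simp)

end

text \<open>One step of long division: since \<open>x\<close> is a root of the monic polynomial
  \<open>\<one> # qs\<close>, the leading term \<open>g\<close> of the dividend can be traded for a
  multiple of \<open>qs\<close>. The padding with zeros aligns \<open>qs\<close> with the top of
  \<open>hs\<close>.\<close>

lemma (in cring) eval_reduce:
  assumes qs: "set qs \<subseteq> carrier R" "set hs \<subseteq> carrier R" and x: "x \<in> carrier R" "g \<in> carrier R"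
    and root: "eval (\<one> # qs) x = \<zero>" and len: "length qs \<le> length hs"
  shows "eval (map2 (\<lambda>a b. a \<ominus> b) hs (map (\<lambda>b. g \<otimes> b) qs @ replicate (length hs - length qs) \<zero>)) x = eval (g # hs) x"
proof -
  let ?k = "length hs - length qs"
  have e: "eval qs x \<in> carrier R" "eval hs x \<in> carrier R" using qs x eval_in_carrier by auto
  have z: "eval (replicate ?k \<zero>) x = \<zero>" using eval_replicate[of "[]" x ?k] x by simp
  have c: "set (map (\<lambda>b. g \<otimes> b) qs) \<subseteq> carrier R" using qs x by auto
  have "eval (map (\<lambda>b. g \<otimes> b) qs @ replicate ?k \<zero>) x = g \<otimes> eval qs x \<otimes> x [^] ?k"
    using c x e z eval_scalar[OF qs(1) x(2,1)] by (subst eval_append) auto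
  moreover have "set (map (\<lambda>b. g \<otimes> b) qs @ replicate ?k \<zero>) \<subseteq> carrier R" using c by auto
  ultimately have "eval (map2 (\<lambda>a b. a \<ominus> b) hs (map (\<lambda>b. g \<otimes> b) qs @ replicate ?k \<zero>)) x
      = eval hs x \<ominus> g \<otimes> eval qs x \<otimes> x [^] ?k"
    using qs x len by (subst eval_map2_minus) auto
  also have "\<dots> = g \<otimes> x [^] length hs \<oplus> eval hs x"
  proof -
    have "x [^] length qs \<oplus> eval qs x = \<zero>" using root x by simp
    then have q: "eval qs x = \<ominus> (x [^] length qs)" using e x by (metis add.inv_equality a_comm nat_pow_closed)
    have p: "x [^] length hs = x [^] length qs \<otimes> x [^] ?k" using x len by (simp add: nat_pow_mult)
    have "x [^] length qs \<in> carrier R" "x [^] ?k \<in> carrier R" using x by auto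
    then show ?thesis unfolding q p using e x(2) by algebra
  qed
  finally show ?thesis by simp
qed

context field
begin

lemma adjoin_pair_fst:
  assumes G: "partial_iso G" and c: "c \<in> carrier R" "c' \<in> carrier R"
  shows "fst ` adjoin_pair G c c' = simple_extension (fst ` G) c"
proof
  have "a \<in> simple_extension (fst ` G) c" if "(a, a') \<in> adjoin_pair G c c'" for a a'
    using that
  proof (induction rule: adjoin_pair.induct)
    case (lin a a' g g')
    then show ?case using simple_extension.lin[of a "fst ` G" c g] by force
  qed simp
  then show "fst ` adjoin_pair G c c' \<subseteq> simple_extension (fst ` G) c" by auto
  show "simple_extension (fst ` G) c \<subseteq> fst ` adjoin_pair G c c'"
  proof
    fix a assume "a \<in> simple_extension (fst ` G) c"
    then show "a \<in> fst ` adjoin_pair G c c'"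
    proof induction
      case zero
      then show ?case using adjoin_pair.zero by force
    next
      case (lin k1 k2)
      then obtain a' g' where "(k1, a') \<in> adjoin_pair G c c'" "(k2, g') \<in> G" by auto
      then have "(k1 \<otimes> c \<oplus> k2, a' \<otimes> c' \<oplus> g') \<in> adjoin_pair G c c'" by (rule adjoin_pair.lin)
      then show ?case by force
    qed
  qed
qed

lemma adjoin_pair_evals:
  assumes G: "partial_iso G" and c: "c \<in> carrier R" "c' \<in> carrier R" and gs: "set gs \<subseteq> G"
  shows "(eval (map fst gs) c, eval (map snd gs) c') \<in> adjoin_pair G c c'"
  using gs
proof (induction gs rule: rev_induct)
  case Nil
  then show ?case using adjoin_pair.zero by simp
next
  case (snoc g gs)
  obtain h h' where g: "g = (h, h')" by (cases g)
  have hG: "(h, h') \<in> G" "set gs \<subseteq> G" using snoc.prems g by auto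
  have car: "h \<in> carrier R" "h' \<in> carrier R" "set (map fst gs) \<subseteq> carrier R" "set (map snd gs) \<subseteq> carrier R"
    using hG partial_isoD(3,4)[OF G] by auto
  show ?case
    using adjoin_pair.lin[OF snoc.IH[OF hG(2)] hG(1)] car c by (simp add: g eval_append_aux)
qed

text \<open>If \<open>c\<close> is algebraic, an image for \<open>c\<close> is a root of the image of the minimal polynomial of \<open>c\<close>.
  The resulting map on \<open>K[c]\<close> is well defined by division with remainder, and injective because
  \<open>K[c]\<close> is a field.\<close>

lemma adjoin_pair_algebraic:
  assumes closed: "\<And>p. p \<in> carrier (poly_ring R) \<Longrightarrow> length p \<ge> 2 \<Longrightarrow> \<exists>x\<in>carrier R. eval p x = \<zero>"
    and G: "partial_iso G" and K: "subfield (fst ` G) R" and c: "c \<in> carrier R" "(algebraic over (fst ` G)) c"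
  shows "\<exists>c'\<in>carrier R. (algebraic over (snd ` G)) c' \<and> partial_iso (adjoin_pair G c c')"
proof -
  note D = partial_isoD[OF G]
  \<comment> \<open>A list in \<open>P\<close> is a nonzero polynomial with root \<open>c\<close>
    whose coefficients carry their images under \<open>G\<close>. A shortest one is the minimal
    polynomial of \<open>c\<close> up to a scalar, and its second components form the polynomial
    whose root will be \<open>c'\<close>.\<close>
  define P where "P ps \<longleftrightarrow> set ps \<subseteq> G \<and> eval (map fst ps) c = \<zero> \<and> \<not> fst ` set ps \<subseteq> {\<zero>}" for ps
  obtain p where p: "p \<in> carrier ((fst ` G)[X])" "p \<noteq> []" "eval p c = \<zero>"
    using algebraicE[OF subfieldE(1)[OF K] c] by blast
  then have "set p \<subseteq> fst ` G" "hd p \<noteq> \<zero>" by (auto simp: univ_poly_carrier[symmetric] polynomial_def)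
  have "\<exists>ps. set ps \<subseteq> G \<and> map fst ps = p" using \<open>set p \<subseteq> fst ` G\<close>
  proof (induction p)
    case (Cons a p)
    then obtain ps a' where "set ps \<subseteq> G" "map fst ps = p" "(a, a') \<in> G" by auto
    then show ?case by (intro exI[of _ "(a, a') # ps"]) auto
  qed simp
  then obtain ps0 where "set ps0 \<subseteq> G" "map fst ps0 = p" by blast
  moreover have "hd p \<in> set p" using p(2) by simp
  ultimately have "P ps0" using p(3) \<open>hd p \<noteq> \<zero>\<close> unfolding P_def by (metis list.set_map singletonD subsetD)
  then have "\<exists>ps. P ps \<and> (\<forall>qs. P qs \<longrightarrow> length ps \<le> length qs)"
    by (intro exI[of _ "arg_min length P"]) (metis arg_min_natI arg_min_nat_le)
  then obtain ps1 where ps1: "P ps1" and min: "\<And>qs. P qs \<Longrightarrow> length ps1 \<le> length qs" by blast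
  obtain l l' qs1 where ps1_eq: "ps1 = (l, l') # qs1" using ps1 unfolding P_def by (cases ps1) auto
  have l: "(l, l') \<in> G" and qs1: "set qs1 \<subseteq> G" using ps1 ps1_eq by (auto simp: P_def)
  have qs1c: "set (map fst qs1) \<subseteq> carrier R" using qs1 D(3) by auto
  have "l \<noteq> \<zero>"
  proof
    assume "l = \<zero>"
    then have "P qs1" using ps1 c qs1c eval_in_carrier[OF qs1c c(1)] unfolding P_def ps1_eq by simp
    then show False using min ps1_eq by fastforce
  qed
  have "inv l \<in> fst ` G" using subfield_m_inv(1)[OF K] l \<open>l \<noteq> \<zero>\<close> by force
  then obtain m where m: "(inv l, m) \<in> G" by auto
  have lc: "l \<in> carrier R" "inv l \<in> carrier R" using D(3) l m by auto
  have "(inv l \<otimes> l, m \<otimes> l') \<in> G" by (rule D(7)[OF m l])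
  then have ml: "m \<otimes> l' = \<one>" using partial_iso_inj[OF G D(1)] lc \<open>l \<noteq> \<zero>\<close> by (metis l_inv_nz)
  \<comment> \<open>Scaling by the pair of \<open>inv l\<close> and its image \<open>m\<close> makes
    the relation monic, as long division requires; the leading one is left out of
    \<open>qs\<close>.\<close>
  define qs where "qs = map (\<lambda>(a, a'). (inv l \<otimes> a, m \<otimes> a')) qs1"
  have qs: "set qs \<subseteq> G" using qs1 D(7)[OF m] by (auto simp: qs_def)
  have qsc: "set (map fst qs) \<subseteq> carrier R" "set (map snd qs) \<subseteq> carrier R" using qs D(3,4) by auto
  have "map fst ((\<one>, \<one>) # qs) = map (\<lambda>b. inv l \<otimes> b) (map fst ps1)"
    using lc \<open>l \<noteq> \<zero>\<close> by (auto simp: qs_def ps1_eq)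
  moreover have "set (map fst ps1) \<subseteq> carrier R" using qs1c lc(1) by (simp add: ps1_eq)
  moreover have "eval (map fst ps1) c = \<zero>" using ps1 by (simp add: P_def)
  ultimately have root: "eval (\<one> # map fst qs) c = \<zero>"
    using eval_scalar[of "map fst ps1" "inv l" c] lc c(1) by (metis fst_conv list.map(2) r_null)
  have len: "length ps1 = Suc (length qs)" by (simp add: ps1_eq qs_def)
  have "length qs \<noteq> 0" using root c(1) by auto
  have "(\<one> # map snd qs) \<in> carrier (poly_ring R)"
    using qsc(2) by (auto simp: univ_poly_carrier[symmetric] polynomial_def)
  moreover have "length (\<one> # map snd qs) \<ge> 2" using \<open>length qs \<noteq> 0\<close> by (cases qs) auto
  ultimately obtain c' where c': "c' \<in> carrier R" "eval (\<one> # map snd qs) c' = \<zero>" using closed by blast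
  have "(\<one> # map snd qs) \<in> carrier ((snd ` G)[X])"
    using qs D(1) by (force simp: univ_poly_carrier[symmetric] polynomial_def)
  then have c'_alg: "(algebraic over (snd ` G)) c'" using c' by (intro algebraicI) auto
  \<comment> \<open>A list no longer than \<open>qs\<close> vanishes at \<open>c\<close> only if all
    its coefficients do, by minimality. A longer list is shortened by one division step, performed
    in both components with paired multipliers, and neither value changes.\<close>
  have forward: "eval (map snd gs) c' = \<zero>" if "set gs \<subseteq> G" "eval (map fst gs) c = \<zero>" for gs
    using that
  proof (induction "length gs" arbitrary: gs rule: less_induct)
    case less
    show ?case
    proof (cases "length gs \<le> length qs")
      case True
      then have "\<not> P gs" using min[of gs] len by auto
      then have z: "fst ` set gs \<subseteq> {\<zero>}" using less.prems by (simp add: P_def)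
      have "snd ` set gs \<subseteq> {\<zero>}"
      proof
        fix y assume "y \<in> snd ` set gs"
        then obtain x where x: "(x, y) \<in> set gs" by auto
        then have "x = \<zero>" using z by force
        then show "y \<in> {\<zero>}" using D(5)[of x y] x less.prems(1) by auto
      qed
      then show ?thesis using c'(1) by (induction gs) auto
    next
      case False
      then obtain g g' hs where gs: "gs = (g, g') # hs" by (cases gs) auto
      have g: "(g, g') \<in> G" and hs: "set hs \<subseteq> G" using less.prems(1) gs by auto
      have le: "length qs \<le> length hs" using False gs by simp
      define rs where "rs = map (\<lambda>(a, a'). (g \<otimes> a, g' \<otimes> a')) qs @ replicate (length hs - length qs) (\<zero>, \<zero>)"
      define ns where "ns = map2 (\<lambda>u w. (fst u \<ominus> fst w, snd u \<ominus> snd w)) hs rs"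
      have rsG: "set rs \<subseteq> G" using qs D(7)[OF g] D(2) by (auto simp: rs_def)
      have lrs: "length rs = length hs" using le by (simp add: rs_def)
      have nsG: "set ns \<subseteq> G"
      proof
        fix z assume "z \<in> set ns"
        then obtain q where q: "q \<in> set (zip hs rs)"
            "z = (\<lambda>(u, w). (fst u \<ominus> fst w, snd u \<ominus> snd w)) q"
          unfolding ns_def set_map by blast
        obtain u w where uw': "q = (u, w)" by (cases q)
        have uw: "z = (fst u \<ominus> fst w, snd u \<ominus> snd w)" "u \<in> set hs" "w \<in> set rs"
          using q set_zip_leftD[of u w hs rs] set_zip_rightD[of u w hs rs] by (auto simp: uw')
        then have "(fst u, snd u) \<in> G" "(fst w, snd w) \<in> G" using hs rsG by auto
        then show "z \<in> G" using uw(1) D(6) by simp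
      qed
      have hsc: "set (map fst hs) \<subseteq> carrier R" "set (map snd hs) \<subseteq> carrier R" using hs D(3,4) by auto
      have gc: "g \<in> carrier R" "g' \<in> carrier R" using D(3,4)[OF g] by auto
      have proj: "map fst ns = map2 (\<lambda>a b. a \<ominus> b) (map fst hs) (map fst rs)"
                 "map snd ns = map2 (\<lambda>a b. a \<ominus> b) (map snd hs) (map snd rs)"
        unfolding ns_def using lrs[symmetric]
        by (induction hs rs rule: list_induct2) auto
      have projr: "map fst rs = map (\<lambda>b. g \<otimes> b) (map fst qs) @ replicate (length (map fst hs) - length (map fst qs)) \<zero>"
                  "map snd rs = map (\<lambda>b. g' \<otimes> b) (map snd qs) @ replicate (length (map snd hs) - length (map snd qs)) \<zero>"
        by (auto simp: rs_def)
      have "eval (map fst ns) c = eval (g # map fst hs) c"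
        unfolding proj projr using le by (intro eval_reduce qsc hsc c gc root) auto
      then have "eval (map fst ns) c = \<zero>" using less.prems(2) gs by simp
      moreover have "length ns < length gs" using lrs by (simp add: ns_def gs)
      ultimately have "eval (map snd ns) c' = \<zero>" using less.hyps nsG by blast
      moreover have "eval (map snd ns) c' = eval (g' # map snd hs) c'"
        unfolding proj projr using le by (intro eval_reduce qsc hsc c' gc) auto
      ultimately show ?thesis by (simp add: gs)
    qed
  qed
  let ?A = "adjoin_pair G c c'"
  have S: "subfield (fst ` ?A) R"
    unfolding adjoin_pair_fst[OF G c(1) c'(1)] using simple_extension_is_subfield[OF K c(1)] c(2) by simp
  have "partial_iso ?A"
  proof (rule adjoin_pair_partial_iso[OF G c(1) c'(1)])
    fix gs assume gs: "set gs \<subseteq> G"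
    let ?y = "eval (map fst gs) c" and ?y' = "eval (map snd gs) c'"
    have yA: "(?y, ?y') \<in> ?A" by (rule adjoin_pair_evals[OF G c(1) c'(1) gs])
    note AD = adjoin_pair_carrier[OF G c(1) c'(1)]
    \<comment> \<open>The domain is a field, so multiplying by a pair over \<open>inv ?y\<close>
      turns \<open>(?y, \<zero>)\<close> into \<open>(\<one>, \<zero>)\<close>. Subtracting
      \<open>(\<one>, \<one>)\<close> gives \<open>(\<zero>, \<ominus> \<one>)\<close>, which
      \<open>forward\<close> excludes.\<close>
    have "?y' \<noteq> \<zero>" if nz: "?y \<noteq> \<zero>"
    proof
      assume z: "?y' = \<zero>"
      have yc: "?y \<in> carrier R" "?y' \<in> carrier R" using AD[OF yA] by auto
      have "inv ?y \<in> fst ` ?A" using subfield_m_inv(1)[OF S] yA nz by force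
      then obtain w where w: "(inv ?y, w) \<in> ?A" by auto
      have "(inv ?y \<otimes> ?y, w \<otimes> ?y') \<in> ?A" by (rule adjoin_pair_mult[OF G c(1) c'(1) w yA])
      then have 1: "(\<one>, \<zero>) \<in> ?A" using yc nz z AD[OF w] by simp
      have "(\<ominus> \<one>, \<ominus> \<one>) \<in> G" by (intro D(8,1))
      then have "(\<ominus> \<one>, \<ominus> \<one>) \<in> ?A" by (rule adjoin_pair_incl[OF G c(1) c'(1)])
      then have "(\<one> \<oplus> \<ominus> \<one>, \<zero> \<oplus> \<ominus> \<one>) \<in> ?A" by (rule adjoin_pair_add[OF G c(1) c'(1) 1])
      then have "(\<zero>, \<ominus> \<one>) \<in> ?A" by (simp add: r_neg)
      then obtain hs where "set hs \<subseteq> G" "\<zero> = eval (map fst hs) c" "\<ominus> \<one> = eval (map snd hs) c'"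
        using adjoin_pair_lists[OF G c(1) c'(1)] by blast
      then have "\<ominus> \<one> = \<zero>" using forward[of hs] by simp
      then show False by (metis add.inv_eq_1_iff one_closed one_not_zero)
    qed
    then show "?y = \<zero> \<longleftrightarrow> ?y' = \<zero>" using forward[OF gs] by blast
  qed
  then show ?thesis using c' c'_alg by blast
qed

section \<open>Maximal partial isomorphisms\<close>

lemma fracs_mono: "D \<subseteq> D' \<Longrightarrow> fracs D \<subseteq> fracs D'"
  unfolding fracs_def by blast

lemma fracs_least:
  assumes "subfield K R" "D \<subseteq> K"
  shows "fracs D \<subseteq> K"
proof
  fix x assume "x \<in> fracs D"
  then obtain a b where x: "x = a \<otimes> inv b" "a \<in> K" "b \<in> K" "b \<noteq> \<zero>" using assms(2) by (auto simp: fracs_def)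
  then have "inv b \<in> K" using subfield_m_inv(1)[OF assms(1), of b] by simp
  then show "x \<in> K" using x subringE(6)[OF subfieldE(1)[OF assms(1)], of a "inv b"] by simp
qed

text \<open>Maximality makes the domain a field, because fractions could be added. Every
  \<open>c\<close> in \<open>F\<close> is then algebraic over it and can be added too: its image is
  algebraic over the range, hence over \<open>F\<close>, and stays in \<open>F\<close> because
  \<open>F\<close> is relatively algebraically closed.\<close>

lemma maximal_partial_iso_domain:
  assumes closed: "\<And>p. p \<in> carrier (poly_ring R) \<Longrightarrow> length p \<ge> 2 \<Longrightarrow> \<exists>x\<in>carrier R. eval p x = \<zero>"
    and F: "subfield F R" "alg_cl F \<subseteq> F"
    and M: "partial_iso M" "M \<subseteq> F \<times> F"
    and max: "\<And>N. partial_iso N \<Longrightarrow> N \<subseteq> F \<times> F \<Longrightarrow> M \<subseteq> N \<Longrightarrow> N = M"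
    and alg: "F \<subseteq> alg_cl (fracs (fst ` M))"
  shows "fst ` M = F"
proof
  show "fst ` M \<subseteq> F" using M(2) by auto
  show "F \<subseteq> fst ` M"
  proof
    fix c assume "c \<in> F"
    obtain M' where M': "partial_iso M'" "M \<subseteq> M'" "fst ` M' = fracs (fst ` M)" "snd ` M' = fracs (snd ` M)"
      using partial_iso_fracs[OF M(1)] by blast
    have "fracs (fst ` M) \<subseteq> F" "fracs (snd ` M) \<subseteq> F" using M(2) by (auto intro!: fracs_least[OF F(1)])
    then have "fst ` M' \<subseteq> F" "snd ` M' \<subseteq> F" using M'(3,4) by simp_all
    moreover have "M' \<subseteq> fst ` M' \<times> snd ` M'" by force
    ultimately have "M' \<subseteq> F \<times> F" by blast
    then have "M' = M" using max M' by blast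
    then have fst: "fst ` M = fracs (fst ` M)" using M'(3) by simp
    have K: "subfield (fst ` M) R" using fracs_subfield(1)[OF partial_iso_fst_subring[OF M(1)]] fst by simp
    have "c \<in> alg_cl (fst ` M)" using alg \<open>c \<in> F\<close> fst by auto
    then have c: "c \<in> carrier R" "(algebraic over (fst ` M)) c" by (auto simp: alg_cl_def)
    obtain c' where c': "c' \<in> carrier R" "(algebraic over (snd ` M)) c'" "partial_iso (adjoin_pair M c c')"
      using adjoin_pair_algebraic[OF closed M(1) K c] by blast
    have "snd ` M \<subseteq> F" using M(2) by auto
    then have "c' \<in> alg_cl F" using c'(1,2) algebraic_mono by (auto simp: alg_cl_def)
    then have "c' \<in> F" using F(2) by auto
    then have "adjoin_pair M c c' \<subseteq> F \<times> F"
      by (intro adjoin_pair_subset[OF M(1) c(1) c'(1)] subfieldE(1)[OF F(1)] M(2) \<open>c \<in> F\<close>)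
    moreover have "M \<subseteq> adjoin_pair M c c'" using adjoin_pair_incl[OF M(1) c(1) c'(1)] by auto
    ultimately have "adjoin_pair M c c' = M" using max c'(3) by blast
    then show "c \<in> fst ` M" using adjoin_pair_mem[OF M(1) c(1) c'(1)] by force
  qed
qed

text \<open>Zorn's lemma gives a maximal extension inside \<open>F \<times> F\<close>. It is defined
  everywhere because \<open>F\<close> is algebraic over the fractions of the domain of
  \<open>G\<close>, and onto by the same argument for the converse relation, which is maximal as
  well.\<close>

lemma partial_iso_extends:
  assumes closed: "\<And>p. p \<in> carrier (poly_ring R) \<Longrightarrow> length p \<ge> 2 \<Longrightarrow> \<exists>x\<in>carrier R. eval p x = \<zero>"
    and F: "subfield F R" "alg_cl F \<subseteq> F"
    and G: "partial_iso G" "G \<subseteq> F \<times> F"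
    and alg: "F \<subseteq> alg_cl (fracs (fst ` G))" "F \<subseteq> alg_cl (fracs (snd ` G))"
  shows "\<exists>M. partial_iso M \<and> G \<subseteq> M \<and> fst ` M = F \<and> snd ` M = F"
proof -
  let ?A = "{N. partial_iso N \<and> G \<subseteq> N \<and> N \<subseteq> F \<times> F}"
  have "\<exists>M\<in>?A. \<forall>N\<in>?A. M \<subseteq> N \<longrightarrow> N = M"
  proof (rule subset_Zorn_nonempty)
    show "?A \<noteq> {}" using G by blast
    fix C assume C: "C \<noteq> {}" "subset.chain ?A C"
    then have CA: "N \<in> ?A" if "N \<in> C" for N using that unfolding subset_chain_def by blast
    obtain N0 where N0: "N0 \<in> C" using C(1) by blast
    have two: "\<exists>N\<in>C. y \<in> N \<and> z \<in> N" if yz: "y \<in> \<Union>C" "z \<in> \<Union>C" for y z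
    proof -
      obtain Y Z where "Y \<in> C" "y \<in> Y" "Z \<in> C" "z \<in> Z" using yz by blast
      moreover have "Y \<subseteq> Z \<or> Z \<subseteq> Y" using C(2) \<open>Y \<in> C\<close> \<open>Z \<in> C\<close> unfolding subset_chain_def by blast
      ultimately show ?thesis by blast
    qed
    have "partial_iso (\<Union>C)"
    proof (rule partial_isoI)
      show "\<Union>C \<subseteq> carrier R \<times> carrier R" proof
        fix z assume "z \<in> \<Union>C"
        then obtain N where "N \<in> C" "z \<in> N" by blast
        then have "z \<in> F \<times> F" using CA by auto
        then show "z \<in> carrier R \<times> carrier R" using subfieldE(3)[OF F(1)] by auto
      qed
      show "(\<one>, \<one>) \<in> \<Union>C" proof -
        have "partial_iso N0" using CA[OF N0] by simp
        then show ?thesis using N0 partial_isoD(1) by (intro UnionI[of N0])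
      qed
    next
      fix a a' assume "(a, a') \<in> \<Union>C"
      then obtain N where N: "N \<in> C" "(a, a') \<in> N" by blast
      then have "partial_iso N" using CA by blast
      then show "a = \<zero> \<longleftrightarrow> a' = \<zero>" using partial_isoD(5)[OF _ N(2)] by simp
    next
      fix a a' b b' assume "(a, a') \<in> \<Union>C" "(b, b') \<in> \<Union>C"
      then obtain N where N: "N \<in> C" "(a, a') \<in> N" "(b, b') \<in> N" using two by blast
      then have pX: "partial_iso N" using CA by blast
      show "(a \<ominus> b, a' \<ominus> b') \<in> \<Union>C" using partial_isoD(6)[OF pX N(2,3)] N(1) by blast
      show "(a \<otimes> b, a' \<otimes> b') \<in> \<Union>C" using partial_isoD(7)[OF pX N(2,3)] N(1) by blast
    qed
    moreover have "G \<subseteq> \<Union>C" "\<Union>C \<subseteq> F \<times> F" using CA N0 by blast+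
    ultimately show "\<Union>C \<in> ?A" by blast
  qed
  then obtain M where "M \<in> ?A" and max': "\<forall>N\<in>?A. M \<subseteq> N \<longrightarrow> N = M" by blast
  then have M: "partial_iso M" "G \<subseteq> M" "M \<subseteq> F \<times> F" by auto
  have max: "N = M" if "partial_iso N" "N \<subseteq> F \<times> F" "M \<subseteq> N" for N
    using max' that M(2) by auto
  have "fst ` M = F"
  proof (rule maximal_partial_iso_domain[OF closed F M(1,3) max])
    have "fracs (fst ` G) \<subseteq> fracs (fst ` M)" using M(2) by (intro fracs_mono image_mono)
    then show "F \<subseteq> alg_cl (fracs (fst ` M))" using alg(1) alg_cl_mono by blast
  qed
  moreover have "fst ` (M\<inverse>) = F"
  proof (rule maximal_partial_iso_domain[OF closed F partial_iso_converse[OF M(1)]])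
    have "fracs (snd ` G) \<subseteq> fracs (snd ` M)" using M(2) by (intro fracs_mono image_mono)
    then show "F \<subseteq> alg_cl (fracs (fst ` (M\<inverse>)))" using alg(2) alg_cl_mono by (metis snd_image_converse order_trans)
    show "M\<inverse> \<subseteq> F \<times> F" using M(3) by auto
    fix N assume "partial_iso N" "N \<subseteq> F \<times> F" "M\<inverse> \<subseteq> N"
    then have "partial_iso (N\<inverse>)" "N\<inverse> \<subseteq> F \<times> F" "M \<subseteq> N\<inverse>" using partial_iso_converse by auto
    then have "N\<inverse> = M" by (rule max)
    then show "N = M\<inverse>" by auto
  qed
  ultimately show ?thesis using M by (metis snd_image_converse)
qed

end

section \<open>An algebraically closed extension with independent elements\<close>

lemma (in ring) exists_maximalideal:
  assumes I: "ideal I R" "\<one> \<notin> I"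
  obtains J where "maximalideal J R" "I \<subseteq> J"
proof -
  let ?A = "{J. ideal J R \<and> I \<subseteq> J \<and> \<one> \<notin> J}"
  have "\<exists>M\<in>?A. \<forall>N\<in>?A. M \<subseteq> N \<longrightarrow> N = M"
  proof (rule subset_Zorn_nonempty)
    show "?A \<noteq> {}" using I by blast
    fix C assume C: "C \<noteq> {}" "subset.chain ?A C"
    then have CA: "C \<subseteq> ?A" unfolding subset_chain_def by blast
    have "subset.chain {J. ideal J R} C" using C(2) unfolding subset_chain_def by blast
    then have "ideal (\<Union>C) R" using chain_Union_is_ideal[of C] C(1) by simp
    then show "\<Union>C \<in> ?A" using CA C(1) by blast
  qed
  then obtain M where M: "ideal M R" "I \<subseteq> M" "\<one> \<notin> M" and max: "\<forall>N\<in>?A. M \<subseteq> N \<longrightarrow> N = M" by auto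
  have "maximalideal M R"
  proof (rule maximalidealI[OF M(1)])
    show "carrier R \<noteq> M" using M(3) one_closed by blast
    fix J assume J: "ideal J R" "M \<subseteq> J" "J \<subseteq> carrier R"
    show "J = M \<or> J = carrier R"
    proof (cases "\<one> \<in> J")
      case True
      then show ?thesis using ideal.one_imp_carrier[OF J(1)] by blast
    next
      case False
      then have "J \<in> ?A" using J M(2) by blast
      then show ?thesis using max J(2) by blast
    qed
  qed
  then show ?thesis using M(2) by (rule that)
qed

definition fun_ring :: "('a, 'm) ring_scheme \<Rightarrow> ('y \<Rightarrow> 'a) ring" where
  "fun_ring R = \<lparr>carrier = {g. \<forall>y. g y \<in> carrier R}, monoid.mult = (\<lambda>g h y. g y \<otimes>\<^bsub>R\<^esub> h y), monoid.one = (\<lambda>_. \<one>\<^bsub>R\<^esub>),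
     ring.zero = (\<lambda>_. \<zero>\<^bsub>R\<^esub>), ring.add = (\<lambda>g h y. g y \<oplus>\<^bsub>R\<^esub> h y)\<rparr>"

lemma fun_ring_simps:
  "g \<in> carrier (fun_ring R) \<longleftrightarrow> (\<forall>y. g y \<in> carrier R)"
  "g \<otimes>\<^bsub>fun_ring R\<^esub> h = (\<lambda>y. g y \<otimes>\<^bsub>R\<^esub> h y)"
  "g \<oplus>\<^bsub>fun_ring R\<^esub> h = (\<lambda>y. g y \<oplus>\<^bsub>R\<^esub> h y)"
  "\<one>\<^bsub>fun_ring R\<^esub> = (\<lambda>_. \<one>\<^bsub>R\<^esub>)" "\<zero>\<^bsub>fun_ring R\<^esub> = (\<lambda>_. \<zero>\<^bsub>R\<^esub>)"
  by (auto simp: fun_ring_def)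

lemma (in cring) fun_ring_cring: "cring (fun_ring R :: ('y \<Rightarrow> 'a) ring)"
proof (intro cringI abelian_groupI comm_monoidI)
  fix g assume "g \<in> carrier (fun_ring R :: ('y \<Rightarrow> 'a) ring)"
  then show "\<exists>h\<in>carrier (fun_ring R). h \<oplus>\<^bsub>fun_ring R\<^esub> g = \<zero>\<^bsub>fun_ring R\<^esub>"
    by (intro bexI[of _ "\<lambda>y. \<ominus> g y"]) (auto simp: fun_ring_simps l_neg)
next
  fix x y z assume "x \<in> carrier (fun_ring R :: ('y \<Rightarrow> 'a) ring)" "y \<in> carrier (fun_ring R :: ('y \<Rightarrow> 'a) ring)"
    "z \<in> carrier (fun_ring R :: ('y \<Rightarrow> 'a) ring)"
  then show "(x \<oplus>\<^bsub>fun_ring R\<^esub> y) \<otimes>\<^bsub>fun_ring R\<^esub> z = (x \<otimes>\<^bsub>fun_ring R\<^esub> z) \<oplus>\<^bsub>fun_ring R\<^esub> (y \<otimes>\<^bsub>fun_ring R\<^esub> z)"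
    by (simp add: fun_ring_simps l_distr)
qed (auto simp: fun_ring_simps a_ac m_ac)

lemma (in cring) fun_ring_eval_hom: "(\<lambda>g. g y) \<in> ring_hom (fun_ring R) R"
  by (auto simp: ring_hom_def fun_ring_simps)

lemma (in cring) fun_ring_uminus:
  assumes "g \<in> carrier (fun_ring R)"
  shows "\<ominus>\<^bsub>fun_ring R\<^esub> g = (\<lambda>y. \<ominus> g y)"
proof -
  interpret F: cring "fun_ring R" by (rule fun_ring_cring)
  show ?thesis using assms
    by (intro F.add.inv_equality) (auto simp: fun_ring_simps l_neg)
qed

section \<open>Thin subsets of affine space\<close>

context field
begin

lemma card_roots_le:
  assumes c: "\<And>i. i < n \<Longrightarrow> c i \<in> carrier R" "j < n" "c j \<noteq> \<zero>"
    and A: "finite A" "A \<subseteq> carrier R" "\<And>x. x \<in> A \<Longrightarrow> (\<Oplus>i\<in>{..<n}. c i \<otimes> x [^] i) = \<zero>"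
  shows "card A \<le> n"
proof -
  let ?l = "rev (map c [0..<n])"
  let ?p = "normalize ?l"
  have l: "set ?l \<subseteq> carrier R" using c by auto
  have p: "?p \<in> carrier (poly_ring R)"
    using normalize_gives_polynomial[OF l] by (simp add: univ_poly_carrier)
  have "?p \<noteq> []"
  proof
    assume "?p = []"
    then have "set ?l \<subseteq> {\<zero>}" by (rule normalize_eq_Nil)
    moreover have "c j \<in> set ?l" using c(2) by auto
    ultimately show False using c(3) by blast
  qed
  have "A \<subseteq> set_mset (roots ?p)"
  proof
    fix x assume x: "x \<in> A"
    then have xc: "x \<in> carrier R" using A(2) by auto
    have "eval ?l x = \<zero>" using eval_coeff_list[of n c x] c(1) xc A(3)[OF x] by simp
    then have "eval ?p x = \<zero>" using eval_normalize[OF l xc] by simp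
    then have "is_root ?p x" using xc \<open>?p \<noteq> []\<close> by (simp add: is_root_def)
    then show "x \<in> set_mset (roots ?p)" using roots_mem_iff_is_root[OF p] by simp
  qed
  then have "card A \<le> card (set_mset (roots ?p))" by (intro card_mono) auto
  also have "\<dots> \<le> size (roots ?p)" by (metis size_multiset_overloaded_eq card_eq_sum sum_mono
      count_greater_eq_one_iff)
  also have "\<dots> \<le> length ?p - 1" by (rule size_roots_le_degree[OF p])
  also have "\<dots> \<le> n" using normalize_length_le[of ?l] by simp
  finally show ?thesis .
qed

text \<open>Modelled on the zero set of a polynomial in the \<open>i\<close>-th coordinate whose
  coefficients do not depend on that coordinate: away from the zeros of one coefficient it meets
  each line parallel to the \<open>i\<close>-th axis in a bounded number of points.\<close>

definition line_bounded :: "nat \<Rightarrow> nat \<Rightarrow> (nat \<Rightarrow> 'a) set \<Rightarrow> bool" where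
  "line_bounded d i Z \<longleftrightarrow>
     (\<forall>y A. finite A \<and> A \<subseteq> carrier R \<and> (\<forall>z\<in>A. y(i := z) \<in> Z) \<longrightarrow> card A \<le> d)"

text \<open>Thin sets form an ideal of subsets, proper if \<open>R\<close> is infinite. A thin set
  needs finitely many directions and one bound \<open>d\<close> for all of them, which suits the
  induction in \<open>line_bounded_avoid\<close>.\<close>

definition thin :: "(nat \<Rightarrow> 'a) set \<Rightarrow> bool" where
  "thin Z \<longleftrightarrow> (\<exists>n d W. (\<forall>i. line_bounded d i (W i)) \<and> Z \<subseteq> (\<Union>i<n. W i))"

lemma thin_subset: "thin Z \<Longrightarrow> Y \<subseteq> Z \<Longrightarrow> thin Y"
  unfolding thin_def by (meson order_trans)

lemma line_bounded_Un:
  assumes "line_bounded d i Z" "line_bounded e i Y"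
  shows "line_bounded (d + e) i (Z \<union> Y)"
  unfolding line_bounded_def
proof (intro allI impI)
  fix y A assume A: "finite A \<and> A \<subseteq> carrier R \<and> (\<forall>z\<in>A. y(i := z) \<in> Z \<union> Y)"
  have "card {z \<in> A. y(i := z) \<in> Z} \<le> d"
    by (rule assms(1)[unfolded line_bounded_def, rule_format, where y = y]) (use A in auto)
  moreover have "card {z \<in> A. y(i := z) \<in> Y} \<le> e"
    by (rule assms(2)[unfolded line_bounded_def, rule_format, where y = y]) (use A in auto)
  moreover have "A = {z \<in> A. y(i := z) \<in> Z} \<union> {z \<in> A. y(i := z) \<in> Y}" using A by auto
  ultimately show "card A \<le> d + e" by (metis (no_types, lifting) add_mono card_Un_le order_trans)
qed

lemma line_bounded_empty: "line_bounded d i {}"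
  unfolding line_bounded_def by (metis all_not_in_conv card.empty empty_iff le0)

lemma thin_Un:
  assumes "thin Z" "thin Y"
  shows "thin (Z \<union> Y)"
proof -
  obtain n d W m e V where *: "\<And>i. line_bounded d i (W i)" "Z \<subseteq> (\<Union>i<n. W i)"
    "\<And>i. line_bounded e i (V i)" "Y \<subseteq> (\<Union>i<m. V i)"
    using assms unfolding thin_def by metis
  have "Z \<union> Y \<subseteq> (\<Union>i<max n m. W i \<union> V i)" using *(2,4) by fastforce
  moreover have "\<forall>i. line_bounded (d + e) i (W i \<union> V i)" using *(1,3) line_bounded_Un by blast
  ultimately show ?thesis unfolding thin_def
    by (intro exI[of _ "max n m"] exI[of _ "d + e"] exI[of _ "\<lambda>i. W i \<union> V i"] conjI)
qed

lemma thin_line_bounded: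
  assumes "line_bounded d i Z"
  shows "thin Z"
proof -
  have "\<forall>j. line_bounded d j (if j = i then Z else {})" using assms line_bounded_empty by simp
  moreover have "Z \<subseteq> (\<Union>j<Suc i. if j = i then Z else {})" by auto
  ultimately show ?thesis unfolding thin_def
    by (intro exI[of _ "Suc i"] exI[of _ d] exI[of _ "\<lambda>j. if j = i then Z else {}"] conjI)
qed

text \<open>Induction on the number of directions. Of \<open>d + 1\<close> values for coordinate
  \<open>n\<close>, at most \<open>d\<close> lead into \<open>W n\<close>, whatever the other
  coordinates are. So it suffices to choose the other coordinates in such a way that all
  \<open>d + 1\<close> values avoid the earlier sets.\<close>

lemma line_bounded_avoid:
  assumes inf: "infinite (carrier R)" and W: "\<And>i. line_bounded d i (W i)"
  shows "\<exists>y. \<forall>i<n. y \<notin> W i"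
  using W
proof (induction n arbitrary: d W)
  case 0
  then show ?case by simp
next
  case (Suc n)
  obtain A where A: "finite A" "card A = Suc d" "A \<subseteq> carrier R"
    using infinite_arbitrarily_large[OF inf] by blast
  \<comment> \<open>\<open>W' i\<close> collects the points that some value in \<open>A\<close>
    would move into \<open>W i\<close>. As a union over \<open>Suc d\<close> values it has the bound
    \<open>Suc d * d\<close>.\<close>
  define W' where "W' i = (if i < n then {y. \<exists>a\<in>A. y(n := a) \<in> W i} else {})" for i
  have "line_bounded (Suc d * d) i (W' i)" for i
  proof (cases "i < n")
    case True
    show ?thesis unfolding line_bounded_def
    proof (intro allI impI)
      fix y B assume B: "finite B \<and> B \<subseteq> carrier R \<and> (\<forall>z\<in>B. y(i := z) \<in> W' i)"
      let ?B = "\<lambda>a. {z \<in> B. (y(n := a))(i := z) \<in> W i}"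
      have "B \<subseteq> (\<Union>a\<in>A. ?B a)"
      proof
        fix z assume z: "z \<in> B"
        then have "y(i := z) \<in> W' i" using B by blast
        then obtain a where a: "a \<in> A" "(y(i := z))(n := a) \<in> W i" using True by (auto simp: W'_def)
        have "(y(i := z))(n := a) = (y(n := a))(i := z)" using True by (simp add: fun_upd_twist)
        then show "z \<in> (\<Union>a\<in>A. ?B a)" using a z by auto
      qed
      then have "card B \<le> card (\<Union>a\<in>A. ?B a)" using B A by (intro card_mono) auto
      also have "\<dots> \<le> (\<Sum>a\<in>A. card (?B a))" by (rule card_UN_le[OF A(1)])
      also have "\<dots> \<le> (\<Sum>a\<in>A. d)"
      proof (rule sum_mono)
        fix a
        show "card (?B a) \<le> d"
          by (rule Suc.prems[of i, unfolded line_bounded_def, rule_format, where y = "y(n := a)"]) (use B in auto)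
      qed
      finally show "card B \<le> Suc d * d" using A by simp
    qed
  qed (simp add: W'_def line_bounded_empty)
  then obtain y where y: "\<And>i. i < n \<Longrightarrow> y \<notin> W' i" using Suc.IH by blast
  have "card {a \<in> A. y(n := a) \<in> W n} \<le> d"
    by (rule Suc.prems[of n, unfolded line_bounded_def, rule_format, where y = y]) (use A in auto)
  then have "{a \<in> A. y(n := a) \<in> W n} \<noteq> A" using A(2) by (metis Suc_n_not_le_n)
  then obtain a where a: "a \<in> A" "y(n := a) \<notin> W n" by blast
  have "y(n := a) \<notin> W i" if "i < Suc n" for i
    using that a y[of i] by (cases "i = n") (auto simp: W'_def)
  then show ?case by blast
qed

lemma not_thin_UNIV: "infinite (carrier R) \<Longrightarrow> \<not> thin UNIV"
  using line_bounded_avoid unfolding thin_def by (metis UNIV_I UN_iff lessThan_iff subset_eq)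

text \<open>The functions on the affine space \<open>R\<^sup>\<nat>\<close> modulo a maximal ideal that contains the functions
  with thin support: the \<open>i\<close>-th coordinate becomes transcendental over the functions that do not
  depend on it, because a monic relation would have a thin zero set.\<close>

lemma independent_elements_exist:
  assumes inf: "infinite (carrier R)"
  shows "\<exists>(M :: ((nat \<Rightarrow> 'a) \<Rightarrow> 'a) set ring) h t N. field M \<and> h \<in> ring_hom R M \<and>
    (\<forall>i::nat. subfield (N i) M \<and> h ` carrier R \<subseteq> N i \<and> t i \<in> carrier M \<and> (\<forall>j. j \<noteq> i \<longrightarrow> t j \<in> N i) \<and>
       (ring.transcendental M over (N i)) (t i))"
proof -
  let ?F = "fun_ring R :: ((nat \<Rightarrow> 'a) \<Rightarrow> 'a) ring"
  interpret F: cring ?F by (rule fun_ring_cring)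
  let ?I = "{g \<in> carrier ?F. thin {y. g y \<noteq> \<zero>}}"
  have "ideal ?I ?F"
  proof (rule idealI[OF F.ring_axioms])
    show "subgroup ?I (add_monoid ?F)"
    proof (rule F.add.subgroupI)
      have "thin {}" using line_bounded_empty thin_line_bounded by blast
      then have "\<zero>\<^bsub>?F\<^esub> \<in> ?I" by (simp add: fun_ring_simps)
      then show "?I \<noteq> {}" by blast
    next
      fix g assume g: "g \<in> ?I"
      then have "{y. (\<ominus>\<^bsub>?F\<^esub> g) y \<noteq> \<zero>} = {y. g y \<noteq> \<zero>}" by (auto simp: fun_ring_uminus fun_ring_simps)
      then show "\<ominus>\<^bsub>?F\<^esub> g \<in> ?I" using g by auto
      fix h assume h: "h \<in> ?I"
      have "{y. (g \<oplus>\<^bsub>?F\<^esub> h) y \<noteq> \<zero>} \<subseteq> {y. g y \<noteq> \<zero>} \<union> {y. h y \<noteq> \<zero>}" by (auto simp: fun_ring_simps)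
      then show "g \<oplus>\<^bsub>?F\<^esub> h \<in> ?I" using g h thin_Un thin_subset by blast
    qed auto
    fix a x assume ax: "a \<in> ?I" "x \<in> carrier ?F"
    have "{y. (x \<otimes>\<^bsub>?F\<^esub> a) y \<noteq> \<zero>} \<subseteq> {y. a y \<noteq> \<zero>}" using ax by (auto simp: fun_ring_simps)
    then show xa: "x \<otimes>\<^bsub>?F\<^esub> a \<in> ?I" using ax thin_subset by blast
    have "a \<otimes>\<^bsub>?F\<^esub> x = x \<otimes>\<^bsub>?F\<^esub> a" using ax by (intro F.m_comm) auto
    then show "a \<otimes>\<^bsub>?F\<^esub> x \<in> ?I" using xa by simp
  qed
  moreover have "\<one>\<^bsub>?F\<^esub> \<notin> ?I" using not_thin_UNIV[OF inf] by (simp add: fun_ring_simps)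
  ultimately obtain J where J: "maximalideal J ?F" "?I \<subseteq> J" by (rule F.exists_maximalideal)
  interpret J: maximalideal J ?F by (rule J(1))
  define M where "M = ?F Quot J"
  interpret M: field M unfolding M_def by (rule J.quotient_is_field[OF F.cring_axioms])
  define \<pi> where "\<pi> g = J +>\<^bsub>?F\<^esub> g" for g
  interpret \<pi>: ring_hom_cring ?F M \<pi>
    unfolding M_def \<pi>_def by (rule J.rcos_ring_hom_cring[OF F.cring_axioms])
  have ker: "\<pi> g = \<zero>\<^bsub>M\<^esub> \<longleftrightarrow> g \<in> J" if "g \<in> carrier ?F" for g
    using J.rcos_const_imp_mem[OF that] J.a_rcos_const[of g] by (auto simp: M_def \<pi>_def FactRing_def)
  have one: "\<one>\<^bsub>?F\<^esub> \<notin> J" using J.I_notcarr J.one_imp_carrier by blast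
  \<comment> \<open>The pointwise inverse, with value zero at zeros, satisfies
    \<open>g = g * g * pinv g\<close>, so it represents the inverse in the quotient field. It
    depends on no more coordinates than \<open>g\<close>, which makes each \<open>N i\<close> a
    field.\<close>
  define pinv where "pinv g = (\<lambda>y. if g y = \<zero> then \<zero> else inv (g y))" for g :: "(nat \<Rightarrow> 'a) \<Rightarrow> 'a"
  have pinv: "pinv g \<in> carrier ?F" "\<And>y. g y \<otimes> pinv g y = (if g y = \<zero> then \<zero> else \<one>)"
    if "g \<in> carrier ?F" for g
    using that by (auto simp: pinv_def fun_ring_simps)
  have inv: "\<pi> g \<otimes>\<^bsub>M\<^esub> \<pi> (pinv g) = \<one>\<^bsub>M\<^esub>" if g: "g \<in> carrier ?F" "\<pi> g \<noteq> \<zero>\<^bsub>M\<^esub>" for g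
  proof -
    have "g \<otimes>\<^bsub>?F\<^esub> (g \<otimes>\<^bsub>?F\<^esub> pinv g) = g"
      using g(1) pinv(2)[OF g(1)] by (auto simp: fun_ring_simps fun_eq_iff)
    then have "\<pi> g \<otimes>\<^bsub>M\<^esub> (\<pi> g \<otimes>\<^bsub>M\<^esub> \<pi> (pinv g)) = \<pi> g \<otimes>\<^bsub>M\<^esub> \<one>\<^bsub>M\<^esub>"
      using g(1) pinv(1)[OF g(1)] by (metis F.m_closed M.r_one \<pi>.hom_closed \<pi>.hom_mult)
    then show ?thesis using g pinv(1)[OF g(1)] by (subst (asm) M.m_lcancel) auto
  qed
  define D where "D i = {g \<in> carrier ?F. \<forall>y z. g (y(i := z)) = g y}" for i
  define N where "N i = \<pi> ` D i" for i
  have DF: "g \<in> carrier ?F" if "g \<in> D i" for g i using that by (simp add: D_def)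
  have D: "subring (D i) ?F" for i
  proof (rule F.subringI)
    show "D i \<subseteq> carrier ?F" "\<one>\<^bsub>?F\<^esub> \<in> D i" by (auto simp: D_def fun_ring_simps)
    fix g h assume gh: "g \<in> D i" "h \<in> D i"
    show "\<ominus>\<^bsub>?F\<^esub> g \<in> D i" using gh(1) F.a_inv_closed[OF DF[OF gh(1)]]
      unfolding fun_ring_uminus[OF DF[OF gh(1)]] by (auto simp: D_def)
    show "g \<otimes>\<^bsub>?F\<^esub> h \<in> D i" "g \<oplus>\<^bsub>?F\<^esub> h \<in> D i" using gh by (auto simp: D_def fun_ring_simps)
  qed
  have subfieldN: "subfield (N i) M" for i
  proof (rule M.subfieldI')
    show "subring (N i) M" unfolding N_def by (rule ring_hom_ring.img_is_subring[OF J.rcos_ring_hom_ring[folded M_def \<pi>_def[abs_def]] D])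
    fix k assume "k \<in> N i - {\<zero>\<^bsub>M\<^esub>}"
    then obtain g where g: "g \<in> D i" "k = \<pi> g" "\<pi> g \<noteq> \<zero>\<^bsub>M\<^esub>" by (auto simp: N_def)
    have "pinv g \<in> D i" using g(1) pinv(1)[OF DF[OF g(1)]] by (simp add: D_def pinv_def)
    moreover have "inv\<^bsub>M\<^esub> k = \<pi> (pinv g)"
      unfolding g(2) using inv[OF DF[OF g(1)] g(3)] DF[OF g(1)] pinv(1)[OF DF[OF g(1)]]
      by (intro M.comm_inv_char) auto
    ultimately show "inv\<^bsub>M\<^esub> k \<in> N i" by (simp add: N_def)
  qed
  define h where "h a = \<pi> (\<lambda>_. a)" for a
  have "h \<in> ring_hom R M"
  proof -
    have "(\<lambda>a _. a) \<in> ring_hom R ?F" by (auto simp: ring_hom_def fun_ring_simps)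
    then have "\<pi> \<circ> (\<lambda>a _. a) \<in> ring_hom R M" using \<pi>.homh by (rule ring_hom_trans)
    then show ?thesis by (simp add: h_def[abs_def] o_def)
  qed
  moreover have "h ` carrier R \<subseteq> N i" for i
    unfolding h_def N_def by (intro image_subsetI imageI) (simp add: D_def fun_ring_simps)
  \<comment> \<open>Points of the affine space are arbitrary maps into the type, so coordinates
    outside the carrier are sent to zero.\<close>
  define T where "T i = (\<lambda>y :: nat \<Rightarrow> 'a. if y i \<in> carrier R then y i else \<zero>)" for i
  define t where "t i = \<pi> (T i)" for i
  have T: "T i \<in> carrier ?F" for i by (simp add: T_def fun_ring_simps)
  have t: "t i \<in> carrier M" for i using T by (simp add: t_def)
  have tN: "t j \<in> N i" if "j \<noteq> i" for i j
    using T that unfolding t_def N_def by (intro imageI) (simp add: D_def T_def)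
  have "(ring.transcendental M over (N i)) (t i)" for i
  proof (rule ccontr)
    assume "\<not> (ring.transcendental M over (N i)) (t i)"
    then have alg: "(M.algebraic over (N i)) (t i)" by (simp add: over_def)
    obtain n j :: nat and c where c: "\<And>l. c l \<in> N i" "j < n" "c j \<noteq> \<zero>\<^bsub>M\<^esub>"
        "(\<Oplus>\<^bsub>M\<^esub>l\<in>{..<n}. c l \<otimes>\<^bsub>M\<^esub> t i [^]\<^bsub>M\<^esub> l) = \<zero>\<^bsub>M\<^esub>"
      by (rule M.algebraic_coeffsE[OF subfieldE(1)[OF subfieldN] t alg]) blast
    have "\<exists>g. g \<in> D i \<and> c l = \<pi> g" for l using c(1)[of l] by (auto simp: N_def)
    then obtain g where g: "\<And>l. g l \<in> D i" "\<And>l. c l = \<pi> (g l)" by metis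
    have gF: "g l \<in> carrier ?F" for l using g(1) DF by blast
    have gR: "g l y \<in> carrier R" for l y using gF by (auto simp: fun_ring_simps)
    define Q where "Q = (\<Oplus>\<^bsub>?F\<^esub>l\<in>{..<n}. g l \<otimes>\<^bsub>?F\<^esub> T i [^]\<^bsub>?F\<^esub> l)"
    have QF: "Q \<in> carrier ?F" unfolding Q_def using gF T by (intro F.finsum_closed) auto
    have Qy: "Q y = (\<Oplus>l\<in>{..<n}. g l y \<otimes> T i y [^] l)" for y
    proof -
      interpret e: ring_hom_cring ?F R "\<lambda>g. g y"
        by (intro ring_hom_cring.intro ring_hom_cring_axioms.intro fun_ring_eval_hom F.cring_axioms is_cring)
      show ?thesis unfolding Q_def using gF T by (subst e.hom_finsum) (auto simp: o_def)
    qed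
    have "\<pi> Q = \<zero>\<^bsub>M\<^esub>"
      unfolding Q_def using gF T c(4) g(2) by (subst \<pi>.hom_finsum) (auto simp: o_def t_def)
    then have QJ: "Q \<in> J" using ker[OF QF] by simp
    let ?h = "g j"
    have hM: "\<pi> ?h \<noteq> \<zero>\<^bsub>M\<^esub>" using c(3) g(2) by simp
    \<comment> \<open>\<open>?e\<close> is the indicator of the set where the coefficient
      \<open>g j\<close> does not vanish. It is congruent to one because \<open>\<pi> ?h\<close> is
      invertible, so the points where the coefficient vanishes do no harm.\<close>
    let ?e = "?h \<otimes>\<^bsub>?F\<^esub> pinv ?h"
    have eF: "?e \<in> carrier ?F" using pinv(1)[OF gF] gF by simp
    have "\<pi> ?e = \<pi> \<one>\<^bsub>?F\<^esub>" using inv[OF gF hM] gF pinv(1)[OF gF] by simp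
    then have "\<pi> (\<one>\<^bsub>?F\<^esub> \<ominus>\<^bsub>?F\<^esub> ?e) = \<zero>\<^bsub>M\<^esub>" using eF by (simp add: F.minus_eq M.r_neg)
    then have eJ: "\<one>\<^bsub>?F\<^esub> \<ominus>\<^bsub>?F\<^esub> ?e \<in> J" using ker[OF F.minus_closed[OF F.one_closed eF]] by blast
    define Z where "Z = {y. ?h y \<noteq> \<zero> \<and> Q y = \<zero>}"
    have "line_bounded n i Z"
      unfolding line_bounded_def
    proof (intro allI impI)
      fix y A assume A: "finite A \<and> A \<subseteq> carrier R \<and> (\<forall>z\<in>A. y(i := z) \<in> Z)"
      show "card A \<le> n"
      proof (cases "A = {}")
        case False
        then obtain z where z: "z \<in> A" by blast
        have const: "g l (y(i := z)) = g l y" for l z using g(1)[of l] by (simp add: D_def)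
        show ?thesis
        proof (rule card_roots_le[of n "\<lambda>l. g l y" j])
          show "g j y \<noteq> \<zero>" using A z const[of j z] by (auto simp: Z_def)
          fix x assume x: "x \<in> A"
          then have "Q (y(i := x)) = \<zero>" "T i (y(i := x)) = x" using A by (auto simp: Z_def T_def)
          then show "(\<Oplus>l\<in>{..<n}. g l y \<otimes> x [^] l) = \<zero>" unfolding Qy const by simp
        qed (use A gR c(2) in auto)
      qed simp
    qed
    then have "thin Z" by (rule thin_line_bounded)
    define w where "w = (\<lambda>y. if y \<in> Z then \<one> else \<zero>)"
    have wF: "w \<in> carrier ?F" by (simp add: w_def fun_ring_simps)
    have "{y. w y \<noteq> \<zero>} = Z" by (auto simp: w_def)
    then have wJ: "w \<in> J" using J(2) wF \<open>thin Z\<close> by auto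
    let ?q = "?e \<otimes>\<^bsub>?F\<^esub> (pinv Q \<otimes>\<^bsub>?F\<^esub> Q)"
    have qJ: "?q \<in> J" using J.I_l_closed[OF J.I_l_closed[OF QJ pinv(1)[OF QF]] eF] .
    \<comment> \<open>\<open>w\<close>, \<open>a\<close> and \<open>?q\<close> are the indicators of
      \<open>Z\<close>, of the zeros of \<open>?h\<close>, and of the points where neither
      \<open>?h\<close> nor \<open>Q\<close> vanishes. They add up to one, and all three lie in
      \<open>J\<close>.\<close>
    define a where "a = \<one>\<^bsub>?F\<^esub> \<ominus>\<^bsub>?F\<^esub> ?e"
    have "\<one>\<^bsub>?F\<^esub> = w \<oplus>\<^bsub>?F\<^esub> (a \<oplus>\<^bsub>?F\<^esub> ?q)"
    proof
      fix y
      have hy: "?h y \<in> carrier R" "Q y \<in> carrier R" "pinv Q y \<in> carrier R"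
        using gR QF pinv(1)[OF QF] by (auto simp: fun_ring_simps)
      have e: "?h y \<otimes> pinv ?h y = (if ?h y = \<zero> then \<zero> else \<one>)" by (rule pinv(2)[OF gF])
      have q: "pinv Q y \<otimes> Q y = (if Q y = \<zero> then \<zero> else \<one>)"
        using pinv(2)[OF QF, of y] hy by (simp add: m_comm)
      have m: "a y = \<one> \<ominus> ?h y \<otimes> pinv ?h y"
        unfolding a_def F.minus_eq fun_ring_uminus[OF eF] by (simp add: fun_ring_simps minus_eq)
      show "\<one>\<^bsub>?F\<^esub> y = (w \<oplus>\<^bsub>?F\<^esub> (a \<oplus>\<^bsub>?F\<^esub> ?q)) y"
        unfolding fun_ring_simps m e q by (auto simp: w_def Z_def minus_eq r_neg)
    qed
    moreover have "w \<oplus>\<^bsub>?F\<^esub> (a \<oplus>\<^bsub>?F\<^esub> ?q) \<in> J"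
      using wJ eJ qJ unfolding a_def by (intro J.a_closed)
    ultimately show False using one by metis
  qed
  ultimately show ?thesis using M.field_axioms subfieldN t tN
    \<open>\<And>i. h ` carrier R \<subseteq> N i\<close> by blast
qed

end

section \<open>Roots of difference polynomials in extensions\<close>

lemma (in cring) mpoly_eval_subring:
  assumes S: "subring S R" and P: "P \<in> mpoly_carrier R I" "\<And>M. P M \<in> S" and x: "x \<in> I \<rightarrow> S"
  shows "mpoly_eval R x P \<in> S"
  unfolding mpoly_eval_mono_val
proof (rule subring_finsum[OF S])
  have mv: "mono_val R x M \<in> S" if "x \<in> set_mset M \<rightarrow> S" for M
    using that
  proof (induction M)
    case empty
    then show ?case using subringE(3)[OF S] by simp
  next
    case (add i M)
    then have "x \<in> set_mset (add_mset i M) \<rightarrow> carrier R" using subringE(1)[OF S] by blast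
    then show ?case using add subringE(6)[OF S] by (simp add: mono_val_add_mset)
  qed
  fix M assume M: "M \<in> {M. P M \<noteq> \<zero>}"
  then have "set_mset M \<subseteq> I" using P(1) by (auto simp: mpoly_carrier_iff)
  then have "mono_val R x M \<in> S" using x by (intro mv) auto
  then show "P M \<otimes> mono_val R x M \<in> S" using P(2) subringE(6)[OF S] by blast
qed

lemma poly_slice_hom:
  assumes "ring R" "ring S" "h \<in> ring_hom R S"
  shows "poly_slice S i d (h \<circ> P) = h \<circ> poly_slice R i d P"
  using ring_hom_zero[OF assms(3,1,2)] by (auto simp: poly_slice_def fun_eq_iff)

lemma mpoly_carrier_hom:
  assumes "ring R" "ring S" "h \<in> ring_hom R S" "P \<in> mpoly_carrier R I"
  shows "h \<circ> P \<in> mpoly_carrier S I"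
proof -
  note P = assms(4)[unfolded ring.mpoly_carrier_iff[OF assms(1)]]
  have z: "h \<zero>\<^bsub>R\<^esub> = \<zero>\<^bsub>S\<^esub>" by (rule ring_hom_zero[OF assms(3,1,2)])
  have "{M. (h \<circ> P) M \<noteq> \<zero>\<^bsub>S\<^esub>} \<subseteq> {M. P M \<noteq> \<zero>\<^bsub>R\<^esub>}" using z by auto
  then show ?thesis
    unfolding ring.mpoly_carrier_iff[OF assms(2)] using P ring_hom_closed[OF assms(3)]
    by (auto intro: finite_subset)
qed

text \<open>With the other arguments inserted, \<open>P\<close> becomes a polynomial in
  \<open>i\<close> with coefficients in \<open>S\<close>. The transcendental \<open>t\<close> is a
  root, so all coefficients are zero and every \<open>y\<close> is a root. This is how a generic
  element is replaced by an iterate of the automorphism.\<close>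

lemma (in field) mpoly_specialize:
  assumes S: "subfield S R" and t: "t \<in> carrier R" "(transcendental over S) t"
    and P: "P \<in> mpoly_carrier R I" "\<And>M. P M \<in> S" and x: "x \<in> I - {i} \<rightarrow> S"
    and z: "mpoly_eval R (x(i := t)) P = \<zero>" and y: "y \<in> carrier R"
  shows "mpoly_eval R (x(i := y)) P = \<zero>"
proof -
  obtain D where D: "\<And>M. P M \<noteq> \<zero> \<Longrightarrow> count M i \<le> D" using mpoly_degree_bound[OF P(1)] by blast
  define c where "c d = mpoly_eval R x (poly_slice R i d P)" for d
  have xc: "x \<in> I - {i} \<rightarrow> carrier R" using x subfieldE(3)[OF S] by blast
  have cS: "c d \<in> S" for d
    unfolding c_def
  proof (rule mpoly_eval_subring[OF subfieldE(1)[OF S] poly_slice_carrier[OF P(1)] _ x])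
    show "poly_slice R i d P M \<in> S" for M
      using P(2) subringE(2)[OF subfieldE(1)[OF S]] by (simp add: poly_slice_def)
  qed
  have ev: "mpoly_eval R (x(i := u)) P = (\<Oplus>d\<in>{..<Suc D}. c d \<otimes> u [^] d)" if u: "u \<in> carrier R" for u
  proof -
    have "mpoly_eval R (x(i := u)) P
        = (\<Oplus>d\<in>{..D}. mpoly_eval R (x(i := u)) (poly_slice R i d P) \<otimes> (x(i := u)) i [^] d)"
      using xc u D by (intro mpoly_eval_slices[OF P(1)]) auto
    also have "\<dots> = (\<Oplus>d\<in>{..<Suc D}. c d \<otimes> u [^] d)"
      unfolding lessThan_Suc_atMost
    proof (rule add.finprod_cong')
      fix d
      have "mpoly_eval R (x(i := u)) (poly_slice R i d P) = c d"
        unfolding c_def by (rule mpoly_eval_cong[OF poly_slice_carrier[OF P(1)] _ xc]) auto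
      then show "mpoly_eval R (x(i := u)) (poly_slice R i d P) \<otimes> (x(i := u)) i [^] d = c d \<otimes> u [^] d" by simp
    qed (use cS subfieldE(3)[OF S] u in auto)
    finally show ?thesis .
  qed
  have "c d = \<zero>" if "d < Suc D" for d
    using transcendental_coeffsD[OF subfieldE(1)[OF S] t, of "Suc D" c d] cS z ev[OF t(1)] that by simp
  then have "(\<Oplus>d\<in>{..<Suc D}. c d \<otimes> y [^] d) = \<zero>" using y by (intro add.finprod_one_eqI) auto
  then show ?thesis using ev[OF y] by simp
qed

text \<open>The condition \<open>0 < d\<close> keeps the polynomial nonconstant after leading zeros
  are dropped.\<close>

lemma (in field) coeffs_root_exists:
  assumes closed: "\<And>p. p \<in> carrier (poly_ring R) \<Longrightarrow> length p \<ge> 2 \<Longrightarrow> \<exists>x\<in>carrier R. eval p x = \<zero>"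
    and c: "\<And>i. i < (n::nat) \<Longrightarrow> c i \<in> carrier R" and d: "0 < d" "d < n" "c d \<noteq> \<zero>"
  shows "\<exists>x\<in>carrier R. (\<Oplus>i\<in>{..<n}. c i \<otimes> x [^] i) = \<zero>"
proof -
  let ?l = "rev (map c [0..<n])"
  let ?p = "normalize ?l"
  have l: "set ?l \<subseteq> carrier R" using c by auto
  have p: "?p \<in> carrier (poly_ring R)"
    using normalize_gives_polynomial[OF l] by (simp add: univ_poly_carrier)
  have "length ?p \<ge> 2"
  proof (rule ccontr)
    assume "\<not> length ?p \<ge> 2"
    then have "coeff ?p d = \<zero>" using d(1) by (intro coeff_length) auto
    then have "coeff ?l d = \<zero>" using normalize_coeff[of ?l] by simp
    moreover have "coeff ?l d = c d" using d(2) by (simp add: coeff_nth rev_nth)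
    ultimately show False using d(3) by simp
  qed
  then obtain x where x: "x \<in> carrier R" "eval ?p x = \<zero>" using closed p by blast
  then have "eval ?l x = \<zero>" using eval_normalize[OF l x(1)] by simp
  then show ?thesis using eval_coeff_list[of n c x] c x(1) by auto
qed

lemma field_hom_inj:
  assumes "field R" "field S" "h \<in> ring_hom R S"
  shows "inj_on h (carrier R)"
proof -
  interpret R: field R by fact
  interpret S: field S by fact
  interpret h: ring_hom_ring R S h by (rule ring_hom_ringI2[OF R.ring_axioms S.ring_axioms assms(3)])
  have "h \<one>\<^bsub>R\<^esub> \<noteq> \<zero>\<^bsub>S\<^esub>" by simp
  then have "h ` carrier R \<noteq> {\<zero>\<^bsub>S\<^esub>}" using R.one_closed by blast
  then show ?thesis by (rule h.non_trivial_field_hom_imp_inj[OF R.field_axioms])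
qed

lemma transcendental_hom:
  assumes "field M" "field L" "h \<in> ring_hom M L" "subfield K M" "x \<in> carrier M"
    and "(ring.transcendental M over K) x"
  shows "(ring.transcendental L over (h ` K)) (h x)"
proof (rule ccontr)
  interpret M: field M by fact
  interpret L: field L by fact
  interpret h: ring_hom_cring M L h
    by (intro ring_hom_cring.intro ring_hom_cring_axioms.intro assms M.is_cring L.is_cring)
  have hr: "ring_hom_ring M L h" by (rule ring_hom_ringI2[OF M.ring_axioms L.ring_axioms assms(3)])
  have inj: "inj_on h (carrier M)" by (rule field_hom_inj[OF assms(1-3)])
  assume "\<not> (ring.transcendental L over (h ` K)) (h x)"
  then have alg: "(L.algebraic over (h ` K)) (h x)" by (simp add: over_def)
  have "subring (h ` K) L" by (rule ring_hom_ring.img_is_subring[OF hr subfieldE(1)[OF assms(4)]])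
  then obtain n j :: nat and c where c: "\<And>i. c i \<in> h ` K" "j < n" "c j \<noteq> \<zero>\<^bsub>L\<^esub>"
      "(\<Oplus>\<^bsub>L\<^esub>i\<in>{..<n}. c i \<otimes>\<^bsub>L\<^esub> h x [^]\<^bsub>L\<^esub> i) = \<zero>\<^bsub>L\<^esub>"
    by (rule L.algebraic_coeffsE[OF _ h.hom_closed[OF assms(5)] alg]) blast
  have "\<exists>b. b \<in> K \<and> c i = h b" for i using c(1)[of i] by auto
  then obtain b where b: "\<And>i. b i \<in> K" "\<And>i. c i = h (b i)" by metis
  have bM: "b i \<in> carrier M" for i using b(1) subfieldE(3)[OF assms(4)] by auto
  have s: "(\<Oplus>\<^bsub>M\<^esub>i\<in>{..<n}. b i \<otimes>\<^bsub>M\<^esub> x [^]\<^bsub>M\<^esub> i) \<in> carrier M"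
    using bM assms(5) by (intro M.finsum_closed) auto
  have "h (\<Oplus>\<^bsub>M\<^esub>i\<in>{..<n}. b i \<otimes>\<^bsub>M\<^esub> x [^]\<^bsub>M\<^esub> i) = h \<zero>\<^bsub>M\<^esub>"
    using c(4) b(2) bM assms(5) by (subst h.hom_finsum) (auto simp: o_def)
  then have "(\<Oplus>\<^bsub>M\<^esub>i\<in>{..<n}. b i \<otimes>\<^bsub>M\<^esub> x [^]\<^bsub>M\<^esub> i) = \<zero>\<^bsub>M\<^esub>"
    using inj_onD[OF inj _ s M.zero_closed] by simp
  then have "b j = \<zero>\<^bsub>M\<^esub>"
    using M.transcendental_coeffsD[OF subfieldE(1)[OF assms(4)] assms(5,6), of n b j] b(1) c(2) by blast
  then show False using c(3) b(2)[of j] by simp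
qed

text \<open>Algebraic independence of the \<open>t i\<close> over \<open>k\<close> in the form in
  which it is used: \<open>N i\<close> contains the image of \<open>k\<close> and all other generic
  elements, and \<open>t i\<close> is transcendental over it. Smaller fields inherit this by
  monotonicity.\<close>

locale generic_extension = k: field k + field L for k :: "('b, 'm) ring_scheme" and L :: "('c, 'n) ring_scheme" (structure) +
  fixes h :: "'b \<Rightarrow> 'c" and t :: "nat \<Rightarrow> 'c" and N :: "nat \<Rightarrow> 'c set"
  assumes closed: "\<And>p. p \<in> carrier (poly_ring L) \<Longrightarrow> length p \<ge> 2 \<Longrightarrow> \<exists>x\<in>carrier L. eval p x = \<zero>"
    and hom: "h \<in> ring_hom k L"
    and N: "subfield (N i) L" "h ` carrier k \<subseteq> N i" "j \<noteq> i \<Longrightarrow> t j \<in> N i"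
    and t: "t i \<in> carrier L" "(transcendental over (N i)) (t i)"

text \<open>The embedding into an algebraic closure is injective, so the \<open>t i\<close> stay
  transcendental over the images of the \<open>N i\<close>.\<close>

lemma (in field) generic_extension_exists:
  assumes inf: "infinite (carrier R)"
  shows "\<exists>(L :: (((((nat \<Rightarrow> 'a) \<Rightarrow> 'a) set) list \<times> nat) multiset \<Rightarrow> ((nat \<Rightarrow> 'a) \<Rightarrow> 'a) set) ring) h t N.
    generic_extension R L h t N"
proof -
  obtain M :: "((nat \<Rightarrow> 'a) \<Rightarrow> 'a) set ring" and h t N where M: "field M" "h \<in> ring_hom R M"
    and N: "\<And>i::nat. subfield (N i) M" "\<And>i. h ` carrier R \<subseteq> N i" "\<And>i j. j \<noteq> i \<Longrightarrow> t j \<in> N i"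
    and t: "\<And>i. t i \<in> carrier M" "\<And>i. (ring.transcendental M over (N i)) (t i)"
    using independent_elements_exist[OF inf] by metis
  interpret M: field M by (rule M(1))
  obtain L :: "(((((nat \<Rightarrow> 'a) \<Rightarrow> 'a) set) list \<times> nat) multiset \<Rightarrow> ((nat \<Rightarrow> 'a) \<Rightarrow> 'a) set) ring"
    where L: "algebraic_closure L (M.indexed_const ` carrier M)" "M.indexed_const \<in> ring_hom M L"
    using M.exists_closure by blast
  interpret L: algebraic_closure L "M.indexed_const ` carrier M" by (rule L(1))
  let ?e = "M.indexed_const"
  interpret e: ring_hom_ring M L ?e by (rule ring_hom_ringI2[OF M.ring_axioms L.ring_axioms L(2)])
  have "generic_extension R L (?e \<circ> h) (?e \<circ> t) (\<lambda>i. ?e ` N i)"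
  proof (intro generic_extension.intro generic_extension_axioms.intro field_axioms L.field_axioms)
    fix p assume p: "p \<in> carrier (poly_ring L)" "2 \<le> length p"
    then have "size (L.roots p) = length p - 1" using L.roots_over_carrier[OF p(1)] by (simp add: L.splitted_def)
    then have "L.roots p \<noteq> {#}" using p(2) by auto
    then obtain x where "x \<in># L.roots p" by blast
    then have "L.is_root p x" using L.roots_mem_iff_is_root[OF p(1)] by simp
    then show "\<exists>x\<in>carrier L. L.eval p x = \<zero>\<^bsub>L\<^esub>" by (auto simp: L.is_root_def)
  next
    show "?e \<circ> h \<in> ring_hom R L" using M(2) L(2) by (rule ring_hom_trans)
    show "subfield (?e ` N i) L" for i using e.img_is_subfield(2)[OF N(1) L.one_not_zero] .
    show "(?e \<circ> h) ` carrier R \<subseteq> ?e ` N i" for i using N(2)[of i] by auto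
    show "j \<noteq> i \<Longrightarrow> (?e \<circ> t) j \<in> ?e ` N i" for i j using N(3) by auto
    show "(?e \<circ> t) i \<in> carrier L" for i using t(1) by simp
    show "(L.transcendental over (?e ` N i)) ((?e \<circ> t) i)" for i
      using transcendental_hom[OF M.field_axioms L.field_axioms L(2) N(1) t] by simp
  qed
  then show ?thesis by blast
qed

section \<open>Subfields generated by generic elements\<close>

context generic_extension
begin

definition k0 :: "'c set" where "k0 = h ` carrier k"

definition gen :: "nat set \<Rightarrow> 'c set" where "gen A = generate_field L (k0 \<union> t ` A)"

lemma hom_ring: "ring_hom_ring k L h"
  by (rule ring_hom_ringI2[OF k.ring_axioms ring_axioms hom])

lemma k0_carrier: "k0 \<union> t ` A \<subseteq> carrier L"
  using t(1) ring_hom_closed[OF hom] by (auto simp: k0_def)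

lemma gen_subfield: "subfield (gen A) L"
  unfolding gen_def by (rule generate_field_is_subfield[OF k0_carrier])

lemma gen_incl: "k0 \<subseteq> gen A" "t ` A \<subseteq> gen A"
  unfolding gen_def by (auto intro: generate_field.incl)

lemma gen_least:
  assumes "subfield K L" "k0 \<subseteq> K" "t ` A \<subseteq> K"
  shows "gen A \<subseteq> K"
  unfolding gen_def using assms k0_carrier by (intro generate_field_min_subfield1) auto

lemma gen_mono: "A \<subseteq> B \<Longrightarrow> gen A \<subseteq> gen B"
  using gen_least[OF gen_subfield gen_incl(1)] gen_incl(2)[of B] by blast

lemma gen_N:
  assumes "i \<notin> A"
  shows "gen A \<subseteq> N i"
proof -
  have "t ` A \<subseteq> N i" using assms by (intro image_subsetI N(3)) auto
  then show ?thesis using gen_least[OF N(1)] N(2) by (simp add: k0_def)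
qed

lemma t_transcendental_gen: "i \<notin> A \<Longrightarrow> (transcendental over (gen A)) (t i)"
  using transcendental_mono[OF gen_N t(2)] .

text \<open>Iterates of the automorphism are only algebraic over the fields \<open>gen A\<close>, so
  specialization needs transcendence over an algebraic closure.\<close>

lemma t_transcendental_alg_cl: "(transcendental over (alg_cl (N i))) (t i)"
proof (rule ccontr)
  assume "\<not> ?thesis"
  then have "(algebraic over (alg_cl (N i))) (t i)" by (simp add: over_def)
  then have "t i \<in> alg_cl (N i)" by (rule alg_cl_idem[OF N(1) t(1)])
  then show False using t(2) by (simp add: alg_cl_def over_def)
qed

lemma mpoly_hom: "P \<in> mpoly_carrier k I \<Longrightarrow> h \<circ> P \<in> mpoly_carrier L I"
  by (rule mpoly_carrier_hom[OF k.ring_axioms ring_axioms hom])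

lemma eval_gen:
  assumes "P \<in> mpoly_carrier k A"
  shows "mpoly_eval L t (h \<circ> P) \<in> gen A"
proof (rule mpoly_eval_subring[OF subfieldE(1)[OF gen_subfield] mpoly_hom[OF assms]])
  show "(h \<circ> P) M \<in> gen A" for M
    using assms gen_incl(1)[of A] by (auto simp: k.mpoly_carrier_iff k0_def)
  show "t \<in> A \<rightarrow> gen A" using gen_incl(2) by auto
qed

lemma eval_t_slices:
  assumes P: "P \<in> mpoly_carrier k I" and x: "x \<in> carrier L" and D: "\<And>M. P M \<noteq> \<zero>\<^bsub>k\<^esub> \<Longrightarrow> count M i \<le> D"
  shows "mpoly_eval L (t(i := x)) (h \<circ> P)
    = (\<Oplus>d\<in>{..<Suc D}. mpoly_eval L t (h \<circ> poly_slice k i d P) \<otimes> x [^] d)"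
proof -
  have h0: "h \<zero>\<^bsub>k\<^esub> = \<zero>" by (rule ring_hom_zero[OF hom k.ring_axioms ring_axioms])
  have "mpoly_eval L (t(i := x)) (h \<circ> P)
      = (\<Oplus>d\<in>{..D}. mpoly_eval L (t(i := x)) (poly_slice L i d (h \<circ> P)) \<otimes> (t(i := x)) i [^] d)"
  proof (rule mpoly_eval_slices[OF mpoly_hom[OF P]])
    fix M assume "(h \<circ> P) M \<noteq> \<zero>"
    then have "P M \<noteq> \<zero>\<^bsub>k\<^esub>" using h0 by auto
    then show "count M i \<le> D" by (rule D)
  qed (use t x in auto)
  also have "\<dots> = (\<Oplus>d\<in>{..<Suc D}. mpoly_eval L t (h \<circ> poly_slice k i d P) \<otimes> x [^] d)"
    unfolding lessThan_Suc_atMost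
  proof (rule add.finprod_cong')
    have s: "h \<circ> poly_slice k i d P \<in> mpoly_carrier L (I - {i})" for d
      by (rule mpoly_hom[OF k.poly_slice_carrier[OF P]])
    show "(\<lambda>d. mpoly_eval L t (h \<circ> poly_slice k i d P) \<otimes> x [^] d) \<in> {..D} \<rightarrow> carrier L"
      using mpoly_eval_closed[OF s] t(1) x by auto
    fix d
    have "mpoly_eval L (t(i := x)) (h \<circ> poly_slice k i d P) = mpoly_eval L t (h \<circ> poly_slice k i d P)"
      by (rule mpoly_eval_cong[OF s]) (use t in auto)
    then show "mpoly_eval L (t(i := x)) (poly_slice L i d (h \<circ> P)) \<otimes> (t(i := x)) i [^] d
        = mpoly_eval L t (h \<circ> poly_slice k i d P) \<otimes> x [^] d"
      using poly_slice_hom[OF k.ring_axioms ring_axioms hom, of i d P] by simp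
  qed simp
  finally show ?thesis .
qed

lemma slice_nonzero:
  assumes "P M \<noteq> \<zero>\<^bsub>k\<^esub>"
  shows "\<exists>M'. poly_slice k i (count M i) P M' \<noteq> \<zero>\<^bsub>k\<^esub>"
proof -
  have "M - replicate_mset (count M i) i \<in> {M'. poly_slice k i (count M i) P M' \<noteq> \<zero>\<^bsub>k\<^esub>}"
    unfolding k.poly_slice_supp using assms by blast
  then show ?thesis by blast
qed

text \<open>Induction on the indeterminates: some slice in \<open>i\<close> is a nonzero polynomial,
  so its value is nonzero by induction. These values lie in \<open>N i\<close> and are the
  coefficients of a polynomial in \<open>t i\<close>, which is transcendental over
  \<open>N i\<close>.\<close>

lemma eval_t_nonzero:
  assumes "finite A" "P \<in> mpoly_carrier k A" "P M \<noteq> \<zero>\<^bsub>k\<^esub>"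
  shows "mpoly_eval L t (h \<circ> P) \<noteq> \<zero>"
  using assms
proof (induction A arbitrary: P M rule: finite_induct)
  case empty
  note P = empty.prems(1)[unfolded k.mpoly_carrier_iff]
  have "P M' = \<zero>\<^bsub>k\<^esub>" if "M' \<noteq> {#}" for M' using P that by auto
  moreover have "h \<zero>\<^bsub>k\<^esub> = \<zero>" by (rule ring_hom_zero[OF hom k.ring_axioms ring_axioms])
  moreover have hc: "h (P M) \<in> carrier L" for M using P ring_hom_closed[OF hom] by blast
  ultimately have "mpoly_eval L t (h \<circ> P) = (\<Oplus>M\<in>{{#}}. (h \<circ> P) M \<otimes> mono_val L t M)"
    by (intro mpoly_evalI) auto
  then have "mpoly_eval L t (h \<circ> P) = h (P {#})" using hc by simp
  moreover have "P {#} \<noteq> \<zero>\<^bsub>k\<^esub>" using P empty.prems(2) by auto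
  moreover have "inj_on h (carrier k)" by (rule field_hom_inj[OF k.field_axioms field_axioms hom])
  ultimately show ?case using \<open>h \<zero>\<^bsub>k\<^esub> = \<zero>\<close> P inj_onD[of h "carrier k" "P {#}" "\<zero>\<^bsub>k\<^esub>"]
    by (metis k.zero_closed)
next
  case (insert i A)
  obtain D where D: "\<And>M. P M \<noteq> \<zero>\<^bsub>k\<^esub> \<Longrightarrow> count M i \<le> D"
    using k.mpoly_degree_bound[OF insert.prems(1)] by blast
  define c where "c d = mpoly_eval L t (h \<circ> poly_slice k i d P)" for d
  have slice: "poly_slice k i d P \<in> mpoly_carrier k A" for d
    using k.poly_slice_carrier[OF insert.prems(1), of i d] insert.hyps(2) by simp
  have cN: "c d \<in> N i" for d unfolding c_def using eval_gen[OF slice] gen_N[OF insert.hyps(2)] by blast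
  have "c (count M i) \<noteq> \<zero>"
    unfolding c_def using slice_nonzero[of P M i] insert.IH[OF slice] insert.prems(2) by blast
  moreover have "mpoly_eval L t (h \<circ> P) = (\<Oplus>d\<in>{..<Suc D}. c d \<otimes> t i [^] d)"
    using eval_t_slices[OF insert.prems(1) t(1)[of i] D] by (simp add: c_def)
  moreover have "count M i < Suc D" using D[OF insert.prems(2)] by simp
  ultimately show ?case
    using transcendental_coeffsD[OF subfieldE(1)[OF N(1)] t, of "Suc D" c i "count M i"] cN by force
qed

end

lemma partial_iso_automorphism:
  assumes L: "field L" and F: "subfield F L" and M: "ring.partial_iso L M" "fst ` M = F" "snd ` M = F"
  shows "\<exists>\<tau>. \<tau> \<in> ring_iso (L\<lparr>carrier := F\<rparr>) (L\<lparr>carrier := F\<rparr>) \<and> (\<forall>(x, y)\<in>M. \<tau> x = y)"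
proof -
  interpret L: field L by fact
  define \<tau> where "\<tau> x = (THE y. (x, y) \<in> M)" for x
  have \<tau>: "\<tau> x = y" if "(x, y) \<in> M" for x y
    unfolding \<tau>_def using that L.partial_iso_inj[OF M(1)] by (intro the_equality) blast+
  have mem: "(x, \<tau> x) \<in> M" if "x \<in> F" for x
  proof -
    obtain y where "(x, y) \<in> M" using \<open>x \<in> F\<close> M(2) by force
    then show ?thesis using \<tau> by simp
  qed
  have cl: "\<tau> x \<in> F" if "x \<in> F" for x using mem[OF that] M(3) by force
  note D = L.partial_isoD[OF M(1)]
  have "\<tau> \<in> ring_hom (L\<lparr>carrier := F\<rparr>) (L\<lparr>carrier := F\<rparr>)"
  proof (rule ring_hom_memI)
    fix x y assume xy: "x \<in> carrier (L\<lparr>carrier := F\<rparr>)" "y \<in> carrier (L\<lparr>carrier := F\<rparr>)"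
    show "\<tau> (x \<otimes>\<^bsub>L\<lparr>carrier := F\<rparr>\<^esub> y) = \<tau> x \<otimes>\<^bsub>L\<lparr>carrier := F\<rparr>\<^esub> \<tau> y"
      using \<tau>[OF D(7)[OF mem mem]] xy by simp
    show "\<tau> (x \<oplus>\<^bsub>L\<lparr>carrier := F\<rparr>\<^esub> y) = \<tau> x \<oplus>\<^bsub>L\<lparr>carrier := F\<rparr>\<^esub> \<tau> y"
      using \<tau>[OF D(9)[OF mem mem]] xy by simp
  next
    show "\<tau> \<one>\<^bsub>L\<lparr>carrier := F\<rparr>\<^esub> = \<one>\<^bsub>L\<lparr>carrier := F\<rparr>\<^esub>" using \<tau>[OF D(1)] by simp
  qed (use cl in auto)
  moreover have "bij_betw \<tau> (carrier (L\<lparr>carrier := F\<rparr>)) (carrier (L\<lparr>carrier := F\<rparr>))"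
  proof -
    have "inj_on \<tau> F" using mem L.partial_iso_inj[OF M(1)] by (metis inj_onI)
    moreover have "\<tau> ` F = F"
    proof
      show "\<tau> ` F \<subseteq> F" using cl by blast
      show "F \<subseteq> \<tau> ` F"
      proof
        fix y assume "y \<in> F"
        then obtain x where x: "(x, y) \<in> M" using M(3) by force
        then have "x \<in> F" using M(2) by force
        then show "y \<in> \<tau> ` F" using \<tau>[OF x] by blast
      qed
    qed
    ultimately show ?thesis by (simp add: bij_betw_def)
  qed
  ultimately have "\<tau> \<in> ring_iso (L\<lparr>carrier := F\<rparr>) (L\<lparr>carrier := F\<rparr>)" by (simp add: ring_iso_def)
  then show ?thesis using \<tau> by blast
qed

section \<open>Automorphisms that shift the generic elements\<close>

context generic_extension
begin

context
  fixes \<sigma> assumes \<sigma>: "\<sigma> \<in> ring_iso k k"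
begin

definition base_graph :: "('c \<times> 'c) set" where
  "base_graph = {(h x, h (\<sigma> x)) | x. x \<in> carrier k}"

lemma \<sigma>_hom: "\<sigma> \<in> ring_hom k k" and \<sigma>_bij: "bij_betw \<sigma> (carrier k) (carrier k)"
  using \<sigma> by (auto simp: ring_iso_def)

lemma base_graph_partial_iso: "partial_iso base_graph"
proof (rule partial_isoI)
  interpret h: ring_hom_ring k L h by (rule hom_ring)
  interpret s: ring_hom_ring k k \<sigma> by (rule ring_hom_ringI2[OF k.ring_axioms k.ring_axioms \<sigma>_hom])
  have I: "(h x, h (\<sigma> x)) \<in> base_graph" if "x \<in> carrier k" for x using that by (auto simp: base_graph_def)
  show "base_graph \<subseteq> carrier L \<times> carrier L" by (auto simp: base_graph_def)
  show "(\<one>, \<one>) \<in> base_graph" using I[OF k.one_closed] by simp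
  fix a a' assume "(a, a') \<in> base_graph"
  then obtain x where x: "a = h x" "a' = h (\<sigma> x)" "x \<in> carrier k" by (auto simp: base_graph_def)
  have hz: "h y = \<zero> \<longleftrightarrow> y = \<zero>\<^bsub>k\<^esub>" if "y \<in> carrier k" for y
    using inj_onD[OF field_hom_inj[OF k.field_axioms field_axioms hom], of y "\<zero>\<^bsub>k\<^esub>"] that by auto
  have "\<sigma> x = \<zero>\<^bsub>k\<^esub> \<longleftrightarrow> x = \<zero>\<^bsub>k\<^esub>"
    using inj_onD[OF field_hom_inj[OF k.field_axioms k.field_axioms \<sigma>_hom], of x "\<zero>\<^bsub>k\<^esub>"] x(3) by auto
  then show "a = \<zero> \<longleftrightarrow> a' = \<zero>" using x hz by auto
  fix b b' assume "(b, b') \<in> base_graph"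
  then obtain y where y: "b = h y" "b' = h (\<sigma> y)" "y \<in> carrier k" by (auto simp: base_graph_def)
  show "(a \<otimes> b, a' \<otimes> b') \<in> base_graph" using I[of "x \<otimes>\<^bsub>k\<^esub> y"] x y by simp
  show "(a \<ominus> b, a' \<ominus> b') \<in> base_graph" using I[of "x \<ominus>\<^bsub>k\<^esub> y"] x y by (simp add: k.minus_eq minus_eq)
qed

lemma base_graph_fst: "fst ` base_graph = k0" and base_graph_snd: "snd ` base_graph = k0"
proof -
  show "fst ` base_graph = k0" by (force simp: base_graph_def k0_def)
  have "snd ` base_graph = h ` (\<sigma> ` carrier k)" by (force simp: base_graph_def)
  then show "snd ` base_graph = k0" using \<sigma>_bij by (simp add: bij_betw_def k0_def)
qed

lemma subfield_pair_subset:
  assumes G: "partial_iso G" "fst ` G \<subseteq> S" "snd ` G \<subseteq> S'" and S: "subfield S L" "subfield S' L" and c: "c \<in> S" "c' \<in> S'"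
  shows "fst ` adjoin_pair G c c' \<subseteq> S \<and> snd ` adjoin_pair G c c' \<subseteq> S'"
proof -
  have cc: "c \<in> carrier L" "c' \<in> carrier L" using c subfieldE(3)[OF S(1)] subfieldE(3)[OF S(2)] by auto
  have "G \<subseteq> S \<times> S'" using G(2,3) by force
  then have "adjoin_pair G c c' \<subseteq> S \<times> S'"
    by (rule adjoin_pair_subset[OF G(1) cc subfieldE(1)[OF S(1)] subfieldE(1)[OF S(2)] _ c])
  then show ?thesis by auto
qed

lemma gen_mem: "i \<in> A \<Longrightarrow> t i \<in> gen A"
  using gen_incl(2) by blast

text \<open>The pairs are adjoined in increasing order; each new element and its image are
  transcendental over the domain and range obtained so far, which involve only earlier generic
  elements. The range avoids \<open>t (Suc j)\<close>, which stays free to become the image of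
  \<open>a\<close>.\<close>

lemma shift_graph_exists:
  "\<exists>G. partial_iso G \<and> base_graph \<subseteq> G \<and> (\<forall>l. j < l \<and> l \<le> j + n \<longrightarrow> (t l, t (Suc l)) \<in> G) \<and>
     fst ` G \<subseteq> gen {j<..j + n} \<and> snd ` G \<subseteq> gen {Suc j<..Suc (j + n)}"
proof (induction n)
  case 0
  show ?case
    using base_graph_partial_iso gen_incl(1) base_graph_fst base_graph_snd by (intro exI[of _ base_graph]) auto
next
  case (Suc n)
  then obtain G where G: "partial_iso G" "base_graph \<subseteq> G" "\<forall>l. j < l \<and> l \<le> j + n \<longrightarrow> (t l, t (Suc l)) \<in> G"
    "fst ` G \<subseteq> gen {j<..j + n}" "snd ` G \<subseteq> gen {Suc j<..Suc (j + n)}" by blast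
  let ?i = "Suc (j + n)"
  let ?A = "adjoin_pair G (t ?i) (t (Suc ?i))"
  have "(transcendental over (fst ` G)) (t ?i)"
    using transcendental_mono[OF G(4)] t_transcendental_gen[of ?i "{j<..j + n}"] by simp
  moreover have "(transcendental over (snd ` G)) (t (Suc ?i))"
    using transcendental_mono[OF G(5)] t_transcendental_gen[of "Suc ?i" "{Suc j<..Suc (j + n)}"] by simp
  ultimately have A: "partial_iso ?A" by (intro adjoin_pair_transcendental G(1) t(1))
  have GA: "G \<subseteq> ?A" using adjoin_pair_incl[OF G(1) t(1) t(1)] by auto
  have sub: "fst ` ?A \<subseteq> gen {j<..j + Suc n}" "snd ` ?A \<subseteq> gen {Suc j<..Suc (j + Suc n)}"
  proof -
    have "fst ` G \<subseteq> gen {j<..j + Suc n}" by (rule order_trans[OF G(4) gen_mono]) auto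
    moreover have "snd ` G \<subseteq> gen {Suc j<..Suc (j + Suc n)}" by (rule order_trans[OF G(5) gen_mono]) auto
    moreover have "t ?i \<in> gen {j<..j + Suc n}" "t (Suc ?i) \<in> gen {Suc j<..Suc (j + Suc n)}" by (auto intro: gen_mem)
    ultimately have "fst ` ?A \<subseteq> gen {j<..j + Suc n} \<and> snd ` ?A \<subseteq> gen {Suc j<..Suc (j + Suc n)}"
      by (intro subfield_pair_subset[OF G(1)] gen_subfield)
    then show "fst ` ?A \<subseteq> gen {j<..j + Suc n}" "snd ` ?A \<subseteq> gen {Suc j<..Suc (j + Suc n)}" by blast+
  qed
  have "(t l, t (Suc l)) \<in> ?A" if "j < l \<and> l \<le> j + Suc n" for l
  proof (cases "l = ?i")
    case True
    then show ?thesis using adjoin_pair_mem[OF G(1) t(1) t(1)] by simp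
  next
    case False
    then show ?thesis using G(3) GA that by auto
  qed
  then show ?case using A GA G(2) sub by (intro exI[of _ ?A]) auto
qed

lemma alg_cl_gen_closed: "alg_cl (alg_cl (gen A)) \<subseteq> alg_cl (gen A)"
  using alg_cl_least[OF gen_subfield, of "alg_cl (gen A)" A] by simp

text \<open>The element \<open>a\<close> is algebraic over \<open>t\<^sub>j\<^sub>+\<^sub>1, \<dots>, t\<^sub>s\<close> with \<open>s\<close> minimal.  By exchange, both
  \<open>a, t\<^sub>j\<^sub>+\<^sub>1, \<dots>, t\<^sub>s\<^sub>-\<^sub>1\<close> and \<open>t\<^sub>j\<^sub>+\<^sub>1, \<dots>, t\<^sub>s\<close> are transcendence bases of the same algebraically closed
  field, and the shift between them extends to an automorphism.\<close>

lemma shift_automorphism_exists: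
  assumes a: "a \<in> alg_cl (gen {j<..j + n})" and min: "n > 0 \<Longrightarrow> a \<notin> alg_cl (gen {j<..j + (n - 1)})"
  shows "\<exists>\<tau>. \<tau> \<in> ring_iso (L\<lparr>carrier := alg_cl (gen {j<..j + n})\<rparr>) (L\<lparr>carrier := alg_cl (gen {j<..j + n})\<rparr>) \<and>
    (\<forall>x\<in>carrier k. \<tau> (h x) = h (\<sigma> x)) \<and> (n > 0 \<longrightarrow> \<tau> a = t (Suc j)) \<and>
    (\<forall>l. j < l \<and> l < j + n \<longrightarrow> \<tau> (t l) = t (Suc l))"
proof -
  let ?F = "alg_cl (gen {j<..j + n})"
  have F: "subfield ?F L" by (rule alg_cl_subfield[OF gen_subfield])
  have ac: "a \<in> carrier L" using a by (simp add: alg_cl_def)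
  have genF: "gen {j<..j + n} \<subseteq> ?F" by (rule alg_cl_incl[OF gen_subfield])
  have "\<exists>G. partial_iso G \<and> base_graph \<subseteq> G \<and> G \<subseteq> ?F \<times> ?F \<and> (n > 0 \<longrightarrow> (a, t (Suc j)) \<in> G) \<and>
      (\<forall>l. j < l \<and> l < j + n \<longrightarrow> (t l, t (Suc l)) \<in> G)"
  proof (cases n)
    case 0
    have "base_graph \<subseteq> k0 \<times> k0" using base_graph_fst base_graph_snd by force
    then have "base_graph \<subseteq> ?F \<times> ?F" using gen_incl(1) genF by blast
    then show ?thesis using base_graph_partial_iso 0 by (intro exI[of _ base_graph]) auto
  next
    \<comment> \<open>Only the first \<open>n'\<close> of the \<open>n\<close> generic elements are
      shifted, since the last one would leave \<open>?F\<close>. In its place \<open>a\<close> joins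
      the domain and \<open>t (Suc j)\<close> the range; by \<open>min\<close>, \<open>a\<close> is
      transcendental over the domain.\<close>
    case (Suc n')
    obtain G where G: "partial_iso G" "base_graph \<subseteq> G" "\<forall>l. j < l \<and> l \<le> j + n' \<longrightarrow> (t l, t (Suc l)) \<in> G"
      "fst ` G \<subseteq> gen {j<..j + n'}" "snd ` G \<subseteq> gen {Suc j<..Suc (j + n')}"
      using shift_graph_exists[of j n'] by blast
    let ?A = "adjoin_pair G a (t (Suc j))"
    have "(transcendental over (gen {j<..j + n'})) a"
      using min ac Suc by (simp add: alg_cl_def over_def)
    then have "(transcendental over (fst ` G)) a" by (rule transcendental_mono[OF G(4)])
    moreover have "(transcendental over (snd ` G)) (t (Suc j))"
      using transcendental_mono[OF G(5)] t_transcendental_gen[of "Suc j" "{Suc j<..Suc (j + n')}"] by simp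
    ultimately have A: "partial_iso ?A" by (intro adjoin_pair_transcendental G(1) t(1) ac)
    have GA: "G \<subseteq> ?A" using adjoin_pair_incl[OF G(1) ac t(1)] by auto
    have "fst ` G \<subseteq> ?F" by (rule order_trans[OF order_trans[OF G(4) gen_mono] genF]) (use Suc in auto)
    moreover have "snd ` G \<subseteq> ?F" by (rule order_trans[OF order_trans[OF G(5) gen_mono] genF]) (use Suc in auto)
    moreover have "t (Suc j) \<in> ?F" by (rule subsetD[OF genF gen_mem]) (use Suc in simp)
    ultimately have "fst ` ?A \<subseteq> ?F \<and> snd ` ?A \<subseteq> ?F"
      using a by (intro subfield_pair_subset[OF G(1)] F)
    moreover have "?A \<subseteq> fst ` ?A \<times> snd ` ?A" by force
    ultimately have "?A \<subseteq> ?F \<times> ?F" by blast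
    moreover have "\<forall>l. j < l \<and> l < j + n \<longrightarrow> (t l, t (Suc l)) \<in> ?A" using G(3) GA Suc by auto
    ultimately show ?thesis using A GA G(2) adjoin_pair_mem[OF G(1) ac t(1)]
      by (intro exI[of _ ?A]) blast
  qed
  then obtain G where G: "partial_iso G" "base_graph \<subseteq> G" "G \<subseteq> ?F \<times> ?F" "n > 0 \<Longrightarrow> (a, t (Suc j)) \<in> G"
    "\<And>l. j < l \<Longrightarrow> l < j + n \<Longrightarrow> (t l, t (Suc l)) \<in> G" by blast
  let ?K1 = "fracs (fst ` G)" and ?K2 = "fracs (snd ` G)"
  have Gc: "partial_iso (G\<inverse>)" by (rule partial_iso_converse[OF G(1)])
  have K1: "subfield ?K1 L" "fst ` G \<subseteq> ?K1" using fracs_subfield[OF partial_iso_fst_subring[OF G(1)]] by auto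
  have K2: "subfield ?K2 L" "snd ` G \<subseteq> ?K2"
    using fracs_subfield[OF partial_iso_fst_subring[OF Gc]] unfolding snd_image_converse by auto
  have k01: "k0 \<subseteq> fst ` G" using G(2) base_graph_fst by blast
  have k02: "k0 \<subseteq> snd ` G" using G(2) base_graph_snd by blast
  \<comment> \<open>The range contains all \<open>n\<close> generic elements. For the domain,
    \<open>t (j + n)\<close> has to be recovered by exchange: \<open>a\<close> is algebraic over
    \<open>?E\<close> together with \<open>t (j + n)\<close>, but not over \<open>?E\<close>
    alone.\<close>
  have "t ` {j<..j + n} \<subseteq> snd ` G"
  proof (rule image_subsetI)
    fix l assume l: "l \<in> {j<..j + n}"
    show "t l \<in> snd ` G"
    proof (cases "l = Suc j")
      case True
      then show ?thesis using G(4) l by (force intro: image_eqI)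
    next
      case False
      then have "(t (l - 1), t (Suc (l - 1))) \<in> G" using l by (intro G(5)) auto
      then show ?thesis using l by (force intro: image_eqI)
    qed
  qed
  then have "gen {j<..j + n} \<subseteq> ?K2" using K2 k02 by (intro gen_least) auto
  then have alg2: "?F \<subseteq> alg_cl ?K2" by (rule alg_cl_mono)
  have "t ` {j<..j + n} \<subseteq> alg_cl ?K1"
  proof (cases n)
    case 0
    then show ?thesis by simp
  next
    case (Suc n')
    let ?E = "alg_cl (gen {j<..j + n'})"
    have E: "subfield ?E L" by (rule alg_cl_subfield[OF gen_subfield])
    have tE: "t ` {j<..j + n'} \<subseteq> fst ` G"
    proof (rule image_subsetI)
      fix l assume "l \<in> {j<..j + n'}"
      then show "t l \<in> fst ` G" using G(5)[of l] Suc by (force intro: image_eqI)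
    qed
    then have "gen {j<..j + n'} \<subseteq> ?K1" using K1 k01 by (intro gen_least) auto
    then have EK: "?E \<subseteq> alg_cl ?K1" by (rule alg_cl_mono)
    have aK: "a \<in> alg_cl ?K1" using G(4) Suc K1(2) alg_cl_incl[OF K1(1)] by (force intro: image_eqI)
    have "a \<notin> alg_cl ?E" using min Suc alg_cl_gen_closed[of "{j<..j + n'}"] by auto
    then have tr: "(transcendental over ?E) a" using ac by (simp add: alg_cl_def over_def)
    have "k0 \<subseteq> ?E" "t ` {j<..j + n'} \<subseteq> ?E" using gen_incl alg_cl_incl[OF gen_subfield] by blast+
    moreover have "{j<..j + n} = insert (j + n) {j<..j + n'}" using Suc by auto
    ultimately have "k0 \<union> t ` {j<..j + n} \<subseteq> insert (t (j + n)) ?E" by auto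
    then have "gen {j<..j + n} \<subseteq> generate_field L (insert (t (j + n)) ?E)"
    proof -
      assume sub: "k0 \<union> t ` {j<..j + n} \<subseteq> insert (t (j + n)) ?E"
      have "insert (t (j + n)) ?E \<subseteq> carrier L" using t(1) subfieldE(3)[OF E] by auto
      then show ?thesis unfolding gen_def[of "{j<..j + n}"] by (intro mono_generate_field sub)
    qed
    then have "(algebraic over (generate_field L (insert (t (j + n)) ?E))) a"
      using a algebraic_mono by (auto simp: alg_cl_def)
    then have ex: "(algebraic over (generate_field L (insert a ?E))) (t (j + n))"
      by (rule algebraic_exchange[OF E ac tr t(1)])
    have "generate_field L (insert a ?E) \<subseteq> alg_cl ?K1"
      using EK aK ac subfieldE(3)[OF E] by (intro generate_field_min_subfield1 alg_cl_subfield[OF K1(1)]) auto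
    then have "t (j + n) \<in> alg_cl ?K1" using alg_cl_idem[OF K1(1) t(1) algebraic_mono[OF _ ex]] by simp
    moreover have "t ` {j<..j + n'} \<subseteq> alg_cl ?K1" using tE K1 alg_cl_incl[OF K1(1)] by blast
    ultimately show ?thesis using \<open>{j<..j + n} = insert (j + n) {j<..j + n'}\<close> by auto
  qed
  moreover have "k0 \<subseteq> alg_cl ?K1" using k01 K1 alg_cl_incl[OF K1(1)] by blast
  ultimately have "gen {j<..j + n} \<subseteq> alg_cl ?K1" by (intro gen_least alg_cl_subfield[OF K1(1)])
  then have alg1: "?F \<subseteq> alg_cl ?K1" by (rule alg_cl_least[OF K1(1)])
  obtain M where M: "partial_iso M" "G \<subseteq> M" "fst ` M = ?F" "snd ` M = ?F"
    using partial_iso_extends[OF closed F alg_cl_gen_closed G(1,3) alg1 alg2] by blast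
  obtain \<tau> where \<tau>: "\<tau> \<in> ring_iso (L\<lparr>carrier := ?F\<rparr>) (L\<lparr>carrier := ?F\<rparr>)" "\<forall>(x, y)\<in>M. \<tau> x = y"
    using partial_iso_automorphism[OF field_axioms F M(1,3,4)] by blast
  have "\<tau> x = y" if "(x, y) \<in> G" for x y
  proof -
    have "(x, y) \<in> M" using that M(2) by blast
    then show ?thesis using \<tau>(2) by auto
  qed
  moreover have "(h x, h (\<sigma> x)) \<in> G" if "x \<in> carrier k" for x using that G(2) by (auto simp: base_graph_def)
  ultimately show ?thesis using \<tau>(1) G(4,5) by (intro exI[of _ \<tau>]) simp
qed

end

end

section \<open>A root of a difference polynomial in an extension\<close>

context generic_extension
begin

text \<open>Generic elements inserted for the later arguments leave one equation for the argument
  with the smallest index \<open>j\<close>, and its root \<open>a\<close> is to become the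
  \<open>j\<close>-th iterate. Iterates before the \<open>j\<close>-th are unconstrained, since
  \<open>f\<close> does not involve them.\<close>

lemma difference_root_exists:
  fixes \<sigma> :: "'b \<Rightarrow> 'b"
  assumes \<sigma>: "\<sigma> \<in> ring_iso k k" and f: "f \<in> mpoly_carrier k UNIV" "f M0 \<noteq> \<zero>\<^bsub>k\<^esub>" "M0 \<noteq> {#}"
  shows "\<exists>F \<tau> x. subfield F L \<and> \<tau> \<in> ring_iso (L\<lparr>carrier := F\<rparr>) (L\<lparr>carrier := F\<rparr>) \<and> h ` carrier k \<subseteq> F \<and>
    (\<forall>a\<in>carrier k. \<tau> (h a) = h (\<sigma> a)) \<and> x \<in> F \<and> mpoly_eval L (\<lambda>i. (\<tau> ^^ i) x) (h \<circ> f) = \<zero>"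
proof -
  define V where "V = \<Union>(set_mset ` {M. f M \<noteq> \<zero>\<^bsub>k\<^esub>})"
  have V: "finite V" "V \<noteq> {}" using f by (auto simp: V_def k.mpoly_carrier_iff)
  define j where "j = Min V"
  define m where "m = Max V"
  have jV: "j \<in> V" using V by (simp add: j_def)
  have sub: "set_mset M \<subseteq> {j..m}" if "f M \<noteq> \<zero>\<^bsub>k\<^esub>" for M
  proof
    fix i assume "i \<in># M"
    then have "i \<in> V" using that by (auto simp: V_def)
    then show "i \<in> {j..m}" using V by (simp add: j_def m_def)
  qed
  then have fI: "f \<in> mpoly_carrier k {j..m}" using f(1) by (auto simp: k.mpoly_carrier_iff)
  have fL: "h \<circ> f \<in> mpoly_carrier L {j..m}" by (rule mpoly_hom[OF fI])
  obtain D where D: "\<And>M. f M \<noteq> \<zero>\<^bsub>k\<^esub> \<Longrightarrow> count M j \<le> D" using k.mpoly_degree_bound[OF fI] by blast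
  obtain M where M: "f M \<noteq> \<zero>\<^bsub>k\<^esub>" "j \<in># M" using jV by (auto simp: V_def)
  define c where "c d = mpoly_eval L t (h \<circ> poly_slice k j d f)" for d
  have slice: "poly_slice k j d f \<in> mpoly_carrier k {j<..m}" for d
  proof -
    have "{j..m} - {j} = {j<..m}" by auto
    then show ?thesis using k.poly_slice_carrier[OF fI, of j d] by simp
  qed
  have cg: "c d \<in> gen {j<..m}" for d unfolding c_def by (rule eval_gen[OF slice])
  have cc: "c d \<in> carrier L" for d using cg subfieldE(3)[OF gen_subfield] by blast
  let ?d = "count M j"
  have d: "0 < ?d" "?d < Suc D" using M D[OF M(1)] by (auto simp: count_greater_zero_iff)
  have cd: "c ?d \<noteq> \<zero>"
    unfolding c_def using slice_nonzero[of f M j, OF M(1)] eval_t_nonzero[OF _ slice] by blast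
  obtain a where a: "a \<in> carrier L" "(\<Oplus>i\<in>{..<Suc D}. c i \<otimes> a [^] i) = \<zero>"
    using coeffs_root_exists[OF closed, of "Suc D" c ?d] cc d cd by blast
  have root: "mpoly_eval L (t(j := a)) (h \<circ> f) = \<zero>"
    using eval_t_slices[OF fI a(1) D] a(2) by (simp add: c_def)
  have "(algebraic over (gen {j<..m})) a"
    using algebraic_coeffsI[OF subfieldE(1)[OF gen_subfield] a(1), of "Suc D" c _ ?d] cg d(2) cd a(2) by blast
  then have am: "a \<in> alg_cl (gen {j<..m})" using a(1) by (simp add: alg_cl_def)
  have jm: "j \<le> m" using V by (simp add: j_def m_def)
  then have "a \<in> alg_cl (gen {j<..j + (m - j)})" using am by simp
  then have ex: "\<exists>n. a \<in> alg_cl (gen {j<..j + n})" by blast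
  \<comment> \<open>The least \<open>n\<close> makes \<open>a\<close> transcendental over the field
    generated by the first \<open>n - 1\<close> generic elements, as the shift requires.\<close>
  define n where "n = (LEAST n. a \<in> alg_cl (gen {j<..j + n}))"
  have an: "a \<in> alg_cl (gen {j<..j + n})" unfolding n_def using ex by (rule LeastI_ex)
  have min: "a \<notin> alg_cl (gen {j<..j + (n - 1)})" if "n > 0"
    using not_less_Least[of "n - 1" "\<lambda>n. a \<in> alg_cl (gen {j<..j + n})"] that by (simp add: n_def)
  let ?F = "alg_cl (gen {j<..j + n})"
  have F: "subfield ?F L" by (rule alg_cl_subfield[OF gen_subfield])
  obtain \<tau> where \<tau>: "\<tau> \<in> ring_iso (L\<lparr>carrier := ?F\<rparr>) (L\<lparr>carrier := ?F\<rparr>)"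
    "\<And>a. a \<in> carrier k \<Longrightarrow> \<tau> (h a) = h (\<sigma> a)" "n > 0 \<Longrightarrow> \<tau> a = t (Suc j)"
    "\<And>l. j < l \<Longrightarrow> l < j + n \<Longrightarrow> \<tau> (t l) = t (Suc l)"
    using shift_automorphism_exists[OF \<sigma> an min] by blast
  have bij: "bij_betw \<tau> ?F ?F" using \<tau>(1) by (simp add: ring_iso_def)
  have bijn: "bij_betw (\<tau> ^^ i) ?F ?F" for i
  proof (induction i)
    case 0
    then show ?case by (simp add: bij_betw_def)
  next
    case (Suc i)
    show ?case unfolding funpow.simps(2) by (rule bij_betw_trans[OF Suc bij])
  qed
  \<comment> \<open>The desired root is a preimage of \<open>a\<close> under the \<open>j\<close>-th
    iterate; this is where \<open>\<tau>\<close> has to be onto.\<close>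
  have "(\<tau> ^^ j) ` ?F = ?F" using bijn[of j] by (simp add: bij_betw_def)
  then have "a \<in> (\<tau> ^^ j) ` ?F" using an by simp
  then obtain x where x: "x \<in> ?F" "(\<tau> ^^ j) x = a" by blast
  define y where "y i = (\<tau> ^^ i) x" for i
  have yF: "y i \<in> ?F" for i unfolding y_def by (rule bij_betwE[OF bijn, rule_format, OF x(1)])
  have yt: "y (Suc (j + l)) = t (Suc (j + l))" if "l < n" for l
    using that
  proof (induction l)
    case 0
    then show ?case using \<tau>(3) x(2) by (simp add: y_def)
  next
    case (Suc l)
    then have "y (Suc (j + Suc l)) = \<tau> (t (Suc (j + l)))" by (simp add: y_def)
    then show ?case using \<tau>(4)[of "Suc (j + l)"] Suc.prems by simp
  qed
  \<comment> \<open>Actual iterates up to index \<open>r\<close>, generic elements after that. For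
    \<open>r = j + n\<close> this agrees on the indices of \<open>f\<close> with the root of the
    ordinary polynomial. Each increase of \<open>r\<close> is one specialization at
    \<open>Suc r\<close>, whose generic element is transcendental over a field containing all other
    arguments.\<close>
  define z where "z r = (\<lambda>i. if i \<le> r then y i else t i)" for r :: nat
  have Fc: "?F \<subseteq> carrier L" by (rule subfieldE(3)[OF F])
  have zc: "z r i \<in> carrier L" for r i using yF Fc t(1) by (auto simp: z_def)
  have "mpoly_eval L (z (j + n + e)) (h \<circ> f) = \<zero>" for e
  proof (induction e)
    case 0
    have "mpoly_eval L (z (j + n)) (h \<circ> f) = mpoly_eval L (t(j := a)) (h \<circ> f)"
    proof (rule mpoly_eval_cong[OF fL])
      fix i assume i: "i \<in> {j..m}"
      consider "i = j" | "j < i" "i \<le> j + n" | "j + n < i" using i by fastforce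
      then show "z (j + n) i = (t(j := a)) i"
      proof cases
        case 1
        then show ?thesis using x(2) by (simp add: z_def y_def)
      next
        case 2
        then obtain l where "i = Suc (j + l)" by (metis less_iff_Suc_add)
        then show ?thesis using yt[of l] 2 by (simp add: z_def)
      qed (simp add: z_def)
    qed (use t(1) a(1) in auto)
    then show ?case unfolding add_0_right using root by (rule trans)
  next
    case (Suc e)
    let ?r = "j + n + e"
    let ?S = "alg_cl (N (Suc ?r))"
    have S: "subfield ?S L" by (rule alg_cl_subfield[OF N(1)])
    have NS: "N (Suc ?r) \<subseteq> ?S" by (rule alg_cl_incl[OF N(1)])
    have FS: "?F \<subseteq> ?S" by (rule alg_cl_mono[OF gen_N]) simp
    have 1: "z ?r = (z ?r)(Suc ?r := t (Suc ?r))" by (auto simp: z_def)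
    have 2: "z (j + n + Suc e) = (z ?r)(Suc ?r := y (Suc ?r))" by (auto simp: z_def fun_eq_iff le_Suc_eq)
    have "mpoly_eval L ((z ?r)(Suc ?r := y (Suc ?r))) (h \<circ> f) = \<zero>"
    proof (rule mpoly_specialize[OF S t(1) t_transcendental_alg_cl fL])
      show "(h \<circ> f) M \<in> ?S" for M
        using f(1) N(2)[of "Suc ?r"] NS by (auto simp: k.mpoly_carrier_iff)
      show "z ?r \<in> {j..m} - {Suc ?r} \<rightarrow> ?S"
      proof
        fix i assume "i \<in> {j..m} - {Suc ?r}"
        then have "t i \<in> ?S" using subsetD[OF NS N(3)[of i "Suc ?r"]] by simp
        moreover have "y i \<in> ?S" using subsetD[OF FS yF] .
        ultimately show "z ?r i \<in> ?S" by (simp add: z_def)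
      qed
      show "mpoly_eval L ((z ?r)(Suc ?r := t (Suc ?r))) (h \<circ> f) = \<zero>"
        using Suc.IH unfolding 1[symmetric] .
      show "y (Suc ?r) \<in> carrier L" using yF Fc by blast
    qed
    then show ?case unfolding 2 .
  qed
  \<comment> \<open>Since \<open>j + n + m\<close> is at least \<open>m\<close>, no generic element
    is left among the arguments of \<open>f\<close>.\<close>
  from this[of m] have "mpoly_eval L (z (j + n + m)) (h \<circ> f) = \<zero>" .
  moreover have "mpoly_eval L y (h \<circ> f) = mpoly_eval L (z (j + n + m)) (h \<circ> f)"
    by (rule mpoly_eval_cong[OF fL]) (use zc in \<open>auto simp: z_def\<close>)
  ultimately have "mpoly_eval L y (h \<circ> f) = \<zero>" by (simp only:)
  moreover have "y = (\<lambda>i. (\<tau> ^^ i) x)" by (simp add: y_def fun_eq_iff)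
  moreover have "h ` carrier k \<subseteq> ?F"
    using gen_incl(1) alg_cl_incl[OF gen_subfield] unfolding k0_def by blast
  ultimately show ?thesis using F \<tau>(1,2) x(1)
    by (intro exI[of _ ?F] exI[of _ \<tau>] exI[of _ x] conjI ballI) (simp_all only:)
qed

end

section \<open>Reduction of the size of an extension\<close>

text \<open>The closure of the image of \<open>k\<close> and \<open>x\<close> under the field
  operations, \<open>\<tau>\<close> and its inverse is reached in countably many stages, none of
  them larger than the type of lists.\<close>

lemma small_difference_subfield:
  fixes k :: "('b, 'm) ring_scheme" and F :: "('c, 'n) ring_scheme"
  assumes F: "field F" and \<tau>: "\<tau> \<in> ring_iso F F" and inf: "infinite (UNIV :: 'b set)"
    and h: "h ` carrier k \<subseteq> carrier F" and x: "x \<in> carrier F"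
  shows "\<exists>S. subfield S F \<and> \<tau> ` S = S \<and> h ` carrier k \<subseteq> S \<and> x \<in> S \<and> (\<exists>e :: 'c \<Rightarrow> 'b list. inj_on e S)"
proof -
  interpret field F by fact
  let ?B = "UNIV :: 'b list set"
  have infB: "\<not> finite ?B" by (rule infinite_UNIV_listI)
  \<comment> \<open>All operations are put into one map with a selector, so that a stage is a single
    image. Selectors 4 and 5 apply \<open>\<tau>\<close> and its inverse, so that
    \<open>\<tau>\<close> maps \<open>S\<close> onto itself; from 7 on the first argument is
    returned, which makes the stages increasing.\<close>
  define op where "op = (\<lambda>(n :: nat, a, b). if n = 0 then a \<oplus>\<^bsub>F\<^esub> b else if n = 1 then a \<otimes>\<^bsub>F\<^esub> b else if n = 2 then \<ominus>\<^bsub>F\<^esub> a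
     else if n = 3 then (if a = \<zero>\<^bsub>F\<^esub> then \<zero>\<^bsub>F\<^esub> else inv\<^bsub>F\<^esub> a) else if n = 4 then \<tau> a
     else if n = 5 then inv_into (carrier F) \<tau> a else if n = 6 then \<one>\<^bsub>F\<^esub> else a)"
  \<comment> \<open>The empty list stands for \<open>x\<close> and \<open>[a]\<close> for
    \<open>h a\<close>, so the starting set is an image of a set of lists.\<close>
  define S0 where "S0 = (\<lambda>l. case l of [] \<Rightarrow> x | a # _ \<Rightarrow> h a) ` insert [] ((\<lambda>a. [a]) ` carrier k)"
  define stage where "stage n = ((\<lambda>U. op ` (UNIV \<times> U \<times> U)) ^^ n) S0" for n
  define S where "S = (\<Union>n. stage n)"
  have bij: "bij_betw \<tau> (carrier F) (carrier F)" and \<tau>c: "\<And>a. a \<in> carrier F \<Longrightarrow> \<tau> a \<in> carrier F"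
    using \<tau> by (auto simp: ring_iso_def ring_hom_def)
  have icl: "inv_into (carrier F) \<tau> a \<in> carrier F" "\<tau> (inv_into (carrier F) \<tau> a) = a" if "a \<in> carrier F" for a
    using bij that by (auto simp: bij_betw_def inv_into_into f_inv_into_f)
  have S0c: "S0 \<subseteq> carrier F" using h x by (auto simp: S0_def)
  have stage_Suc: "stage (Suc n) = op ` (UNIV \<times> stage n \<times> stage n)" for n by (simp add: stage_def)
  have op_closed: "op (n, a, b) \<in> carrier F" if "a \<in> carrier F" "b \<in> carrier F" for n a b
    using that \<tau>c[OF that(1)] icl(1)[OF that(1)] by (simp add: op_def)
  have stc: "stage n \<subseteq> carrier F" for n
  proof (induction n)
    case 0
    then show ?case using S0c by (simp add: stage_def)
  next
    case (Suc n)
    then show ?case unfolding stage_Suc by (intro image_subsetI) (auto intro!: op_closed)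
  qed
  have opc: "op (n, a, b) \<in> stage (Suc i)" if "a \<in> stage i" "b \<in> stage i" for n a b i
    unfolding stage_Suc using that by blast
  have up: "stage i \<subseteq> stage (i + d)" for i d
  proof (induction d)
    case (Suc d)
    have "stage (i + d) \<subseteq> stage (Suc (i + d))"
    proof
      fix a assume a: "a \<in> stage (i + d)"
      have "op (7, a, a) = a" by (simp add: op_def)
      then show "a \<in> stage (Suc (i + d))" using opc[OF a a, of 7] by simp
    qed
    then show ?case using Suc by simp
  qed simp
  have opS: "op (n, a, b) \<in> S" if "a \<in> S" "b \<in> S" for n a b
  proof -
    obtain i l where "a \<in> stage i" "b \<in> stage l" using \<open>a \<in> S\<close> \<open>b \<in> S\<close> by (auto simp: S_def)
    then have "a \<in> stage (i + l)" "b \<in> stage (i + l)" using up[of i l] up[of l i] by (auto simp: add.commute)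
    then have "op (n, a, b) \<in> stage (Suc (i + l))" by (rule opc)
    then show ?thesis unfolding S_def by (rule UN_I[OF UNIV_I])
  qed
  have Sc: "S \<subseteq> carrier F" using stc by (auto simp: S_def)
  have "S0 \<subseteq> S" unfolding S_def stage_def by (rule order_trans[OF _ UN_upper[of 0]]) auto
  moreover have "x \<in> S0" "h ` carrier k \<subseteq> S0" by (force simp: S0_def)+
  ultimately have xS: "x \<in> S" "h ` carrier k \<subseteq> S" by auto
  have "subfield S F"
  proof (rule subfieldI'[OF subringI])
    show "S \<subseteq> carrier F" by (rule Sc)
    show "\<one>\<^bsub>F\<^esub> \<in> S" using opS[OF xS(1) xS(1), of 6] by (simp add: op_def)
    fix a b assume ab: "a \<in> S" "b \<in> S"
    show "\<ominus>\<^bsub>F\<^esub> a \<in> S" "a \<otimes>\<^bsub>F\<^esub> b \<in> S" "a \<oplus>\<^bsub>F\<^esub> b \<in> S"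
      using opS[OF ab, of 2] opS[OF ab, of 1] opS[OF ab, of 0] by (simp_all add: op_def)
  next
    fix a assume "a \<in> S - {\<zero>\<^bsub>F\<^esub>}"
    then show "inv\<^bsub>F\<^esub> a \<in> S" using opS[of a a 3] by (simp add: op_def)
  qed
  moreover have "\<tau> ` S = S"
  proof
    show "\<tau> ` S \<subseteq> S"
    proof (rule image_subsetI)
      fix a assume "a \<in> S"
      then show "\<tau> a \<in> S" using opS[of a a 4] by (simp add: op_def)
    qed
    show "S \<subseteq> \<tau> ` S"
    proof
      fix a assume a: "a \<in> S"
      have "inv_into (carrier F) \<tau> a \<in> S" using opS[OF a a, of 5] by (simp add: op_def)
      moreover have "\<tau> (inv_into (carrier F) \<tau> a) = a" using icl(2) Sc a by blast
      ultimately show "a \<in> \<tau> ` S" by (metis image_eqI)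
    qed
  qed
  moreover have "\<exists>e :: 'c \<Rightarrow> 'b list. inj_on e S"
  proof -
    have nat: "(card_of (UNIV :: nat set), card_of ?B) \<in> ordLeq" using infB infinite_iff_card_of_nat by blast
    have "(card_of (stage n), card_of ?B) \<in> ordLeq" for n
    proof (induction n)
      case 0
      have "(card_of S0, card_of (insert [] ((\<lambda>a. [a]) ` carrier k))) \<in> ordLeq"
        unfolding S0_def by (rule card_of_image)
      moreover have "(card_of (insert [] ((\<lambda>a. [a]) ` carrier k)), card_of ?B) \<in> ordLeq"
        by (rule card_of_mono1) simp
      ultimately show ?case unfolding stage_def by (simp add: ordLeq_transitive[of "card_of S0"])
    next
      case (Suc n)
      have "(card_of (stage n \<times> stage n), card_of ?B) \<in> ordLeq"
        by (rule card_of_Sigma_ordLeq_infinite[OF infB Suc]) (simp add: Suc)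
      then have "(card_of ((UNIV :: nat set) \<times> stage n \<times> stage n), card_of ?B) \<in> ordLeq"
        by (intro card_of_Sigma_ordLeq_infinite[OF infB nat]) simp
      then show ?case unfolding stage_Suc by (rule ordLeq_transitive[OF card_of_image])
    qed
    then have "(card_of S, card_of ?B) \<in> ordLeq"
      unfolding S_def by (intro card_of_UNION_ordLeq_infinite[OF infB nat]) simp
    then show ?thesis using card_of_ordLeq[of S ?B] by blast
  qed
  ultimately show ?thesis using xS by blast
qed

lemma ring_iso_restrict:
  assumes "\<tau> \<in> ring_iso F F" "S \<subseteq> carrier F" "\<tau> ` S = S" "field F"
  shows "\<tau> \<in> ring_iso (F\<lparr>carrier := S\<rparr>) (F\<lparr>carrier := S\<rparr>)"
proof -
  have "\<tau> \<in> ring_hom F F" "inj_on \<tau> (carrier F)" using assms(1) by (auto simp: ring_iso_def bij_betw_def)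
  moreover have "inj_on \<tau> S" using \<open>inj_on \<tau> (carrier F)\<close> assms(2) by (rule inj_on_subset)
  ultimately show ?thesis
    using assms(2,3) by (auto simp: ring_iso_def ring_hom_def bij_betw_def subset_iff)
qed

text \<open>The small difference subfield is copied along an injection \<open>e\<close> into lists,
  and its automorphism is conjugated by \<open>e\<close>.\<close>

lemma difference_extension_list_type:
  fixes k :: "('b, 'm) ring_scheme" and F :: "('c, 'n) ring_scheme"
  assumes k: "difference_field k s" and F: "field F" and \<tau>: "\<tau> \<in> ring_iso F F" and inf: "infinite (UNIV :: 'b set)"
    and h: "h \<in> ring_hom k F" "\<And>a. a \<in> carrier k \<Longrightarrow> \<tau> (h a) = h (s a)" and x: "x \<in> carrier F"
    and f: "f \<in> mpoly_carrier k UNIV" "mpoly_eval F (\<lambda>i. (\<tau> ^^ i) x) (h \<circ> f) = \<zero>\<^bsub>F\<^esub>"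
  shows "\<exists>(L :: 'b list ring) t g y. difference_field_extension k s L t g \<and> y \<in> carrier L \<and>
    mpoly_eval L (\<lambda>i. (t ^^ i) y) (g \<circ> f) = \<zero>\<^bsub>L\<^esub>"
proof -
  interpret k: difference_field k s by fact
  interpret F: field F by fact
  have "h ` carrier k \<subseteq> carrier F" using ring_hom_closed[OF h(1)] by auto
  then obtain S and e :: "'c \<Rightarrow> 'b list" where S: "subfield S F" "\<tau> ` S = S" "h ` carrier k \<subseteq> S" "x \<in> S" "inj_on e S"
    using small_difference_subfield[OF F \<tau> inf _ x] by blast
  let ?S = "F\<lparr>carrier := S\<rparr>"
  interpret S: field ?S by (rule F.subfield_iff(2)[OF S(1)])
  have Sc: "S \<subseteq> carrier F" by (rule subfieldE(3)[OF S(1)])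
  define L where "L = image_ring e ?S"
  have injS: "inj_on e (carrier ?S)" using S(5) by simp
  interpret L: field L unfolding L_def by (rule S.inj_imp_image_ring_is_field[OF injS])
  have e: "e \<in> ring_iso ?S L" unfolding L_def by (rule inj_imp_image_ring_iso[OF injS])
  have ei: "inv_into S e \<in> ring_iso L ?S" using ring_iso_set_sym[OF S.ring_axioms e] by simp
  have \<tau>S: "\<tau> \<in> ring_iso ?S ?S" by (rule ring_iso_restrict[OF \<tau> Sc S(2) F])
  define t where "t = e \<circ> (\<tau> \<circ> inv_into S e)"
  have t: "t \<in> ring_iso L L" unfolding t_def by (intro ring_iso_set_trans[OF _ e] ring_iso_set_trans[OF ei \<tau>S])
  have te: "t (e a) = e (\<tau> a)" if "a \<in> S" for a using S(5) that by (simp add: t_def)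
  have eh: "e \<in> ring_hom ?S L" using e by (simp add: ring_iso_def)
  have hS: "h \<in> ring_hom k ?S"
    using h(1) S(3) by (auto simp: ring_hom_def image_subset_iff)
  have ext: "difference_field_extension k s L t (e \<circ> h)"
    unfolding difference_field_extension_def
  proof (intro conjI ballI)
    show "difference_field k s" by fact
    show "difference_field L t" by (intro difference_field.intro L.field_axioms difference_field_axioms.intro t)
    show "e \<circ> h \<in> ring_hom k L" using hS eh by (rule ring_hom_trans)
    fix a assume a: "a \<in> carrier k"
    then have "h a \<in> S" using S(3) by auto
    then show "(e \<circ> h) (s a) = t ((e \<circ> h) a)" using te h(2)[OF a] by simp
  qed
  have \<tau>n: "(\<tau> ^^ i) x \<in> S" for i by (induction i) (use S(2,4) in auto)
  have tn: "(t ^^ i) (e x) = e ((\<tau> ^^ i) x)" for i by (induction i) (use te \<tau>n in auto)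
  have hf: "h \<circ> f \<in> mpoly_carrier ?S UNIV"
    by (rule mpoly_carrier_hom[OF k.ring_axioms S.ring_axioms hS f(1)])
  have "id \<in> ring_hom ?S F" using Sc by (auto simp: ring_hom_def)
  then have "mpoly_eval F (id \<circ> (\<lambda>i. (\<tau> ^^ i) x)) (id \<circ> (h \<circ> f)) = id (mpoly_eval ?S (\<lambda>i. (\<tau> ^^ i) x) (h \<circ> f))"
    using \<tau>n by (intro mpoly_eval_hom[OF S.is_cring F.is_cring _ hf]) auto
  then have "mpoly_eval ?S (\<lambda>i. (\<tau> ^^ i) x) (h \<circ> f) = \<zero>\<^bsub>?S\<^esub>" using f(2) by simp
  moreover have "mpoly_eval L (e \<circ> (\<lambda>i. (\<tau> ^^ i) x)) (e \<circ> (h \<circ> f)) = e (mpoly_eval ?S (\<lambda>i. (\<tau> ^^ i) x) (h \<circ> f))"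
    using \<tau>n by (intro mpoly_eval_hom[OF S.is_cring L.is_cring eh hf]) auto
  moreover have "e \<zero>\<^bsub>?S\<^esub> = \<zero>\<^bsub>L\<^esub>" by (rule ring_hom_zero[OF eh S.ring_axioms L.ring_axioms])
  ultimately have "mpoly_eval L (\<lambda>i. (t ^^ i) (e x)) ((e \<circ> h) \<circ> f) = \<zero>\<^bsub>L\<^esub>"
    by (simp add: tn o_def)
  moreover have "e x \<in> carrier L" using ring_hom_closed[OF eh] S(4) by simp
  ultimately show ?thesis using ext by blast
qed

text \<open>Systems have indeterminates \<open>(j, i)\<close> in which \<open>j\<close> numbers the
  unknown; with a single unknown, \<open>j\<close> is always 0.\<close>

definition pair_poly :: "('a, 'm) ring_scheme \<Rightarrow> (nat multiset \<Rightarrow> 'a) \<Rightarrow> (nat \<times> nat) multiset \<Rightarrow> 'a" where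
  "pair_poly R f = (\<lambda>M. if \<forall>p\<in>#M. fst p = 0 then f (image_mset snd M) else \<zero>\<^bsub>R\<^esub>)"

lemma image_Pair_snd:
  assumes "\<forall>p\<in>#M. fst p = (0::nat)"
  shows "image_mset (Pair 0) (image_mset snd M) = M"
proof -
  have "image_mset (Pair 0 \<circ> snd) M = image_mset id M"
    using assms by (intro image_mset_cong) (auto simp: prod_eq_iff)
  then show ?thesis by (simp add: multiset.map_comp)
qed

lemma pair_poly_image: "pair_poly R f (image_mset (Pair 0) M) = f M"
  by (simp add: pair_poly_def multiset.map_comp o_def)

lemma pair_poly_supp:
  "{M. pair_poly R f M \<noteq> \<zero>\<^bsub>R\<^esub>} = image_mset (Pair 0) ` {M. f M \<noteq> \<zero>\<^bsub>R\<^esub>}"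
proof safe
  fix M assume "pair_poly R f M \<noteq> \<zero>\<^bsub>R\<^esub>"
  then have "\<forall>p\<in>#M. fst p = 0" "f (image_mset snd M) \<noteq> \<zero>\<^bsub>R\<^esub>" by (auto simp: pair_poly_def split: if_splits)
  then show "M \<in> image_mset (Pair 0) ` {M. f M \<noteq> \<zero>\<^bsub>R\<^esub>}" 
    by (intro image_eqI[of _ _ "image_mset snd M"]) (simp_all add: image_Pair_snd)
qed (simp add: pair_poly_image)

lemma (in cring) pair_poly_carrier:
  assumes "f \<in> mpoly_carrier R UNIV"
  shows "pair_poly R f \<in> mpoly_carrier R ({..<1} \<times> UNIV)"
  unfolding mpoly_carrier_iff
proof (intro conjI allI impI)
  note f = assms[unfolded mpoly_carrier_iff]
  show "finite {M. pair_poly R f M \<noteq> \<zero>}" unfolding pair_poly_supp using f by simp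
  show "pair_poly R f M \<in> carrier R" for M using f by (simp add: pair_poly_def)
  show "set_mset M \<subseteq> {..<1} \<times> UNIV" if "pair_poly R f M \<noteq> \<zero>" for M
    using that by (auto simp: pair_poly_def split: if_splits)
qed

lemma (in cring) mono_val_pair:
  assumes "\<And>i. x (0, i) \<in> carrier R"
  shows "mono_val R x (image_mset (Pair 0) M) = mono_val R (\<lambda>i. x (0, i)) M"
proof (induction M)
  case (add i M)
  then show ?case using assms by (simp add: mono_val_add_mset Pi_iff)
qed simp

lemma (in cring) mpoly_eval_pair_poly:
  assumes f: "f \<in> mpoly_carrier R UNIV" and x: "\<And>i. x (0, i) \<in> carrier R"
  shows "mpoly_eval R x (pair_poly R f) = mpoly_eval R (\<lambda>i. x (0, i)) f"
proof -
  have inj: "inj (Pair (0::nat) :: nat \<Rightarrow> _)" by (auto intro: injI)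
  have inj': "inj_on (image_mset (Pair (0::nat))) {M. f M \<noteq> \<zero>}"
    using multiset.inj_map[OF inj] by (rule inj_on_subset) simp
  have "mpoly_eval R x (pair_poly R f)
      = (\<Oplus>M\<in>{M. f M \<noteq> \<zero>}. pair_poly R f (image_mset (Pair 0) M) \<otimes> mono_val R x (image_mset (Pair 0) M))"
    unfolding mpoly_eval_mono_val pair_poly_supp
    using f x by (subst add.finprod_reindex[OF _ inj']) (auto simp: pair_poly_image mono_val_pair mpoly_carrier_iff)
  then show ?thesis by (simp add: pair_poly_image mono_val_pair[of x, OF x] mpoly_eval_mono_val)
qed

text \<open>The equation becomes a system with one unknown that is solvable in an extension on
  lists, so the ACFA property returns a solution in \<open>k\<close>. The generic elements behind
  that extension come from thin sets and need \<open>k\<close> to be infinite.\<close>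

theorem ACFA_root:
  fixes k :: "('b, 'm) ring_scheme"
  assumes A: "ACFA k s" and inf: "infinite (carrier k)" and f: "f \<in> diff_polys k" "f M0 \<noteq> \<zero>\<^bsub>k\<^esub>" "M0 \<noteq> {#}"
  shows "\<exists>x\<in>carrier k. diff_eval k s f x = \<zero>\<^bsub>k\<^esub>"
proof -
  have df: "difference_field k s" using A by (simp add: ACFA_def)
  interpret k: difference_field k s by fact
  obtain L :: "(((((nat \<Rightarrow> 'b) \<Rightarrow> 'b) set) list \<times> nat) multiset \<Rightarrow> ((nat \<Rightarrow> 'b) \<Rightarrow> 'b) set) ring" and h t N
    where "generic_extension k L h t N" using k.generic_extension_exists[OF inf] by blast
  then interpret G: generic_extension k L h t N .
  obtain F \<tau> x where F: "subfield F L" "\<tau> \<in> ring_iso (L\<lparr>carrier := F\<rparr>) (L\<lparr>carrier := F\<rparr>)" "h ` carrier k \<subseteq> F"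
    "\<And>a. a \<in> carrier k \<Longrightarrow> \<tau> (h a) = h (s a)" "x \<in> F" "mpoly_eval L (\<lambda>i. (\<tau> ^^ i) x) (h \<circ> f) = \<zero>\<^bsub>L\<^esub>"
    using G.difference_root_exists[OF k.automorphism f] by blast
  let ?F = "L\<lparr>carrier := F\<rparr>"
  interpret F: field ?F by (rule G.subfield_iff(2)[OF F(1)])
  have hF: "h \<in> ring_hom k ?F" using G.hom F(3) by (auto simp: ring_hom_def image_subset_iff)
  have \<tau>n: "(\<tau> ^^ i) x \<in> F" for i
  proof (induction i)
    case (Suc i)
    have "\<tau> \<in> ring_hom ?F ?F" using F(2) by (simp add: ring_iso_def)
    from ring_hom_closed[OF this, of "(\<tau> ^^ i) x"] show ?case using Suc by simp
  qed (use F(5) in simp)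
  have hf: "h \<circ> f \<in> mpoly_carrier ?F UNIV"
    by (rule mpoly_carrier_hom[OF k.ring_axioms F.ring_axioms hF f(1)])
  have "id \<in> ring_hom ?F L" using subfieldE(3)[OF F(1)] by (auto simp: ring_hom_def)
  then have "mpoly_eval L (id \<circ> (\<lambda>i. (\<tau> ^^ i) x)) (id \<circ> (h \<circ> f)) = id (mpoly_eval ?F (\<lambda>i. (\<tau> ^^ i) x) (h \<circ> f))"
    using \<tau>n by (intro mpoly_eval_hom[OF F.is_cring G.is_cring _ hf]) auto
  then have ev: "mpoly_eval ?F (\<lambda>i. (\<tau> ^^ i) x) (h \<circ> f) = \<zero>\<^bsub>?F\<^esub>" using F(6) by simp
  have infU: "infinite (UNIV :: 'b set)" using inf rev_finite_subset by auto
  obtain L' :: "'b list ring" and t' g y where L': "difference_field_extension k s L' t' g" "y \<in> carrier L'"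
    "mpoly_eval L' (\<lambda>i. (t' ^^ i) y) (g \<circ> f) = \<zero>\<^bsub>L'\<^esub>"
    using difference_extension_list_type[OF df F.field_axioms F(2) infU hF F(4) _ f(1) ev] F(5) by auto
  have dL: "difference_field L' t'" and g: "g \<in> ring_hom k L'"
    using L'(1) by (auto simp: difference_field_extension_def)
  interpret L': difference_field L' t' by (rule dL)
  have t'n: "(t' ^^ i) y \<in> carrier L'" for i
  proof (induction i)
    case (Suc i)
    have "t' \<in> ring_hom L' L'" using L'.automorphism by (simp add: ring_iso_def)
    from ring_hom_closed[OF this Suc] show ?case by simp
  qed (use L'(2) in simp)
  let ?P = "pair_poly k f"
  have gf: "g \<circ> f \<in> mpoly_carrier L' UNIV" by (rule mpoly_carrier_hom[OF k.ring_axioms L'.ring_axioms g f(1)])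
  have gP: "g \<circ> ?P = pair_poly L' (g \<circ> f)"
    using ring_hom_zero[OF g k.ring_axioms L'.ring_axioms] by (auto simp: pair_poly_def fun_eq_iff)
  have "mpoly_eval L' (\<lambda>(j, i). (t' ^^ i) y) (g \<circ> ?P) = \<zero>\<^bsub>L'\<^esub>"
    unfolding gP using L'.mpoly_eval_pair_poly[OF gf, of "\<lambda>(j, i). (t' ^^ i) y"] t'n L'(3) by simp
  then have "solves_system L' t' 1 ((\<lambda>P. g \<circ> P) ` {?P}) (\<lambda>_. y)"
    using L'(2) by (auto simp: solves_system_def)
  moreover have "finite {?P} \<and> {?P} \<subseteq> mpoly_carrier k ({..<1} \<times> UNIV)"
    using k.pair_poly_carrier[OF f(1)] by simp
  ultimately obtain z where z: "solves_system k s 1 {?P} z"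
    using A L'(1) unfolding ACFA_def by blast
  have zc: "z 0 \<in> carrier k" using z by (auto simp: solves_system_def)
  have sn: "(s ^^ i) (z 0) \<in> carrier k" for i
  proof (induction i)
    case (Suc i)
    have "s \<in> ring_hom k k" using k.automorphism by (simp add: ring_iso_def)
    from ring_hom_closed[OF this Suc] show ?case by simp
  qed (use zc in simp)
  have "mpoly_eval k (\<lambda>(j, i). (s ^^ i) (z j)) ?P = \<zero>\<^bsub>k\<^esub>" using z by (simp add: solves_system_def)
  then have "diff_eval k s f (z 0) = \<zero>\<^bsub>k\<^esub>"
    using k.mpoly_eval_pair_poly[OF f(1), of "\<lambda>(j, i). (s ^^ i) (z j)"] sn by (simp add: diff_eval_def)
  then show ?thesis using zc by blast
qed

section \<open>Taylor expansion\<close>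

definition multi_binom :: "nat multiset \<Rightarrow> nat multiset \<Rightarrow> nat" where
  "multi_binom M J = (\<Prod>i\<in>set_mset M \<union> set_mset J. count M i choose count J i)"

lemma multi_binom_superset:
  assumes "finite A" "set_mset M \<union> set_mset J \<subseteq> A"
  shows "multi_binom M J = (\<Prod>i\<in>A. count M i choose count J i)"
  unfolding multi_binom_def
  by (rule prod.mono_neutral_left) (use assms in \<open>auto simp: not_in_iff\<close>)

lemma multi_fact_superset:
  assumes "finite A" "set_mset M \<subseteq> A"
  shows "multi_fact M = (\<Prod>i\<in>A. fact (count M i))"
  unfolding multi_fact_def
  by (rule prod.mono_neutral_left) (use assms in \<open>auto simp: not_in_iff\<close>)

lemma multi_fact_pos: "multi_fact M > 0"
  by (simp add: multi_fact_def prod_pos)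

lemma multi_fact_add_mset: "multi_fact (add_mset i M) = Suc (count M i) * multi_fact M"
proof -
  let ?A = "insert i (set_mset M)"
  have "multi_fact (add_mset i M) = fact (count (add_mset i M) i) * (\<Prod>l\<in>?A - {i}. fact (count (add_mset i M) l))"
    by (subst multi_fact_superset[of ?A]) (auto simp: prod.remove[of ?A i])
  also have "(\<Prod>l\<in>?A - {i}. fact (count (add_mset i M) l)) = (\<Prod>l\<in>?A - {i}. fact (count M l) :: nat)"
    by (intro prod.cong) auto
  also have "fact (count (add_mset i M) i) * \<dots> = Suc (count M i) * (fact (count M i) * (\<Prod>l\<in>?A - {i}. fact (count M l)))"
    by (simp add: algebra_simps)
  also have "fact (count M i) * (\<Prod>l\<in>?A - {i}. fact (count M l)) = multi_fact M"
    by (subst multi_fact_superset[of ?A]) (auto simp: prod.remove[of ?A i])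
  finally show ?thesis .
qed

lemma multi_binom_zero: "\<not> J \<subseteq># M \<Longrightarrow> multi_binom M J = 0"
proof -
  assume "\<not> J \<subseteq># M"
  then obtain i where i: "count M i < count J i" by (auto simp: subseteq_mset_def not_le)
  then have "i \<in># J" by (metis count_greater_zero_iff gr_zeroI not_less0)
  then show ?thesis unfolding multi_binom_def using i by (intro prod_zero) auto
qed

lemma multi_binom_empty [simp]: "multi_binom M {#} = 1"
  by (simp add: multi_binom_def)

lemma multi_binom_fact:
  assumes "J \<subseteq># M"
  shows "multi_fact J * multi_fact (M - J) * multi_binom M J = multi_fact M"
proof -
  let ?A = "set_mset M"
  have s: "set_mset J \<subseteq> ?A" "set_mset (M - J) \<subseteq> ?A" using set_mset_mono[OF assms] by (auto dest: in_diffD)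
  have "multi_fact J * multi_fact (M - J) * multi_binom M J
      = (\<Prod>i\<in>?A. fact (count J i) * fact (count M i - count J i) * (count M i choose count J i))"
    using s by (simp add: multi_fact_superset[of ?A] multi_binom_superset[of ?A] prod.distrib)
  also have "\<dots> = (\<Prod>i\<in>?A. fact (count M i))"
    using assms by (intro prod.cong) (auto simp: binomial_fact_lemma subseteq_mset_def)
  finally show ?thesis by (simp add: multi_fact_def)
qed

lemma multi_binom_pascal:
  "multi_binom (add_mset i M) J = multi_binom M J + (if i \<in># J then multi_binom M (J - {#i#}) else 0)"
proof -
  let ?A = "insert i (set_mset M \<union> set_mset J)"
  let ?c = "\<Prod>l\<in>?A - {i}. count M l choose count J l"
  have 1: "multi_binom (add_mset i M) J = (Suc (count M i) choose count J i) * ?c"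
    by (subst multi_binom_superset[of ?A]) (auto simp: prod.remove[of ?A i] intro!: prod.cong)
  have 2: "multi_binom M J = (count M i choose count J i) * ?c"
    by (subst multi_binom_superset[of ?A]) (auto simp: prod.remove[of ?A i])
  show ?thesis
  proof (cases "i \<in># J")
    case True
    have "multi_binom M (J - {#i#}) = (count M i choose (count J i - 1)) * ?c"
      by (subst multi_binom_superset[of ?A]) (auto simp: prod.remove[of ?A i] dest: in_diffD intro!: prod.cong)
    moreover obtain d where "count J i = Suc d" using True by (metis count_greater_zero_iff gr0_conv_Suc)
    ultimately show ?thesis using 1 2 True by (simp add: add_mult_distrib)
  next
    case False
    then have "count J i = 0" by (simp add: not_in_iff)
    then show ?thesis using 1 2 False by simp
  qed
qed

lemma submultisets_add_mset:
  "{J. J \<subseteq># add_mset i M} = {J. J \<subseteq># M} \<union> add_mset i ` {J. J \<subseteq># M}"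
proof safe
  fix J assume J: "J \<subseteq># add_mset i M" "J \<notin> add_mset i ` {J. J \<subseteq># M}"
  have "i \<notin># J"
  proof
    assume "i \<in># J"
    then obtain J' where "J = add_mset i J'" by (metis mset_add)
    then show False using J by auto
  qed
  then show "J \<subseteq># M" using J(1) by (metis count_add_mset le0 not_in_iff subseteq_mset_def)
next
  fix J assume "J \<subseteq># M"
  then show "J \<subseteq># add_mset i M" by (rule subset_mset.order_trans) simp
qed auto

lemma finite_submultisets: "finite {J. J \<subseteq># M}"
proof (induction M)
  case empty
  then show ?case by simp
next
  case (add i M)
  then show ?case by (simp add: submultisets_add_mset)
qed

lemma multi_fact_dvd: "multi_fact M dvd multi_fact (M + L)"
proof (induction L)
  case (add i L)
  then show ?case by (simp add: multi_fact_add_mset)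
qed simp

section \<open>Iterated partial derivatives\<close>

context ring
begin

text \<open>Differentiating the monomial \<open>M + J\<close> along \<open>J\<close> produces a
  product of falling factorials, which is \<open>(M + J)! / M!\<close>. The closed form no longer
  depends on the order of differentiation.\<close>

lemma multi_deriv_eq:
  assumes "\<And>M. P M \<in> carrier R"
  shows "multi_deriv R J P = (\<lambda>M. add_pow R (multi_fact (M + J) div multi_fact M) (P (M + J)))"
proof -
  have "foldr (partial_deriv R) l P = (\<lambda>M. add_pow R (multi_fact (M + mset l) div multi_fact M) (P (M + mset l)))" for l
  proof (induction l)
    case Nil
    have "multi_fact M div multi_fact M = 1" for M using multi_fact_pos[of M] by simp
    then show ?case using assms by simp
  next
    case (Cons i l)
    show ?case
    proof
      fix M
      let ?a = "multi_fact (add_mset i M + mset l)" and ?b = "multi_fact (add_mset i M)"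
      have b: "?b = Suc (count M i) * multi_fact M" by (rule multi_fact_add_mset)
      have "?b dvd ?a" by (rule multi_fact_dvd)
      then have "?a div multi_fact M = (?a div ?b) * Suc (count M i)"
        unfolding b using multi_fact_pos[of M]
        by (metis b dvd_div_mult_self mult.assoc nonzero_mult_div_cancel_right not_gr_zero)
      then have q: "?a div ?b * Suc (count M i) = ?a div multi_fact M" ..
      have e: "add_mset i M + mset l = M + mset (i # l)" by simp
      have "foldr (partial_deriv R) (i # l) P M
          = add_pow R (Suc (count M i)) (add_pow R (?a div ?b) (P (add_mset i M + mset l)))"
        by (simp only: foldr.simps o_apply partial_deriv_def Cons)
      also have "\<dots> = add_pow R (?a div ?b * Suc (count M i)) (P (add_mset i M + mset l))"
        using assms by (rule add.nat_pow_pow)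
      finally show "foldr (partial_deriv R) (i # l) P M
          = add_pow R (multi_fact (M + mset (i # l)) div multi_fact M) (P (M + mset (i # l)))"
        unfolding q unfolding e .
    qed
  qed
  then show ?thesis unfolding multi_deriv_def by simp
qed

lemma multi_deriv_carrier:
  assumes "P \<in> mpoly_carrier R UNIV"
  shows "multi_deriv R J P \<in> mpoly_carrier R UNIV"
proof -
  note P = assms[unfolded mpoly_carrier_iff]
  have "{M. multi_deriv R J P M \<noteq> \<zero>} \<subseteq> (\<lambda>N. N - J) ` {N. P N \<noteq> \<zero>}"
  proof
    fix M assume "M \<in> {M. multi_deriv R J P M \<noteq> \<zero>}"
    then have "P (M + J) \<noteq> \<zero>" using P by (auto simp: multi_deriv_eq)
    then show "M \<in> (\<lambda>N. N - J) ` {N. P N \<noteq> \<zero>}" by (intro image_eqI[of _ _ "M + J"]) auto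
  qed
  then have "finite {M. multi_deriv R J P M \<noteq> \<zero>}" using P finite_subset by blast
  then show ?thesis using P by (simp add: mpoly_carrier_iff multi_deriv_eq)
qed

lemma multi_deriv_multi_deriv:
  assumes "P \<in> mpoly_carrier R UNIV"
  shows "multi_deriv R I (multi_deriv R J P) = multi_deriv R (I + J) P"
proof
  fix M
  have P: "\<And>M. P M \<in> carrier R" "\<And>M. multi_deriv R J P M \<in> carrier R"
    using assms multi_deriv_carrier[OF assms] by (auto simp: mpoly_carrier_iff)
  let ?a = "multi_fact M" and ?b = "multi_fact (M + I)" and ?c = "multi_fact (M + I + J)"
  have "(?c div ?b) * (?b div ?a) = ?c div ?a"
  proof -
    obtain p where "?b = ?a * p" using multi_fact_dvd[of M I] by (rule dvdE)
    moreover obtain q where "?c = ?b * q" using multi_fact_dvd[of "M + I" J] by (rule dvdE)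
    ultimately show ?thesis using multi_fact_pos[of M] multi_fact_pos[of "M + I"] by (simp add: mult.assoc)
  qed
  note q = this
  have "multi_deriv R I (multi_deriv R J P) M = add_pow R (?b div ?a) (multi_deriv R J P (M + I))"
    by (simp only: multi_deriv_eq[OF P(2)])
  also have "multi_deriv R J P (M + I) = add_pow R (?c div ?b) (P (M + I + J))"
    by (simp only: multi_deriv_eq[OF P(1)])
  also have "add_pow R (?b div ?a) \<dots> = add_pow R (?c div ?a) (P (M + I + J))"
    using P(1) by (simp only: add.nat_pow_pow q)
  also have "\<dots> = multi_deriv R (I + J) P M"
    by (simp only: multi_deriv_eq[OF P(1)] add.assoc)
  finally show "multi_deriv R I (multi_deriv R J P) M = multi_deriv R (I + J) P M" .
qed

end

context cring
begin

text \<open>Induction on \<open>M\<close>: a further factor \<open>x i \<oplus> u i\<close> enlarges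
  either the part taken from \<open>x\<close> or the part \<open>J\<close> taken from
  \<open>u\<close>, and Pascal's rule adds the two coefficients.\<close>

lemma mono_val_binomial:
  assumes x: "x \<in> UNIV \<rightarrow> carrier R" and u: "u \<in> UNIV \<rightarrow> carrier R"
  shows "mono_val R (\<lambda>i. x i \<oplus> u i) M = (\<Oplus>J\<in>{J. J \<subseteq># M}. (add_pow R (multi_binom M J) (mono_val R x (M - J))) \<otimes> mono_val R u J)"
proof (induction M)
  case empty
  have "{J. J \<subseteq># {#}} = {{#}}" by auto
  then show ?case by simp
next
  case (add i M)
  have c: "x i \<in> carrier R" "u i \<in> carrier R" for i using x u by auto
  have mx: "mono_val R x M \<in> carrier R" and mu: "mono_val R u M \<in> carrier R" for M
    using x u by (auto intro!: mono_val_closed)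
  let ?T = "{J. J \<subseteq># M}" and ?T' = "{J. J \<subseteq># add_mset i M}"
  define A where "A M J = add_pow R (multi_binom M J) (mono_val R x (M - J))" for M J
  have Ac: "A M J \<in> carrier R" for M J using mx by (simp add: A_def)
  have A0: "A M J = \<zero>" if "\<not> J \<subseteq># M" for M J using multi_binom_zero[OF that] by (simp add: A_def)
  have xadd: "mono_val R x (add_mset i M) = x i \<otimes> mono_val R x M"
      "mono_val R u (add_mset i M) = u i \<otimes> mono_val R u M" for M
    using x u by (auto intro!: mono_val_add_mset)
  have rec: "A (add_mset i M) J = x i \<otimes> A M J \<oplus> (if i \<in># J then A M (J - {#i#}) else \<zero>)" if J: "J \<in> ?T'" for J
  proof -
    have 1: "add_pow R (multi_binom M J) (mono_val R x (add_mset i M - J)) = x i \<otimes> A M J"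
    proof (cases "J \<subseteq># M")
      case True
      then have "add_mset i M - J = add_mset i (M - J)" by (simp add: multiset_eq_iff subseteq_mset_def Suc_diff_le)
      then show ?thesis using c mx by (simp add: xadd A_def add_pow_rdistr)
    next
      case False
      then show ?thesis using A0 multi_binom_zero[OF False] c by simp
    qed
    have 2: "mono_val R x (add_mset i M - J) = mono_val R x (M - (J - {#i#}))" if "i \<in># J"
    proof -
      have "add_mset i M - J = M - (J - {#i#})" using that by (metis add_mset_diff_bothsides insert_DiffM)
      then show ?thesis by simp
    qed
    have "A (add_mset i M) J = add_pow R (multi_binom M J) (mono_val R x (add_mset i M - J))
        \<oplus> add_pow R (if i \<in># J then multi_binom M (J - {#i#}) else 0) (mono_val R x (add_mset i M - J))"
      unfolding A_def multi_binom_pascal using mx by (simp add: add.nat_pow_mult)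
    then show ?thesis using 1 2 by (simp add: A_def split: if_splits)
  qed
  have finT: "finite ?T" "finite ?T'" by (rule finite_submultisets)+
  have TT: "?T \<subseteq> ?T'" unfolding submultisets_add_mset by simp
  have "(\<Oplus>J\<in>?T'. A (add_mset i M) J \<otimes> mono_val R u J)
      = (\<Oplus>J\<in>?T'. x i \<otimes> (A M J \<otimes> mono_val R u J) \<oplus> (if i \<in># J then A M (J - {#i#}) else \<zero>) \<otimes> mono_val R u J)"
    using c Ac mu by (intro add.finprod_cong') (auto simp: rec l_distr m_assoc)
  also have "\<dots> = (\<Oplus>J\<in>?T'. x i \<otimes> (A M J \<otimes> mono_val R u J)) \<oplus> (\<Oplus>J\<in>?T'. (if i \<in># J then A M (J - {#i#}) else \<zero>) \<otimes> mono_val R u J)"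
    using c Ac mu by (intro finsum_addf) auto
  also have "(\<Oplus>J\<in>?T'. x i \<otimes> (A M J \<otimes> mono_val R u J)) = x i \<otimes> (\<Oplus>J\<in>?T. A M J \<otimes> mono_val R u J)"
  proof -
    have "(\<Oplus>J\<in>?T'. x i \<otimes> (A M J \<otimes> mono_val R u J)) = x i \<otimes> (\<Oplus>J\<in>?T'. A M J \<otimes> mono_val R u J)"
      using c Ac mu finT by (intro finsum_rdistr[symmetric]) auto
    also have "(\<Oplus>J\<in>?T'. A M J \<otimes> mono_val R u J) = (\<Oplus>J\<in>?T. A M J \<otimes> mono_val R u J)"
      using Ac mu finT TT A0 by (intro add.finprod_mono_neutral_cong_right) auto
    finally show ?thesis .
  qed
  also have "(\<Oplus>J\<in>?T'. (if i \<in># J then A M (J - {#i#}) else \<zero>) \<otimes> mono_val R u J) = u i \<otimes> (\<Oplus>J\<in>?T. A M J \<otimes> mono_val R u J)"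
  proof -
    have "(\<Oplus>J\<in>?T'. (if i \<in># J then A M (J - {#i#}) else \<zero>) \<otimes> mono_val R u J)
        = (\<Oplus>J\<in>add_mset i ` ?T. A M (J - {#i#}) \<otimes> mono_val R u J)"
    proof (rule add.finprod_mono_neutral_cong_right)
      show "add_mset i ` ?T \<subseteq> ?T'" unfolding submultisets_add_mset by simp
      show "(if i \<in># J then A M (J - {#i#}) else \<zero>) \<otimes> mono_val R u J = \<zero>" if J: "J \<in> ?T' - add_mset i ` ?T" for J
      proof -
        have "i \<notin># J"
        proof
          assume "i \<in># J"
          then obtain J' where J': "J = add_mset i J'" by (metis mset_add)
          then have "J' \<in> ?T" using J by simp
          then show False using J J' by blast
        qed
        then show ?thesis using mu by simp
      qed
    qed (use finT Ac mu in auto)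
    also have "\<dots> = (\<Oplus>J\<in>?T. A M (add_mset i J - {#i#}) \<otimes> mono_val R u (add_mset i J))"
      using Ac mu by (intro add.finprod_reindex) (auto simp: inj_on_def)
    also have "\<dots> = (\<Oplus>J\<in>?T. u i \<otimes> (A M J \<otimes> mono_val R u J))"
      using Ac mu c by (intro add.finprod_cong') (auto simp: xadd m_ac)
    also have "\<dots> = u i \<otimes> (\<Oplus>J\<in>?T. A M J \<otimes> mono_val R u J)"
      using c Ac mu finT by (intro finsum_rdistr[symmetric]) auto
    finally show ?thesis .
  qed
  finally have "(\<Oplus>J\<in>?T'. A (add_mset i M) J \<otimes> mono_val R u J)
      = x i \<otimes> (\<Oplus>J\<in>?T. A M J \<otimes> mono_val R u J) \<oplus> u i \<otimes> (\<Oplus>J\<in>?T. A M J \<otimes> mono_val R u J)" .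
  also have "\<dots> = (x i \<oplus> u i) \<otimes> (\<Oplus>J\<in>?T. A M J \<otimes> mono_val R u J)"
    using c Ac mu by (intro l_distr[symmetric] finsum_closed) auto
  also have "\<dots> = (x i \<oplus> u i) \<otimes> mono_val R (\<lambda>i. x i \<oplus> u i) M" using add by (simp add: A_def)
  also have "\<dots> = mono_val R (\<lambda>i. x i \<oplus> u i) (add_mset i M)"
    using c by (intro mono_val_add_mset[symmetric]) auto
  finally show ?case by (simp add: A_def)
qed

end

text \<open>The binomial formula is applied to each monomial and the sums are exchanged. The inner
  sum is the derivative divided by \<open>J!\<close>, because \<open>M! / (M - J)!\<close> is
  \<open>J!\<close> times the binomial coefficient. \<open>T\<close> may be larger than necessary,
  so that all derivatives of one polynomial can be expanded over a common index set.\<close>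

lemma (in field) mpoly_taylor:
  assumes char0: "char_zero R" and P: "P \<in> mpoly_carrier R UNIV" and x: "x \<in> UNIV \<rightarrow> carrier R" and u: "u \<in> UNIV \<rightarrow> carrier R"
    and T: "finite T" "\<And>M J. P M \<noteq> \<zero> \<Longrightarrow> J \<subseteq># M \<Longrightarrow> J \<in> T"
  shows "mpoly_eval R (\<lambda>i. x i \<oplus> u i) P
    = (\<Oplus>J\<in>T. (inv (add_pow R (multi_fact J) \<one>) \<otimes> mpoly_eval R x (multi_deriv R J P)) \<otimes> mono_val R u J)"
proof -
  note P' = P[unfolded mpoly_carrier_iff]
  let ?S = "{M. P M \<noteq> \<zero>}"
  have c: "x i \<in> carrier R" "u i \<in> carrier R" for i using x u by auto
  have mx: "mono_val R x M \<in> carrier R" and mu: "mono_val R u M \<in> carrier R" for M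
    using x u by (auto intro!: mono_val_closed)
  define A where "A M J = add_pow R (multi_binom M J) (mono_val R x (M - J))" for M J
  have Ac: "A M J \<in> carrier R" for M J using mx by (simp add: A_def)
  have A0: "A M J = \<zero>" if "\<not> J \<subseteq># M" for M J using multi_binom_zero[OF that] by (simp add: A_def)
  have nz: "add_pow R (multi_fact J) \<one> \<noteq> \<zero>" for J using char0 multi_fact_pos[of J] by (simp add: char_zero_def)
  have "mpoly_eval R (\<lambda>i. x i \<oplus> u i) P = (\<Oplus>M\<in>?S. \<Oplus>J\<in>T. (P M \<otimes> A M J) \<otimes> mono_val R u J)"
    unfolding mpoly_eval_mono_val
  proof (rule add.finprod_cong')
    fix M assume M: "M \<in> ?S"
    have "mono_val R (\<lambda>i. x i \<oplus> u i) M = (\<Oplus>J\<in>{J. J \<subseteq># M}. A M J \<otimes> mono_val R u J)"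
      unfolding A_def by (rule mono_val_binomial[OF x u])
    also have "\<dots> = (\<Oplus>J\<in>T. A M J \<otimes> mono_val R u J)"
      using T M A0 Ac mu by (intro add.finprod_mono_neutral_cong_left) auto
    finally have "P M \<otimes> mono_val R (\<lambda>i. x i \<oplus> u i) M = (\<Oplus>J\<in>T. P M \<otimes> (A M J \<otimes> mono_val R u J))"
      using P' Ac mu T(1) by (simp add: finsum_rdistr Pi_iff)
    also have "\<dots> = (\<Oplus>J\<in>T. (P M \<otimes> A M J) \<otimes> mono_val R u J)"
      using P' Ac mu by (intro add.finprod_cong') (auto simp: m_assoc)
    finally show "P M \<otimes> mono_val R (\<lambda>i. x i \<oplus> u i) M = (\<Oplus>J\<in>T. (P M \<otimes> A M J) \<otimes> mono_val R u J)" .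
  qed (use P' Ac mu in \<open>auto intro!: finsum_closed\<close>)
  also have "\<dots> = (\<Oplus>J\<in>T. \<Oplus>M\<in>?S. (P M \<otimes> A M J) \<otimes> mono_val R u J)"
    using P' Ac mu T(1) by (intro finsum_swap) auto
  also have "\<dots> = (\<Oplus>J\<in>T. (inv (add_pow R (multi_fact J) \<one>) \<otimes> mpoly_eval R x (multi_deriv R J P)) \<otimes> mono_val R u J)"
  proof (rule add.finprod_cong')
    have ev: "mpoly_eval R x (multi_deriv R J P) \<in> carrier R" for J
      by (rule mpoly_eval_closed[OF multi_deriv_carrier[OF P] x])
    then show "(\<lambda>J. (inv (add_pow R (multi_fact J) \<one>) \<otimes> mpoly_eval R x (multi_deriv R J P)) \<otimes> mono_val R u J) \<in> T \<rightarrow> carrier R"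
      using mu nz by auto
    fix J
    let ?SJ = "{M \<in> ?S. J \<subseteq># M}"
    have inj: "inj_on (\<lambda>M. M - J) ?SJ"
      by (rule inj_onI) (metis (no_types, lifting) mem_Collect_eq subset_mset.diff_add)
    have "mpoly_eval R x (multi_deriv R J P) = (\<Oplus>M\<in>(\<lambda>M. M - J) ` ?SJ. multi_deriv R J P M \<otimes> mono_val R x M)"
    proof (rule mpoly_evalI)
      show "finite ((\<lambda>M. M - J) ` ?SJ)" using P' by simp
      show "multi_deriv R J P M = \<zero>" if "M \<notin> (\<lambda>M. M - J) ` ?SJ" for M
      proof (rule ccontr)
        assume "multi_deriv R J P M \<noteq> \<zero>"
        then have "P (M + J) \<noteq> \<zero>" using P' by (auto simp: multi_deriv_eq)
        then have "M + J \<in> ?SJ" by simp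
        then have "M + J - J \<in> (\<lambda>M. M - J) ` ?SJ" by (rule imageI)
        then show False using that by simp
      qed
    qed (use P' x in \<open>auto simp: multi_deriv_eq\<close>)
    also have "\<dots> = (\<Oplus>M\<in>?SJ. multi_deriv R J P (M - J) \<otimes> mono_val R x (M - J))"
      using P' mx by (intro add.finprod_reindex inj) (auto simp: multi_deriv_eq)
    also have "\<dots> = (\<Oplus>M\<in>?SJ. (add_pow R (multi_fact J) \<one>) \<otimes> (P M \<otimes> A M J))"
    proof (rule add.finprod_cong')
      fix M assume M: "M \<in> ?SJ"
      then have MJ: "M - J + J = M" by simp
      have "multi_fact M = multi_fact J * multi_binom M J * multi_fact (M - J)"
        using multi_binom_fact[of J M] M by (simp add: mult_ac)
      then have "multi_fact M div multi_fact (M - J) = multi_fact J * multi_binom M J"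
        using multi_fact_pos[of "M - J"] by simp
      then have "multi_deriv R J P (M - J) = add_pow R (multi_fact J * multi_binom M J) (P M)"
        using P' MJ by (simp add: multi_deriv_eq)
      then show "multi_deriv R J P (M - J) \<otimes> mono_val R x (M - J) = (add_pow R (multi_fact J) \<one>) \<otimes> (P M \<otimes> A M J)"
        using P' mx by (simp add: A_def add_pow_ldistr add_pow_rdistr add.nat_pow_pow mult.commute)
    qed (use P' Ac in auto)
    also have "\<dots> = (add_pow R (multi_fact J) \<one>) \<otimes> (\<Oplus>M\<in>?SJ. P M \<otimes> A M J)"
      using P' Ac by (intro finsum_rdistr[symmetric]) auto
    finally have e: "mpoly_eval R x (multi_deriv R J P) = (add_pow R (multi_fact J) \<one>) \<otimes> (\<Oplus>M\<in>?SJ. P M \<otimes> A M J)" .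
    have sc: "(\<Oplus>M\<in>?SJ. P M \<otimes> A M J) \<in> carrier R" using P' Ac by (intro finsum_closed) auto
    have fc: "add_pow R (multi_fact J) \<one> \<in> carrier R" by simp
    have "inv (add_pow R (multi_fact J) \<one>) \<otimes> mpoly_eval R x (multi_deriv R J P)
        = (inv (add_pow R (multi_fact J) \<one>) \<otimes> (add_pow R (multi_fact J) \<one>)) \<otimes> (\<Oplus>M\<in>?SJ. P M \<otimes> A M J)"
      unfolding e using sc fc nz by (intro m_assoc[symmetric]) auto
    also have "\<dots> = (\<Oplus>M\<in>?SJ. P M \<otimes> A M J)" using l_inv_nz[OF fc nz] sc by (simp only: l_one)
    also have "\<dots> = (\<Oplus>M\<in>?S. P M \<otimes> A M J)"
      using P' Ac A0 by (intro add.finprod_mono_neutral_cong_left) auto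
    finally show "(\<Oplus>M\<in>?S. (P M \<otimes> A M J) \<otimes> mono_val R u J)
        = (inv (add_pow R (multi_fact J) \<one>) \<otimes> mpoly_eval R x (multi_deriv R J P)) \<otimes> mono_val R u J"
      using P' Ac mu by (simp add: finsum_ldistr Pi_iff)
  qed simp
  finally show ?thesis .
qed

section \<open>Valuations\<close>

context valued_difference_field
begin

lemma val_real:
  assumes "x \<in> carrier K" "x \<noteq> \<zero>"
  obtains r where "v x = ereal r"
  using val_not_MInf[OF assms(1)] val_eq_PInf_iff[OF assms(1)] assms(2) by (cases "v x") auto

lemma val_zero [simp]: "v \<zero> = \<infinity>"
  using val_eq_PInf_iff by simp

lemma val_uminus: "x \<in> carrier K \<Longrightarrow> v (\<ominus> x) = v x"
proof -
  have m: "v (\<ominus> \<one>) = 0"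
  proof -
    have "v (\<ominus> \<one>) + v (\<ominus> \<one>) = v (\<ominus> \<one> \<otimes> \<ominus> \<one>)" by (rule val_mult[symmetric]) auto
    also have "\<dots> = 0" using val_one by (simp add: l_minus r_minus)
    finally show ?thesis by (cases "v (\<ominus> \<one>)") auto
  qed
  assume x: "x \<in> carrier K"
  then have "v (\<ominus> x) = v (\<ominus> \<one> \<otimes> x)" by (simp add: l_minus)
  also have "\<dots> = v x" using val_mult[of "\<ominus> \<one>" x] x m by simp
  finally show ?thesis .
qed

lemma add_minus_cancel:
  assumes "a \<in> carrier K" "c \<in> carrier K"
  shows "a \<oplus> (c \<ominus> a) = c"
proof -
  have "a \<oplus> (c \<oplus> \<ominus> a) = c \<oplus> (a \<oplus> \<ominus> a)" by (rule a_lcomm) (use assms in auto)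
  then show ?thesis using assms by (simp only: minus_eq r_neg r_zero)
qed

lemma val_add_ge: "x \<in> carrier K \<Longrightarrow> y \<in> carrier K \<Longrightarrow> c \<le> v x \<Longrightarrow> c \<le> v y \<Longrightarrow> c \<le> v (x \<oplus> y)"
  using val_add[of x y] by (meson min.boundedI order_trans)

lemma val_add_gt: "x \<in> carrier K \<Longrightarrow> y \<in> carrier K \<Longrightarrow> c < v x \<Longrightarrow> c < v y \<Longrightarrow> c < v (x \<oplus> y)"
  using val_add[of x y] by (meson min_less_iff_conj order_less_le_trans)

lemma val_add_eq:
  assumes "x \<in> carrier K" "y \<in> carrier K" "v x < v y"
  shows "v (x \<oplus> y) = v x"
proof (rule antisym)
  show "v x \<le> v (x \<oplus> y)" using assms by (intro val_add_ge) auto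
  show "v (x \<oplus> y) \<le> v x"
  proof (rule ccontr)
    assume "\<not> v (x \<oplus> y) \<le> v x"
    then have lt: "v x < v (x \<oplus> y)" by (rule not_le_imp_less)
    have lt': "v x < v (\<ominus> y)" using assms(2,3) by (simp add: val_uminus)
    have "v x < v ((x \<oplus> y) \<oplus> \<ominus> y)"
      by (rule val_add_gt[OF _ _ lt lt']) (simp_all add: assms(1,2))
    moreover have "(x \<oplus> y) \<oplus> \<ominus> y = x" using assms by (simp add: a_assoc r_neg)
    ultimately show False by simp
  qed
qed

lemma val_finsum_ge:
  assumes "\<And>i. i \<in> A \<Longrightarrow> f i \<in> carrier K" "\<And>i. i \<in> A \<Longrightarrow> c \<le> v (f i)"
  shows "c \<le> v (finsum K f A)"
proof (cases "finite A")
  case True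
  then show ?thesis using assms
  proof (induction A rule: finite_induct)
    case (insert a A)
    have "f \<in> A \<rightarrow> carrier K" "f a \<in> carrier K" using insert.prems by auto
    then show ?case using insert by (simp add: val_add_ge finsum_closed)
  qed simp
qed (simp add: finsum_infinite)

lemma val_finsum_gt:
  assumes "c \<noteq> \<infinity>" "\<And>i. i \<in> A \<Longrightarrow> f i \<in> carrier K" "\<And>i. i \<in> A \<Longrightarrow> c < v (f i)"
  shows "c < v (finsum K f A)"
proof (cases "finite A")
  case True
  then show ?thesis using assms(2,3)
  proof (induction A rule: finite_induct)
    case empty
    then show ?case using assms(1) by simp
  next
    case (insert a A)
    have "f \<in> A \<rightarrow> carrier K" "f a \<in> carrier K" using insert.prems by auto
    then show ?case using insert by (simp add: val_add_gt finsum_closed)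
  qed
qed (use assms(1) in \<open>simp add: finsum_infinite\<close>)

lemma val_inv:
  assumes "x \<in> carrier K" "v x = ereal r"
  shows "v (inv x) = ereal (- r)"
proof -
  have x: "x \<noteq> \<zero>" using assms(2) by auto
  have "v x + v (inv x) = 0" using val_mult[of x "inv x"] x assms(1) val_one by simp
  then show ?thesis using assms(2) by (cases "v (inv x)") auto
qed

lemma \<sigma>_hom: "\<sigma> \<in> ring_hom K K"
  using automorphism by (simp add: ring_iso_def)

lemma \<sigma>_funpow_hom: "(\<sigma> ^^ i) \<in> ring_hom K K"
proof (induction i)
  case 0
  then show ?case by (simp add: ring_hom_def)
next
  case (Suc i)
  then show ?case unfolding funpow.simps(2) using \<sigma>_hom by (rule ring_hom_trans)
qed

lemma \<sigma>_funpow_closed [simp]: "x \<in> carrier K \<Longrightarrow> (\<sigma> ^^ i) x \<in> carrier K"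
  by (rule ring_hom_closed[OF \<sigma>_funpow_hom])

lemma \<sigma>_funpow_nonzero: "x \<in> carrier K \<Longrightarrow> x \<noteq> \<zero> \<Longrightarrow> (\<sigma> ^^ i) x \<noteq> \<zero>"
  using inj_onD[OF field_hom_inj[OF field_axioms field_axioms \<sigma>_funpow_hom], of i x \<zero>]
    ring_hom_zero[OF \<sigma>_funpow_hom ring_axioms ring_axioms] by auto

lemma \<sigma>_funpow_O: "x \<in> valuation_set K v \<Longrightarrow> (\<sigma> ^^ i) x \<in> valuation_set K v"
  by (induction i) (use val_ring_invariant in auto)

section \<open>The valuation ring and its reduction\<close>

abbreviation O_ring :: "('a, 'b) ring_scheme" where
  "O_ring \<equiv> K\<lparr>carrier := valuation_set K v\<rparr>"

lemma valuation_set_subring: "subring (valuation_set K v) K"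
  by (rule subringI) (auto simp: valuation_set_def val_one val_uminus val_mult val_add_ge)

lemma O_ring_cring: "cring O_ring"
  using subring_is_domain[OF valuation_set_subring] by (rule domain.axioms(1))

lemma valuation_ideal_ideal: "ideal (valuation_ideal K v) O_ring"
proof (rule idealI)
  interpret O: cring O_ring by (rule O_ring_cring)
  show "ring O_ring" by (rule O.ring_axioms)
  have neg: "\<ominus>\<^bsub>O_ring\<^esub> x = \<ominus> x" if "x \<in> valuation_set K v" for x
  proof (rule O.add.inv_equality)
    show "\<ominus> x \<oplus>\<^bsub>O_ring\<^esub> x = \<zero>\<^bsub>O_ring\<^esub>" using that by (simp add: valuation_set_def l_neg)
  qed (use that in \<open>auto simp: valuation_set_def val_uminus\<close>)
  show "subgroup (valuation_ideal K v) (add_monoid O_ring)"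
  proof (rule O.add.subgroupI)
    show "valuation_ideal K v \<subseteq> carrier O_ring" by (auto simp: valuation_ideal_def valuation_set_def)
    have "\<zero> \<in> valuation_ideal K v" by (simp add: valuation_ideal_def)
    then show "valuation_ideal K v \<noteq> {}" by blast
    fix x assume x: "x \<in> valuation_ideal K v"
    then have "x \<in> valuation_set K v" by (auto simp: valuation_ideal_def valuation_set_def)
    then show "\<ominus>\<^bsub>O_ring\<^esub> x \<in> valuation_ideal K v" using x by (auto simp: neg valuation_ideal_def val_uminus)
    fix y assume "y \<in> valuation_ideal K v"
    then show "x \<oplus>\<^bsub>O_ring\<^esub> y \<in> valuation_ideal K v"
      using x by (auto simp: valuation_ideal_def val_add_gt)
  qed
  fix a x assume a: "a \<in> valuation_ideal K v" "x \<in> carrier O_ring"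
  then have c: "a \<in> carrier K" "x \<in> carrier K" "0 < v a" "0 \<le> v x" by (auto simp: valuation_ideal_def valuation_set_def)
  have "0 < v x + v a" using c(3,4) by (cases "v x"; cases "v a") auto
  then show "x \<otimes>\<^bsub>O_ring\<^esub> a \<in> valuation_ideal K v" "a \<otimes>\<^bsub>O_ring\<^esub> x \<in> valuation_ideal K v"
    using c val_mult by (auto simp: valuation_ideal_def add.commute)
qed

definition resid :: "'a \<Rightarrow> 'a set" where
  "resid x = valuation_ideal K v +>\<^bsub>O_ring\<^esub> x"

lemma resid_hom: "resid \<in> ring_hom O_ring (residue_field K v)"
  unfolding resid_def[abs_def] residue_field_def by (rule ideal.rcos_ring_hom[OF valuation_ideal_ideal])

lemma resid_surj: "y \<in> carrier (residue_field K v) \<Longrightarrow> \<exists>x\<in>valuation_set K v. y = resid x"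
  unfolding residue_field_def resid_def FactRing_def A_RCOSETS_def' by auto

lemma residue_field_cring: "cring (residue_field K v)"
  unfolding residue_field_def by (rule ideal.quotient_is_cring[OF valuation_ideal_ideal O_ring_cring])

lemma resid_zero_iff:
  assumes "x \<in> valuation_set K v"
  shows "resid x = \<zero>\<^bsub>residue_field K v\<^esub> \<longleftrightarrow> 0 < v x"
proof -
  interpret I: ideal "valuation_ideal K v" O_ring by (rule valuation_ideal_ideal)
  have "resid x = \<zero>\<^bsub>residue_field K v\<^esub> \<longleftrightarrow> x \<in> valuation_ideal K v"
    using I.rcos_const_imp_mem[of x] I.a_rcos_const[of x] assms
    by (auto simp: resid_def residue_field_def FactRing_def)
  then show ?thesis using assms by (auto simp: valuation_ideal_def valuation_set_def)
qed

lemma resid_\<sigma>: "x \<in> valuation_set K v \<Longrightarrow> (residue_map \<sigma> ^^ i) (resid x) = resid ((\<sigma> ^^ i) x)"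
proof (induction i)
  case (Suc i)
  then show ?case using residue_map_coset[OF \<sigma>_funpow_O[OF Suc.prems, of i]] by (simp add: resid_def)
qed simp

text \<open>In residue characteristic zero a positive integer has nonzero reduction and is a unit of
  the valuation ring. Hence the factorials in Taylor coefficients do not change valuations.\<close>

lemma val_nat:
  fixes n :: nat
  assumes "char_zero (residue_field K v)" "n > 0"
  shows "v (add_pow K n \<one>) = 0"
proof -
  interpret O: cring O_ring by (rule O_ring_cring)
  interpret k: cring "residue_field K v" by (rule residue_field_cring)
  interpret r: ring_hom_cring O_ring "residue_field K v" resid
    by (intro ring_hom_cring.intro ring_hom_cring_axioms.intro O.cring_axioms k.cring_axioms resid_hom)
  have 1: "add_pow K m \<one> \<in> valuation_set K v \<and> resid (add_pow K m \<one>) = add_pow (residue_field K v) m \<one>\<^bsub>residue_field K v\<^esub>"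
    for m :: nat
  proof (induction m)
    case 0
    have "\<zero> \<in> valuation_set K v" by (simp add: valuation_set_def)
    then show ?case using r.hom_zero by simp
  next
    case (Suc m)
    have one: "\<one> \<in> valuation_set K v" by (simp add: valuation_set_def val_one)
    have eq: "add_pow K (Suc m) \<one> = add_pow K m \<one> \<oplus> \<one>" by simp
    have "add_pow K m \<one> \<oplus> \<one> \<in> valuation_set K v"
      using Suc one subringE(7)[OF valuation_set_subring] by blast
    moreover have "resid (add_pow K m \<one> \<oplus> \<one>) = resid (add_pow K m \<one>) \<oplus>\<^bsub>residue_field K v\<^esub> resid \<one>"
      using r.hom_add[of "add_pow K m \<one>" \<one>] Suc one by simp
    moreover have "resid \<one> = \<one>\<^bsub>residue_field K v\<^esub>" using r.hom_one by simp
    ultimately show ?case unfolding eq using Suc by simp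
  qed
  have O: "add_pow K n \<one> \<in> valuation_set K v" by (rule conjunct1[OF 1[of n]])
  have "add_pow (residue_field K v) n \<one>\<^bsub>residue_field K v\<^esub> \<noteq> \<zero>\<^bsub>residue_field K v\<^esub>"
    using assms(1)[unfolded char_zero_def, THEN spec, THEN mp, OF assms(2)] .
  then have "resid (add_pow K n \<one>) \<noteq> \<zero>\<^bsub>residue_field K v\<^esub>" by (simp only: conjunct2[OF 1[of n]] not_False_eq_True)
  then have "\<not> 0 < v (add_pow K n \<one>)" by (simp only: resid_zero_iff[OF O] not_False_eq_True)
  moreover have "0 \<le> v (add_pow K n \<one>)" using O by (simp add: valuation_set_def)
  ultimately show ?thesis by (simp add: antisym)
qed

end

section \<open>Weights of multi-indices\<close>

lemma multi_weight_add_mset: "multi_weight \<rho> (add_mset i J) = \<rho> ^ i + multi_weight \<rho> J"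
proof -
  let ?A = "insert i (set_mset J)"
  have J: "multi_weight \<rho> J = (\<Sum>l\<in>?A. \<rho> ^ l * real (count J l))"
    unfolding multi_weight_def by (rule sum.mono_neutral_left) (auto simp: not_in_iff)
  have "multi_weight \<rho> (add_mset i J) = (\<Sum>l\<in>?A. \<rho> ^ l * real (count J l) + (if l = i then \<rho> ^ l else 0))"
    unfolding multi_weight_def set_mset_add_mset_insert
    by (rule sum.cong[OF refl]) (simp add: distrib_left)
  also have "\<dots> = multi_weight \<rho> J + \<rho> ^ i" by (simp add: sum.distrib J)
  finally show ?thesis by simp
qed

lemma multi_weight_empty [simp]: "multi_weight \<rho> {#} = 0"
  by (simp add: multi_weight_def)

lemma multi_weight_union: "multi_weight \<rho> (I + J) = multi_weight \<rho> I + multi_weight \<rho> J"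
  by (induction I) (simp_all add: multi_weight_add_mset)

lemma multi_weight_pos:
  assumes "\<rho> > 0" "J \<noteq> {#}"
  shows "multi_weight \<rho> J > 0"
proof -
  have "multi_weight \<rho> J \<ge> 0" for J
    by (induction J) (use assms(1) in \<open>auto simp: multi_weight_add_mset\<close>)
  moreover obtain i J' where "J = add_mset i J'" using assms(2) by (metis multiset_cases)
  ultimately show ?thesis using assms(1) by (metis multi_weight_add_mset add_pos_nonneg zero_less_power)
qed

text \<open>A weight is the value at \<open>\<rho>\<close> of a polynomial with integer
  coefficients, so division by weights stays inside a module over Q(rho).\<close>

lemma inverse_multi_weight_rat_adjoin:
  assumes "\<rho> > 0" "J \<noteq> {#}"
  shows "1 / multi_weight \<rho> J \<in> rat_adjoin \<rho>"
proof -
  define q :: "real poly" where "q = (\<Sum>i\<in>set_mset J. Polynomial.monom (real (count J i)) i)"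
  have "poly q \<rho> = multi_weight \<rho> J"
    by (simp add: q_def poly_sum poly_monom multi_weight_def mult.commute)
  moreover have "Polynomial.coeff q i \<in> \<rat>" for i by (auto simp: q_def Polynomial.coeff_sum intro!: Rats_sum)
  moreover have "Polynomial.coeff (1 :: real poly) i \<in> \<rat>" for i by (cases i) auto
  moreover have "poly (1 :: real poly) \<rho> = 1" by simp
  ultimately show ?thesis using multi_weight_pos[OF assms] unfolding rat_adjoin_def
    by (intro CollectI exI[of _ "1 :: real poly"] exI[of _ q]) auto
qed

context multiplicative_valued_difference_field
begin

lemma val_\<sigma>_funpow:
  assumes "u \<in> carrier K" "v u = ereal \<gamma>"
  shows "v ((\<sigma> ^^ i) u) = ereal (\<rho> ^ i * \<gamma>)"
proof (induction i)
  case (Suc i)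
  have "u \<noteq> \<zero>" using assms(2) by auto
  then have "(\<sigma> ^^ i) u \<in> carrier K - {\<zero>}" using assms(1) \<sigma>_funpow_nonzero by auto
  then show ?case using scaling Suc by simp
qed (use assms in simp)

text \<open>Each application of the automorphism scales values by \<open>\<rho>\<close>, so a factor
  with index \<open>i\<close> counts \<open>\<rho> ^ i\<close> times; this is the origin of the
  weight.\<close>

lemma val_mono_val:
  assumes u: "u \<in> carrier K" "v u = ereal \<gamma>"
  shows "v (mono_val K (\<lambda>i. (\<sigma> ^^ i) u) J) = ereal (multi_weight \<rho> J * \<gamma>)"
proof (induction J)
  case empty
  then show ?case by (simp add: val_one zero_ereal_def)
next
  case (add i J)
  have c: "(\<lambda>i. (\<sigma> ^^ i) u) \<in> set_mset J \<rightarrow> carrier K" for J using u by auto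
  have "v (mono_val K (\<lambda>i. (\<sigma> ^^ i) u) (add_mset i J)) = v ((\<sigma> ^^ i) u) + v (mono_val K (\<lambda>i. (\<sigma> ^^ i) u) J)"
    using c u by (subst mono_val_add_mset) (auto intro!: val_mult)
  then show ?case using add val_\<sigma>_funpow[OF u] by (simp add: multi_weight_add_mset algebra_simps)
qed

lemma mono_val_zero:
  assumes "J \<noteq> {#}"
  shows "mono_val K (\<lambda>i. (\<sigma> ^^ i) \<zero>) J = \<zero>"
proof -
  obtain i J' where J: "J = add_mset i J'" using assms by (metis multiset_cases)
  have z: "(\<sigma> ^^ i) \<zero> = \<zero>" for i by (rule ring_hom_zero[OF \<sigma>_funpow_hom ring_axioms ring_axioms])
  show ?thesis unfolding J by (subst mono_val_add_mset) (auto simp: z)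
qed

end

section \<open>Newton approximation\<close>

locale newton_setup = multiplicative_valued_difference_field +
  fixes f
  assumes char0: "char_zero K" and res_char0: "char_zero (residue_field K v)"
    and f: "f \<in> diff_polys K" and nonconst: "\<exists>M. M \<noteq> {#} \<and> f M \<noteq> \<zero>"
begin

definition dv :: "nat multiset \<Rightarrow> 'a \<Rightarrow> 'a" where
  "dv J a = diff_eval K \<sigma> (multi_deriv K J f) a"

text \<open>Outside this finite set the derivatives of \<open>f\<close> are the zero polynomial, so
  the Taylor sums of all derivatives at all points share one index set.\<close>

definition supp_closure :: "nat multiset set" where
  "supp_closure = (\<Union>M\<in>{M. f M \<noteq> \<zero>}. {J. J \<subseteq># M})"

text \<open>The \<open>I\<close>-th term in the expansion of \<open>dv J (a \<oplus> u)\<close>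
  around \<open>a\<close>; indices of iterated derivatives add up, hence
  \<open>dv (I + J)\<close>.\<close>

definition taylor_term :: "'a \<Rightarrow> 'a \<Rightarrow> nat multiset \<Rightarrow> nat multiset \<Rightarrow> 'a" where
  "taylor_term a u J I = (inv (add_pow K (multi_fact I) \<one>) \<otimes> dv (I + J) a) \<otimes> mono_val K (\<lambda>i. (\<sigma> ^^ i) u) I"

lemma f_iff: "finite {M. f M \<noteq> \<zero>}" "\<And>M. f M \<in> carrier K"
  using f by (auto simp: mpoly_carrier_iff)

lemma supp_closure_finite: "finite supp_closure"
  unfolding supp_closure_def using f_iff(1) finite_submultisets by auto

lemma empty_supp_closure: "{#} \<in> supp_closure"
  using nonconst by (auto simp: supp_closure_def)

lemma dv_closed [simp]: "a \<in> carrier K \<Longrightarrow> dv J a \<in> carrier K"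
  unfolding dv_def diff_eval_def by (rule mpoly_eval_closed[OF multi_deriv_carrier[OF f]]) auto

lemma dv_empty: "dv {#} a = diff_eval K \<sigma> f a"
  by (simp add: dv_def multi_deriv_def)

lemma multi_deriv_nonzero: "multi_deriv K J f M \<noteq> \<zero> \<Longrightarrow> f (M + J) \<noteq> \<zero>"
  by (auto simp: multi_deriv_eq[OF f_iff(2)])

lemma dv_outside: "J \<notin> supp_closure \<Longrightarrow> dv J a = \<zero>"
proof -
  assume J: "J \<notin> supp_closure"
  have "multi_deriv K J f M = \<zero>" for M
  proof (rule ccontr)
    assume "multi_deriv K J f M \<noteq> \<zero>"
    then have "f (M + J) \<noteq> \<zero>" by (rule multi_deriv_nonzero)
    moreover have "J \<subseteq># M + J" by simp
    ultimately show False using J unfolding supp_closure_def by blast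
  qed
  then show ?thesis by (simp add: dv_def diff_eval_def mpoly_eval_def)
qed

lemma multi_fact_val: "v (inv (add_pow K (multi_fact I) \<one>)) = 0"
  and multi_fact_inv [simp]: "inv (add_pow K (multi_fact I) \<one>) \<in> carrier K"
proof -
  have 0: "v (add_pow K (multi_fact I) \<one>) = ereal 0"
    using val_nat[OF res_char0 multi_fact_pos] by (simp add: zero_ereal_def)
  then show "v (inv (add_pow K (multi_fact I) \<one>)) = 0"
    using val_inv[OF _ 0] by (simp add: zero_ereal_def)
  have "add_pow K (multi_fact I) \<one> \<noteq> \<zero>" using 0 by auto
  then show "inv (add_pow K (multi_fact I) \<one>) \<in> carrier K" by simp
qed

lemma taylor_term_closed [simp]: "a \<in> carrier K \<Longrightarrow> u \<in> carrier K \<Longrightarrow> taylor_term a u J I \<in> carrier K"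
  by (simp add: taylor_term_def)

lemma dv_taylor:
  assumes a: "a \<in> carrier K" and u: "u \<in> carrier K"
  shows "dv J (a \<oplus> u) = (\<Oplus>I\<in>supp_closure. taylor_term a u J I)"
proof -
  have s: "(\<sigma> ^^ i) (a \<oplus> u) = (\<sigma> ^^ i) a \<oplus> (\<sigma> ^^ i) u" for i by (rule ring_hom_add[OF \<sigma>_funpow_hom a u])
  have "dv J (a \<oplus> u) = mpoly_eval K (\<lambda>i. (\<sigma> ^^ i) a \<oplus> (\<sigma> ^^ i) u) (multi_deriv K J f)"
    by (simp add: dv_def diff_eval_def s)
  also have "\<dots> = (\<Oplus>I\<in>supp_closure. (inv (add_pow K (multi_fact I) \<one>) \<otimes>
      mpoly_eval K (\<lambda>i. (\<sigma> ^^ i) a) (multi_deriv K I (multi_deriv K J f))) \<otimes> mono_val K (\<lambda>i. (\<sigma> ^^ i) u) I)"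
  proof (rule mpoly_taylor[OF char0 multi_deriv_carrier[OF f]])
    fix M I assume "multi_deriv K J f M \<noteq> \<zero>" and I: "I \<subseteq># M"
    then have "f (M + J) \<noteq> \<zero>" using multi_deriv_nonzero by blast
    moreover have "I \<subseteq># M + J" using I by (rule subset_mset.order_trans) simp
    ultimately show "I \<in> supp_closure" unfolding supp_closure_def by blast
  qed (use a u supp_closure_finite in auto)
  finally show ?thesis
    by (simp add: multi_deriv_multi_deriv[OF f] taylor_term_def dv_def diff_eval_def)
qed

lemma dv_taylor_split:
  assumes a: "a \<in> carrier K" and u: "u \<in> carrier K"
  shows "dv J (a \<oplus> u) = dv J a \<oplus> (\<Oplus>I\<in>supp_closure - {{#}}. taylor_term a u J I)"
proof -
  have "multi_fact {#} = 1" by (simp add: multi_fact_def)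
  moreover have "inv \<one> = \<one>" by simp
  ultimately have "taylor_term a u J {#} = dv J a" using a by (simp add: taylor_term_def)
  moreover have "(\<Oplus>I\<in>insert {#} (supp_closure - {{#}}). taylor_term a u J I) =
      taylor_term a u J {#} \<oplus> (\<Oplus>I\<in>supp_closure - {{#}}. taylor_term a u J I)"
    by (rule finsum_insert) (use a u supp_closure_finite in auto)
  moreover have "insert {#} (supp_closure - {{#}}) = supp_closure" using empty_supp_closure by blast
  ultimately show ?thesis using dv_taylor[OF a u, of J] by (simp only:)
qed

text \<open>The line with slope \<open>-\<epsilon>\<close> through \<open>(0, \<alpha>)\<close> supports the points \<open>(|J|\<^sub>\<rho>, v(f\<^sub>(\<^sub>J\<^sub>)(a)))\<close> of the Newton
  diagram of \<open>f\<close> at \<open>a\<close>; that is, \<open>v(f(a)) = \<alpha>\<close> and the Newton radius at \<open>a\<close> is \<open>\<epsilon>\<close>.  Factorials are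
  units of the valuation ring, so \<open>dv J\<close> can replace \<open>f\<^sub>(\<^sub>J\<^sub>)\<close>.\<close>

definition newt :: "'a \<Rightarrow> real \<Rightarrow> real \<Rightarrow> bool" where
  "newt a \<epsilon> \<alpha> \<longleftrightarrow> v (dv {#} a) = ereal \<alpha> \<and> (\<forall>J. ereal (\<alpha> - multi_weight \<rho> J * \<epsilon>) \<le> v (dv J a)) \<and>
     (\<exists>J. J \<noteq> {#} \<and> v (dv J a) = ereal (\<alpha> - multi_weight \<rho> J * \<epsilon>))"

text \<open>On the supporting line \<open>dv (I + J) a\<close> has at least the value
  \<open>\<alpha>\<close> minus the weight of \<open>I + J\<close> times \<open>\<epsilon>\<close>,
  and the monomial in \<open>u\<close> restores at least the share of \<open>I\<close>. The weight
  of a nonempty \<open>I\<close> is positive, so strictness in either estimate makes the sum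
  strict.\<close>

lemma val_taylor_term:
  assumes n: "newt a \<epsilon> \<alpha>" and a: "a \<in> carrier K" and u: "u \<in> carrier K" "ereal \<epsilon> \<le> v u"
  shows "ereal (\<alpha> - multi_weight \<rho> J * \<epsilon>) \<le> v (taylor_term a u J I)"
    and "\<lbrakk>I \<noteq> {#}; ereal \<epsilon> < v u \<or> ereal (\<alpha> - multi_weight \<rho> (I + J) * \<epsilon>) < v (dv (I + J) a)\<rbrakk>
      \<Longrightarrow> ereal (\<alpha> - multi_weight \<rho> J * \<epsilon>) < v (taylor_term a u J I)"
proof -
  let ?w = "multi_weight \<rho>"
  have vt: "v (taylor_term a u J I) = v (dv (I + J) a) + v (mono_val K (\<lambda>i. (\<sigma> ^^ i) u) I)"
    unfolding taylor_term_def using a u by (simp add: val_mult multi_fact_val)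
  have low: "ereal (\<alpha> - ?w (I + J) * \<epsilon>) \<le> v (dv (I + J) a)" using n by (simp add: newt_def)
  have w: "?w (I + J) = ?w I + ?w J" by (rule multi_weight_union)
  have main: "ereal (\<alpha> - ?w J * \<epsilon>) \<le> v (taylor_term a u J I) \<and>
    (I \<noteq> {#} \<and> (ereal \<epsilon> < v u \<or> ereal (\<alpha> - ?w (I + J) * \<epsilon>) < v (dv (I + J) a))
      \<longrightarrow> ereal (\<alpha> - ?w J * \<epsilon>) < v (taylor_term a u J I))"
  proof (cases "I = {#}")
    case True
    then show ?thesis unfolding vt using low by (simp add: val_one)
  next
    case I: False
    then have wI: "?w I > 0" by (rule multi_weight_pos[OF scaling_pos])
    show ?thesis
    \<comment> \<open>For \<open>u = \<zero>\<close> the value of \<open>u\<close> is not real, so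
      \<open>val_mono_val\<close> does not apply; the term is then zero.\<close>
    proof (cases "u = \<zero>")
      case True
      then have "mono_val K (\<lambda>i. (\<sigma> ^^ i) u) I = \<zero>" using mono_val_zero[OF I] by simp
      moreover have "v (dv (I + J) a) \<noteq> -\<infinity>" using a by (simp add: val_not_MInf)
      ultimately have "v (taylor_term a u J I) = \<infinity>" unfolding vt by simp
      then show ?thesis by simp
    next
      case False
      then obtain \<gamma> where \<gamma>: "v u = ereal \<gamma>" using val_real[OF u(1)] by blast
      then have "\<epsilon> \<le> \<gamma>" using u(2) by simp
      then have le: "?w I * \<epsilon> \<le> ?w I * \<gamma>" using wI by simp
      have lt: "?w I * \<epsilon> < ?w I * \<gamma>" if "\<epsilon> < \<gamma>" using wI that by simp
      have m: "v (mono_val K (\<lambda>i. (\<sigma> ^^ i) u) I) = ereal (?w I * \<gamma>)" by (rule val_mono_val[OF u(1) \<gamma>])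
      show ?thesis
      proof (cases "v (dv (I + J) a)")
        case (real \<delta>)
        have "\<alpha> - (?w I + ?w J) * \<epsilon> \<le> \<delta>" using low real w by simp
        then have 1: "\<alpha> - ?w I * \<epsilon> - ?w J * \<epsilon> \<le> \<delta>" by (simp add: algebra_simps)
        have 2: "\<alpha> - ?w I * \<epsilon> - ?w J * \<epsilon> < \<delta>" if "\<alpha> - ?w (I + J) * \<epsilon> < \<delta>"
          using that w by (simp add: algebra_simps)
        show ?thesis unfolding vt m real using 1 2 le lt \<gamma> by auto
      next
        case PInf
        then show ?thesis unfolding vt m by simp
      next
        case MInf
        then show ?thesis using low by simp
      qed
    qed
  qed
  show "ereal (\<alpha> - ?w J * \<epsilon>) \<le> v (taylor_term a u J I)" using main by blast
  show "\<lbrakk>I \<noteq> {#}; ereal \<epsilon> < v u \<or> ereal (\<alpha> - ?w (I + J) * \<epsilon>) < v (dv (I + J) a)\<rbrakk>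
      \<Longrightarrow> ereal (\<alpha> - ?w J * \<epsilon>) < v (taylor_term a u J I)" using main by blast
qed

lemma newt_ball_val:
  assumes n: "newt a \<epsilon> \<alpha>" and a: "a \<in> carrier K" and c: "c \<in> carrier K" "ereal \<epsilon> \<le> v (c \<ominus> a)"
  shows "ereal (\<alpha> - multi_weight \<rho> J * \<epsilon>) \<le> v (dv J c)"
proof -
  have u: "c \<ominus> a \<in> carrier K" "a \<oplus> (c \<ominus> a) = c" using a c by (simp_all add: add_minus_cancel)
  have "dv J c = (\<Oplus>I\<in>supp_closure. taylor_term a (c \<ominus> a) J I)" using dv_taylor[OF a u(1), of J] u(2) by simp
  then show ?thesis using val_taylor_term(1)[OF n a u(1) c(2)] a u(1) by (simp add: val_finsum_ge)
qed

text \<open>If \<open>J\<close> has maximal size among the indices on the supporting line, then the valuation of \<open>dv J\<close> is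
  constant on the ball.\<close>

lemma newt_ball_mono:
  assumes n: "newt a \<epsilon> \<alpha>" and a: "a \<in> carrier K" and c: "c \<in> carrier K" "ereal \<epsilon> \<le> v (c \<ominus> a)"
    and n': "newt c \<epsilon>' \<alpha>'"
  shows "\<alpha> \<le> \<alpha>'" "\<epsilon> \<le> \<epsilon>'"
proof -
  let ?w = "multi_weight \<rho>"
  have u: "c \<ominus> a \<in> carrier K" "a \<oplus> (c \<ominus> a) = c" using a c by (simp_all add: add_minus_cancel)
  show al: "\<alpha> \<le> \<alpha>'" using newt_ball_val[OF n a c, of "{#}"] n' by (simp add: newt_def)
  let ?P = "\<lambda>J. J \<noteq> {#} \<and> v (dv J a) = ereal (\<alpha> - ?w J * \<epsilon>)"
  have "{J. ?P J} \<subseteq> supp_closure"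
  proof
    fix J assume "J \<in> {J. ?P J}"
    then have "dv J a \<noteq> \<zero>" by auto
    then show "J \<in> supp_closure" using dv_outside by blast
  qed
  then have fin: "finite (size ` {J. ?P J})" using supp_closure_finite finite_subset by blast
  have ne: "size ` {J. ?P J} \<noteq> {}" using n by (auto simp: newt_def)
  obtain J where J: "?P J" "size J = Max (size ` {J. ?P J})" using Max_in[OF fin ne] by auto
  \<comment> \<open>Adding a nonempty \<open>I\<close> increases the size, so \<open>I + J\<close>
    lies strictly above the supporting line.\<close>
  have max: "\<not> ?P (I + J)" if "I \<noteq> {#}" for I
  proof
    assume "?P (I + J)"
    then have "size (I + J) \<in> size ` {J. ?P J}" by blast
    from Max_ge[OF fin this] have "size (I + J) \<le> size J" unfolding J(2) .
    then show False using that by simp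
  qed
  have "ereal (\<alpha> - ?w J * \<epsilon>) < v (\<Oplus>I\<in>supp_closure - {{#}}. taylor_term a (c \<ominus> a) J I)"
  proof (rule val_finsum_gt)
    fix I assume "I \<in> supp_closure - {{#}}"
    then have I: "I \<noteq> {#}" by simp
    have "ereal (\<alpha> - ?w (I + J) * \<epsilon>) \<le> v (dv (I + J) a)" using n by (simp add: newt_def)
    moreover have "ereal (\<alpha> - ?w (I + J) * \<epsilon>) \<noteq> v (dv (I + J) a)" using max[OF I] I by auto
    ultimately have "ereal (\<alpha> - ?w (I + J) * \<epsilon>) < v (dv (I + J) a)" by simp
    then show "ereal (\<alpha> - ?w J * \<epsilon>) < v (taylor_term a (c \<ominus> a) J I)"
      by (intro val_taylor_term(2)[OF n a u(1) c(2) I]) blast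
  qed (use a u in auto)
  then have "v (dv J c) = ereal (\<alpha> - ?w J * \<epsilon>)"
    using dv_taylor_split[OF a u(1), of J] val_add_eq[of "dv J a"] J(1) a u by (simp add: finsum_closed)
  \<comment> \<open>The supporting line at \<open>c\<close> does not start below the one at
    \<open>a\<close>, but at the weight of \<open>J\<close> it does not lie above it; so it descends
    at least as fast.\<close>
  moreover have "ereal (\<alpha>' - ?w J * \<epsilon>') \<le> v (dv J c)" using n' by (simp add: newt_def)
  ultimately have "\<alpha>' - ?w J * \<epsilon>' \<le> \<alpha> - ?w J * \<epsilon>" by simp
  then have "?w J * \<epsilon> \<le> ?w J * \<epsilon>'" using al by simp
  then show "\<epsilon> \<le> \<epsilon>'" using multi_weight_pos[OF scaling_pos, of J] J(1) by simp
qed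

text \<open>Strictly inside the ball every nonconstant Taylor term has value greater than
  \<open>\<alpha>\<close>, so the constant term dominates and the value of \<open>f\<close> is that
  at \<open>a\<close>.\<close>

lemma newt_no_root_inside:
  assumes n: "newt a \<epsilon> \<alpha>" and a: "a \<in> carrier K" and c: "c \<in> carrier K" "ereal \<epsilon> < v (c \<ominus> a)"
  shows "dv {#} c \<noteq> \<zero>"
proof -
  have u: "c \<ominus> a \<in> carrier K" "a \<oplus> (c \<ominus> a) = c" using a c by (simp_all add: add_minus_cancel)
  have "ereal \<alpha> < v (\<Oplus>I\<in>supp_closure - {{#}}. taylor_term a (c \<ominus> a) {#} I)"
  proof (rule val_finsum_gt)
    fix I assume "I \<in> supp_closure - {{#}}"
    then show "ereal \<alpha> < v (taylor_term a (c \<ominus> a) {#} I)"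
      using val_taylor_term(2)[OF n a u(1) less_imp_le[OF c(2)], of I "{#}"] c(2) by simp
  qed (use a u in auto)
  then have "v (dv {#} c) = ereal \<alpha>"
    using dv_taylor_split[OF a u(1), of "{#}"] val_add_eq[of "dv {#} a"] n a u by (simp add: newt_def finsum_closed)
  then show ?thesis by auto
qed

text \<open>Zero derivatives contribute only the exponent -infinity, so the maximum runs over
  finitely many values. For it to be real some derivative must be nonzero at \<open>a\<close>; a
  monomial of \<open>f\<close> of largest size provides one that is nonzero everywhere.\<close>

lemma newt_exists:
  assumes a: "a \<in> carrier K" "dv {#} a \<noteq> \<zero>"
  shows "\<exists>\<epsilon> \<alpha>. newt a \<epsilon> \<alpha> \<and> newton_radius K v \<sigma> \<rho> f a = ereal \<epsilon>"
proof -
  let ?w = "multi_weight \<rho>"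
  obtain \<alpha> where \<alpha>: "v (dv {#} a) = ereal \<alpha>" using val_real[of "dv {#} a"] a by auto
  let ?e = "newton_exponent K v \<sigma> \<rho> f a"
  let ?S = "{J :: nat multiset. 1 \<le> size J}"
  have S: "J \<in> ?S \<longleftrightarrow> J \<noteq> {#}" for J using nonempty_has_size[of J] by auto
  have wpos: "?w J > 0" if "J \<in> ?S" for J using multi_weight_pos[OF scaling_pos] that S by blast
  have e: "?e J = ereal (1 / ?w J) * (ereal \<alpha> - v (dv J a))" for J
  proof -
    have "v (diff_taylor K \<sigma> f J a) = v (dv J a)"
      unfolding diff_taylor_def dv_def[symmetric] using a by (simp add: val_mult multi_fact_val)
    then show ?thesis unfolding newton_exponent_def using \<alpha> by (simp add: dv_empty)
  qed
  have einf: "?e J = -\<infinity>" if "J \<in> ?S" "dv J a = \<zero>" for J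
    unfolding e using that wpos[OF that(1)] by simp
  have ereal_e: "?e J = ereal ((\<alpha> - \<beta>) / ?w J)" if "v (dv J a) = ereal \<beta>" for J \<beta>
    unfolding e using that by simp
  have "?e ` ?S \<subseteq> insert (-\<infinity>) (?e ` supp_closure)" using einf dv_outside by fastforce
  then have fin: "finite (?e ` ?S)" using supp_closure_finite finite_subset by blast
  have fs: "finite (size ` {M. f M \<noteq> \<zero>})" using f_iff(1) by blast
  have "size ` {M. f M \<noteq> \<zero>} \<noteq> {}" using nonconst by blast
  then have "Max (size ` {M. f M \<noteq> \<zero>}) \<in> size ` {M. f M \<noteq> \<zero>}" by (rule Max_in[OF fs])
  then obtain N where N: "Max (size ` {M. f M \<noteq> \<zero>}) = size N" "N \<in> {M. f M \<noteq> \<zero>}" by (rule imageE)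
  have fN: "f N \<noteq> \<zero>" using N(2) by (rule CollectD)
  have Nmax: "size M \<le> size N" if "f M \<noteq> \<zero>" for M
    unfolding N(1)[symmetric] by (rule Max_ge[OF fs], rule imageI, rule CollectI, rule that)
  obtain M where M: "M \<noteq> {#}" "f M \<noteq> \<zero>" using nonconst by blast
  have NS: "N \<in> ?S" using Nmax[OF M(2)] M(1) nonempty_has_size[of M] by auto
  \<comment> \<open>No monomial of \<open>f\<close> properly contains \<open>N\<close>, so this
    derivative is the constant \<open>N!\<close> times the coefficient of \<open>N\<close>.\<close>
  have dN: "multi_deriv K N f M = (if M = {#} then add_pow K (multi_fact N) (f N) else \<zero>)" for M
  proof (cases "M = {#}")
    case True
    then show ?thesis by (simp add: multi_deriv_eq[OF f_iff(2)] multi_fact_def)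
  next
    case False
    then have "f (M + N) = \<zero>" using Nmax[of "M + N"] nonempty_has_size[of M] by auto
    then show ?thesis using False by (simp add: multi_deriv_eq[OF f_iff(2)])
  qed
  have "dv N a = (\<Oplus>M\<in>{{#}}. multi_deriv K N f M \<otimes> mono_val K (\<lambda>i. (\<sigma> ^^ i) a) M)"
    unfolding dv_def diff_eval_def using f_iff(2) by (intro mpoly_evalI) (auto simp: dN)
  then have dvN: "dv N a = add_pow K (multi_fact N) \<one> \<otimes> f N" using f_iff(2) by (simp add: dN add_pow_ldistr)
  have "v (add_pow K (multi_fact N) \<one>) = 0" by (rule val_nat[OF res_char0 multi_fact_pos])
  moreover obtain \<phi> where "v (f N) = ereal \<phi>" using val_real[OF f_iff(2) fN] by blast
  ultimately have vN: "v (dv N a) = ereal \<phi>" unfolding dvN using f_iff(2) by (simp add: val_mult)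
  have "?e ` ?S \<noteq> {}" using NS by blast
  then have "Max (?e ` ?S) \<in> ?e ` ?S" by (rule Max_in[OF fin])
  then obtain J where J: "Max (?e ` ?S) = ?e J" "J \<in> ?S" by (rule imageE)
  have maxJ: "?e I \<le> ?e J" if "I \<in> ?S" for I
    unfolding J(1)[symmetric] by (rule Max_ge[OF fin], rule imageI, rule that)
  have "dv J a \<noteq> \<zero>"
  proof
    assume "dv J a = \<zero>"
    then have "?e J = -\<infinity>" by (rule einf[OF J(2)])
    then show False using maxJ[OF NS] ereal_e[OF vN] by simp
  qed
  then obtain \<beta> where \<beta>: "v (dv J a) = ereal \<beta>" using val_real[of "dv J a"] a by auto
  define \<epsilon> where "\<epsilon> = (\<alpha> - \<beta>) / ?w J"
  have eJ: "?e J = ereal \<epsilon>" using ereal_e[OF \<beta>] by (simp add: \<epsilon>_def)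
  have "newt a \<epsilon> \<alpha>"
    unfolding newt_def
  proof (intro conjI allI)
    show "v (dv {#} a) = ereal \<alpha>" by (rule \<alpha>)
    show "\<exists>J. J \<noteq> {#} \<and> v (dv J a) = ereal (\<alpha> - ?w J * \<epsilon>)"
      using J(2) S \<beta> wpos[OF J(2)] by (intro exI[of _ J]) (simp add: \<epsilon>_def)
    fix I
    show "ereal (\<alpha> - ?w I * \<epsilon>) \<le> v (dv I a)"
    proof (cases "I = {#}")
      case True
      then show ?thesis using \<alpha> by simp
    next
      case False
      then have IS: "I \<in> ?S" using S by simp
      show ?thesis
      proof (cases "v (dv I a)")
        case (real \<delta>)
        have "(\<alpha> - \<delta>) / ?w I \<le> \<epsilon>" using maxJ[OF IS] ereal_e[OF real] eJ by simp
        then have "\<alpha> - \<delta> \<le> ?w I * \<epsilon>" using wpos[OF IS] by (simp add: divide_le_eq mult.commute)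
        then show ?thesis using real by simp
      next
        case MInf
        then show ?thesis using val_not_MInf[of "dv I a"] a by simp
      qed simp
    qed
  qed
  moreover have "newton_radius K v \<sigma> \<rho> f a = ereal \<epsilon>"
    unfolding newton_radius_def using J(1) eJ by simp
  ultimately show ?thesis by blast
qed

text \<open>At an index \<open>J\<close> on the supporting line, the weight of \<open>J\<close>
  times \<open>\<epsilon>\<close> is a difference of two values, and the weight can be divided
  out.\<close>

lemma newt_value_group:
  assumes m: "rat_adjoin_module \<rho> (value_group K v)" and a: "a \<in> carrier K" and n: "newt a \<epsilon> \<alpha>"
  shows "\<epsilon> \<in> value_group K v"
proof -
  let ?w = "multi_weight \<rho>"
  obtain J where J: "J \<noteq> {#}" "v (dv J a) = ereal (\<alpha> - ?w J * \<epsilon>)" using n by (auto simp: newt_def)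
  have G: "\<gamma> \<in> value_group K v" if "x \<in> carrier K" "v x = ereal \<gamma>" for x \<gamma>
    unfolding value_group_def using that by (intro CollectI image_eqI[of _ _ x]) auto
  have "\<alpha> \<in> value_group K v" using G[of "dv {#} a"] n a by (simp add: newt_def)
  moreover have "\<alpha> - ?w J * \<epsilon> \<in> value_group K v" using G[of "dv J a"] J a by simp
  ultimately have "\<alpha> + - (\<alpha> - ?w J * \<epsilon>) \<in> value_group K v" using m unfolding rat_adjoin_module_def by blast
  moreover have "\<alpha> + - (\<alpha> - ?w J * \<epsilon>) = ?w J * \<epsilon>" by simp
  ultimately have "?w J * \<epsilon> \<in> value_group K v" by simp
  then have "1 / ?w J * (?w J * \<epsilon>) \<in> value_group K v"
    using m inverse_multi_weight_rat_adjoin[OF scaling_pos J(1)] unfolding rat_adjoin_module_def by blast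
  then show ?thesis using multi_weight_pos[OF scaling_pos J(1)] by simp
qed

end

lemma (in ring) char_zero_infinite:
  assumes "char_zero R"
  shows "infinite (carrier R)"
proof -
  have "inj (\<lambda>n::nat. add_pow R n \<one>)"
  proof (rule linorder_injI)
    fix m n :: nat assume mn: "m < n"
    show "add_pow R m \<one> \<noteq> add_pow R n \<one>"
    proof
      assume eq: "add_pow R m \<one> = add_pow R n \<one>"
      have "add_pow R m \<one> \<oplus> add_pow R (n - m) \<one> = add_pow R n \<one>"
        using add.nat_pow_mult[of \<one> m "n - m"] mn by simp
      then have "add_pow R m \<one> \<oplus> add_pow R (n - m) \<one> = add_pow R m \<one> \<oplus> \<zero>" using eq by simp
      then have "add_pow R (n - m) \<one> = \<zero>" by (rule add.l_cancel) auto
      moreover have "add_pow R (n - m) \<one> \<noteq> \<zero>"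
        using assms[unfolded char_zero_def, THEN spec, THEN mp, of "n - m"] mn by simp
      ultimately show False by simp
    qed
  qed
  moreover have "range (\<lambda>n::nat. add_pow R n \<one>) \<subseteq> carrier R" by auto
  ultimately show ?thesis using finite_subset range_inj_infinite by blast
qed

context newton_setup
begin

text \<open>With \<open>v(u) = \<epsilon>\<close>, the difference polynomial \<open>f(a + u z) / f(a)\<close> in \<open>z\<close> has coefficients in the
  valuation ring and a nonconstant reduction, which has a root in the residue field.\<close>

lemma newt_improve:
  assumes A: "ACFA (residue_field K v) (residue_map \<sigma>)"
    and n: "newt a \<epsilon> \<alpha>" and a: "a \<in> carrier K" and u: "u \<in> carrier K" "v u = ereal \<epsilon>"
  shows "\<exists>c\<in>carrier K. ereal \<epsilon> \<le> v (c \<ominus> a) \<and> ereal \<alpha> < v (dv {#} c)"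
proof -
  let ?k = "residue_field K v"
  interpret O: cring O_ring by (rule O_ring_cring)
  interpret k: cring ?k by (rule residue_field_cring)
  define d where "d = dv {#} a"
  have vd: "v d = ereal \<alpha>" using n by (simp add: newt_def d_def)
  have d: "d \<in> carrier K" "d \<noteq> \<zero>" using a vd by (auto simp: d_def)
  have di: "inv d \<in> carrier K" "v (inv d) = ereal (- \<alpha>)" "d \<otimes> inv d = \<one>"
    using d val_inv[OF d(1) vd] by auto
  define t where "t I = taylor_term a u {#} I" for I
  have tc: "t I \<in> carrier K" for I using a u by (simp add: t_def)
  have tv: "ereal \<alpha> \<le> v (t I)" for I
    using val_taylor_term(1)[OF n a u(1), of "{#}" I] u(2) by (simp add: t_def)
  \<comment> \<open>\<open>b I\<close> is the coefficient of the monomial \<open>I\<close> in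
    \<open>z\<close> in the rescaled polynomial; the powers of \<open>u\<close> are contained in
    \<open>t I\<close>.\<close>
  define b where "b I = (if I \<in> supp_closure then inv d \<otimes> t I else \<zero>)" for I
  have bv: "b I \<in> valuation_set K v" for I
  proof (cases "I \<in> supp_closure")
    case True
    have "0 \<le> v (inv d) + v (t I)" using tv[of I] di(2) by (cases "v (t I)") (auto simp: zero_ereal_def)
    then show ?thesis using True di tc by (simp add: b_def valuation_set_def val_mult)
  qed (simp add: b_def valuation_set_def)
  have bc: "b I \<in> carrier K" for I using bv[of I] by (simp add: valuation_set_def)
  have b0: "b I = \<zero>" if "I \<notin> supp_closure" for I using that by (simp add: b_def)
  have db: "d \<otimes> b I = t I" if "I \<in> supp_closure" for I
    using that d di tc[of I] by (simp add: b_def m_assoc[symmetric])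
  have bO: "b \<in> mpoly_carrier O_ring UNIV"
  proof -
    have "{M. b M \<noteq> \<zero>} \<subseteq> supp_closure" using b0 by blast
    then have "finite {M. b M \<noteq> \<zero>}" using supp_closure_finite by (rule finite_subset)
    then show ?thesis unfolding O.mpoly_carrier_iff using bv by simp
  qed
  have rb: "resid \<circ> b \<in> diff_polys ?k"
    by (rule mpoly_carrier_hom[OF O.ring_axioms k.ring_axioms resid_hom bO])
  obtain J where J: "J \<noteq> {#}" "v (dv J a) = ereal (\<alpha> - multi_weight \<rho> J * \<epsilon>)"
    using n by (auto simp: newt_def)
  have JS: "J \<in> supp_closure"
  proof (rule ccontr)
    assume "J \<notin> supp_closure"
    then have "dv J a = \<zero>" by (rule dv_outside)
    then show False using J(2) by simp
  qed
  \<comment> \<open>An index on the supporting line gives a unit coefficient, and since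
    \<open>J\<close> is nonempty the reduction is nonconstant.\<close>
  have "v (t J) = ereal \<alpha>"
    unfolding t_def taylor_term_def using a u J(2) by (simp add: val_mult multi_fact_val val_mono_val[OF u])
  then have "v (b J) = 0" using JS di tc[of J] by (simp add: b_def val_mult)
  then have rJ: "(resid \<circ> b) J \<noteq> \<zero>\<^bsub>?k\<^esub>" using resid_zero_iff[OF bv[of J]] by simp
  obtain y where y: "y \<in> carrier ?k" "diff_eval ?k (residue_map \<sigma>) (resid \<circ> b) y = \<zero>\<^bsub>?k\<^esub>"
    using ACFA_root[OF A k.char_zero_infinite[OF res_char0] rb rJ J(1)] by blast
  obtain z where z: "z \<in> valuation_set K v" "y = resid z" using resid_surj[OF y(1)] by blast
  have zc: "z \<in> carrier K" "0 \<le> v z" using z(1) by (auto simp: valuation_set_def)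
  define x where "x = (\<lambda>i. (\<sigma> ^^ i) z)"
  have xO: "x i \<in> valuation_set K v" for i unfolding x_def by (rule \<sigma>_funpow_O[OF z(1)])
  have xc: "x i \<in> carrier K" for i using xO[of i] by (simp add: valuation_set_def)
  define e where "e = mpoly_eval O_ring x b"
  have xU: "x \<in> UNIV \<rightarrow> carrier O_ring" using xO by simp
  have eO: "e \<in> valuation_set K v" unfolding e_def using O.mpoly_eval_closed[OF bO xU] by simp
  have "resid e = mpoly_eval ?k (resid \<circ> x) (resid \<circ> b)"
    unfolding e_def by (rule mpoly_eval_hom[OF O_ring_cring residue_field_cring resid_hom bO xU, symmetric])
  also have "resid \<circ> x = (\<lambda>i. (residue_map \<sigma> ^^ i) y)" by (auto simp: x_def z(2) resid_\<sigma>[OF z(1)])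
  finally have "resid e = \<zero>\<^bsub>?k\<^esub>" using y(2)[unfolded diff_eval_def] by (rule trans)
  then have ve: "0 < v e" using resid_zero_iff[OF eO] by blast
  have idh: "id \<in> ring_hom O_ring K"
    by (rule ring_hom_memI) (auto simp: valuation_set_def)
  have "e = mpoly_eval K x b"
    unfolding e_def using mpoly_eval_hom[OF O_ring_cring is_cring idh bO xU] by simp
  also have "\<dots> = (\<Oplus>I\<in>supp_closure. b I \<otimes> mono_val K x I)"
    using supp_closure_finite b0 bc xc by (intro mpoly_evalI) auto
  finally have e: "e = (\<Oplus>I\<in>supp_closure. b I \<otimes> mono_val K x I)" .
  have mc: "mono_val K x I \<in> carrier K" for I using xc by auto
  have uz: "u \<otimes> z \<in> carrier K" using u zc by simp
  have "dv {#} (a \<oplus> u \<otimes> z) = (\<Oplus>I\<in>supp_closure. taylor_term a (u \<otimes> z) {#} I)"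
    by (rule dv_taylor[OF a uz])
  also have "\<dots> = (\<Oplus>I\<in>supp_closure. d \<otimes> (b I \<otimes> mono_val K x I))"
  proof (rule finsum_cong')
    fix I assume I: "I \<in> supp_closure"
    have s: "(\<lambda>i. (\<sigma> ^^ i) (u \<otimes> z)) = (\<lambda>i. (\<sigma> ^^ i) u \<otimes> x i)"
      unfolding x_def using ring_hom_mult[OF \<sigma>_funpow_hom u(1) zc(1)] by blast
    have "mono_val K (\<lambda>i. (\<sigma> ^^ i) (u \<otimes> z)) I = mono_val K (\<lambda>i. (\<sigma> ^^ i) u) I \<otimes> mono_val K x I"
      unfolding s using u(1) xc by (intro mono_val_mult) auto
    then have "taylor_term a (u \<otimes> z) {#} I = t I \<otimes> mono_val K x I"
      unfolding t_def taylor_term_def using a u(1) mc by (simp add: m_assoc)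
    also have "\<dots> = d \<otimes> (b I \<otimes> mono_val K x I)"
      using db[OF I] d(1) bc mc by (simp add: m_assoc[symmetric])
    finally show "taylor_term a (u \<otimes> z) {#} I = d \<otimes> (b I \<otimes> mono_val K x I)" .
  qed (use d(1) bc mc in auto)
  also have "\<dots> = d \<otimes> e"
    unfolding e by (rule finsum_rdistr[symmetric]) (use supp_closure_finite d(1) bc mc in auto)
  finally have eq: "dv {#} (a \<oplus> u \<otimes> z) = d \<otimes> e" .
  have "e \<in> carrier K" using eO by (simp add: valuation_set_def)
  then have "v (dv {#} (a \<oplus> u \<otimes> z)) = ereal \<alpha> + v e" unfolding eq using d(1) vd by (simp add: val_mult)
  then have 1: "ereal \<alpha> < v (dv {#} (a \<oplus> u \<otimes> z))" using ve by (cases "v e") auto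
  have "(a \<oplus> u \<otimes> z) \<ominus> a = u \<otimes> z"
  proof -
    have "(a \<oplus> u \<otimes> z) \<oplus> \<ominus> a = (u \<otimes> z \<oplus> a) \<oplus> \<ominus> a" using a uz by (simp add: a_comm)
    also have "\<dots> = u \<otimes> z" using a uz by (simp add: a_assoc r_neg)
    finally show ?thesis by (simp add: minus_eq)
  qed
  moreover have "ereal \<epsilon> \<le> v (u \<otimes> z)" using u zc by (cases "v z") (auto simp: val_mult)
  ultimately show ?thesis using 1 a uz by (intro bexI[of _ "a \<oplus> u \<otimes> z"]) auto
qed

text \<open>Without a root, the balls around \<open>a\<close> whose radius is the Newton radius at \<open>a\<close> have a minimal
  element by spherical completeness, and approximating once more contradicts minimality.\<close>

lemma newt_root_in_ball:
  assumes A: "ACFA (residue_field K v) (residue_map \<sigma>)"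
    and sc: "spherically_complete K v" and m: "rat_adjoin_module \<rho> (value_group K v)"
    and b: "b \<in> carrier K" and n: "newt b \<epsilon> \<alpha>"
  shows "\<exists>a\<in>carrier K. dv {#} a = \<zero> \<and> ereal \<epsilon> \<le> v (a \<ominus> b)"
proof (rule ccontr)
  assume no: "\<not> (\<exists>a\<in>carrier K. dv {#} a = \<zero> \<and> ereal \<epsilon> \<le> v (a \<ominus> b))"
  define S where "S = {x \<in> carrier K. ereal \<epsilon> \<le> v (x \<ominus> b)}"
  have bS: "b \<in> S" using b by (simp add: S_def minus_eq r_neg)
  have SK: "S \<subseteq> carrier K" by (auto simp: S_def)
  have "\<exists>r \<alpha>. newt a r \<alpha>" if "a \<in> S" for a
    using newt_exists[of a] no that unfolding S_def by blast
  then obtain rad ht where nw: "\<And>a. a \<in> S \<Longrightarrow> newt a (rad a) (ht a)" by metis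
  define bl where "bl a = {x \<in> carrier K. ereal (rad a) \<le> v (x \<ominus> a)}" for a
  have self: "a \<in> bl a" if "a \<in> carrier K" for a using that by (simp add: bl_def minus_eq r_neg)
  have mono: "bl c \<subseteq> bl a \<and> ht a \<le> ht c" if a: "a \<in> S" and c: "c \<in> S" "c \<in> bl a" for a c
  proof -
    have ac: "a \<in> carrier K" "c \<in> carrier K" "ereal (rad a) \<le> v (c \<ominus> a)"
      using a c SK by (auto simp: bl_def)
    have le: "ht a \<le> ht c" "rad a \<le> rad c" using newt_ball_mono[OF nw[OF a] ac nw[OF c(1)]] by auto
    have "x \<in> bl a" if x: "x \<in> bl c" for x
    proof -
      have xc: "x \<in> carrier K" "ereal (rad c) \<le> v (x \<ominus> c)" using x by (auto simp: bl_def)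
      have "ereal (rad a) \<le> v (x \<ominus> c)" using le(2) xc(2) by (meson ereal_less_eq(3) order_trans)
      then have "ereal (rad a) \<le> v ((x \<ominus> c) \<oplus> (c \<ominus> a))"
        using val_add_ge[of "x \<ominus> c" "c \<ominus> a"] xc(1) ac by simp
      moreover have "(x \<ominus> c) \<oplus> (c \<ominus> a) = x \<ominus> a"
      proof -
        have "(x \<ominus> c) \<oplus> (c \<ominus> a) = x \<oplus> (\<ominus> c \<oplus> (c \<oplus> \<ominus> a))" using xc(1) ac by (simp add: minus_eq a_assoc)
        also have "\<ominus> c \<oplus> (c \<oplus> \<ominus> a) = \<ominus> a" using ac by (simp add: r_neg1)
        finally show ?thesis by (simp add: minus_eq)
      qed
      ultimately show ?thesis using xc(1) by (simp add: bl_def)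
    qed
    then show ?thesis using le(1) by blast
  qed
  \<comment> \<open>Both \<open>\<epsilon>\<close> and \<open>rad b\<close> are Newton radii at
    \<open>b\<close>; monotonicity with both centers equal to \<open>b\<close>, applied in both
    directions, shows that they agree.\<close>
  have blb: "bl b = S"
  proof -
    have "\<epsilon> \<le> rad b" "rad b \<le> \<epsilon>"
      using newt_ball_mono(2)[OF n b b _ nw[OF bS]] newt_ball_mono(2)[OF nw[OF bS] b b _ n] b
      by (simp_all add: minus_eq r_neg)
    then show ?thesis by (simp add: bl_def S_def)
  qed
  have blS: "bl a \<subseteq> S" if "a \<in> S" for a using mono[OF bS that] that blb by blast
  have balls: "bl a \<in> valuation_balls K v" if "a \<in> S" for a
  proof -
    have "a \<in> carrier K" using that SK by blast
    moreover have "rad a \<in> value_group K v" using newt_value_group[OF m] nw[OF that] calculation by blast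
    ultimately show ?thesis unfolding valuation_balls_def bl_def by blast
  qed
  \<comment> \<open>Complements turn descending chains of balls into ascending ones, to which Zorn's
    lemma with upper bounds applies.\<close>
  define D where "D a = carrier K - bl a" for a
  have Dsub: "D a \<subseteq> D c \<longleftrightarrow> bl c \<subseteq> bl a" for a c unfolding D_def by (auto simp: bl_def)
  have "\<exists>M\<in>(D ` S). \<forall>P\<in>(D ` S). M \<subseteq> P \<longrightarrow> P = M"
  proof (rule subset_Zorn)
    fix C assume C: "subset.chain (D ` S) C"
    show "\<exists>U\<in>(D ` S). \<forall>P\<in>C. P \<subseteq> U"
    proof (cases "C = {}")
      case True
      then show ?thesis using bS by blast
    next
      case False
      \<comment> \<open>A complement does not determine its center, so all centers in
        \<open>S\<close> whose complement belongs to the chain are taken.\<close>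
      define T where "T = {a \<in> S. D a \<in> C}"
      have CT: "\<exists>a\<in>T. P = D a" if "P \<in> C" for P
        using that C unfolding T_def subset_chain_def by blast
      have TS: "a \<in> S" if "a \<in> T" for a using that by (simp add: T_def)
      have "subset.chain (valuation_balls K v) (bl ` T)"
        unfolding subset_chain_def
      proof (intro conjI ballI)
        show "bl ` T \<subseteq> valuation_balls K v" using balls TS by blast
        fix P Q assume "P \<in> bl ` T" "Q \<in> bl ` T"
        then obtain p q where pq: "p \<in> T" "P = bl p" "q \<in> T" "Q = bl q" by blast
        have "D p \<in> C" "D q \<in> C" using pq by (auto simp: T_def)
        then have "D p \<subseteq> D q \<or> D q \<subseteq> D p" using C unfolding subset_chain_def by blast
        then show "P \<subseteq> Q \<or> Q \<subseteq> P" using pq Dsub by blast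
      qed
      moreover have "bl ` T \<noteq> {}" using False CT by blast
      ultimately have "\<Inter>(bl ` T) \<noteq> {}" using sc unfolding spherically_complete_def by simp
      then obtain c where "c \<in> \<Inter>(bl ` T)" by (metis ex_in_conv)
      then have c: "\<And>a. a \<in> T \<Longrightarrow> c \<in> bl a" by simp
      obtain a0 where "a0 \<in> T" using False CT by blast
      \<comment> \<open>A common point of the balls is itself an admissible center, and by
        monotonicity its ball lies in every ball of the chain.\<close>
      then have cS: "c \<in> S" using c blS TS by blast
      have "P \<subseteq> D c" if P: "P \<in> C" for P
      proof -
        obtain a where a: "a \<in> T" "P = D a" using CT[OF P] by blast
        then show ?thesis using mono[OF TS[OF a(1)] cS c[OF a(1)]] Dsub by blast
      qed
      then show ?thesis using cS by blast
    qed
  qed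
  then obtain a where a: "a \<in> S" "\<And>c. c \<in> S \<Longrightarrow> D a \<subseteq> D c \<Longrightarrow> D c = D a" by blast
  have ac: "a \<in> carrier K" using a(1) SK by blast
  have "rad a \<in> value_group K v" by (rule newt_value_group[OF m ac nw[OF a(1)]])
  then have "ereal (rad a) \<in> v ` (carrier K - {\<zero>})" unfolding value_group_def by (rule CollectD)
  then obtain u where "ereal (rad a) = v u" "u \<in> carrier K - {\<zero>}" by (rule imageE)
  then have u: "u \<in> carrier K" "v u = ereal (rad a)" by simp_all
  obtain c where c: "c \<in> carrier K" "ereal (rad a) \<le> v (c \<ominus> a)" "ereal (ht a) < v (dv {#} c)"
    using newt_improve[OF A nw[OF a(1)] ac u] by blast
  have cb: "c \<in> bl a" using c by (simp add: bl_def)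
  then have cS: "c \<in> S" using blS[OF a(1)] by blast
  \<comment> \<open>The balls around \<open>c\<close> and \<open>a\<close> coincide by minimality,
    so \<open>a\<close> lies in the ball around \<open>c\<close>. Monotonicity of \<open>ht\<close>
    then bounds \<open>ht c\<close> by \<open>ht a\<close>, against the improvement at
    \<open>c\<close>.\<close>
  have "D c = D a" using a(2)[OF cS] mono[OF a(1) cS cb] Dsub by blast
  then have "bl a \<subseteq> bl c" using Dsub by blast
  then have "a \<in> bl c" using self[OF ac] by blast
  then have "ht c \<le> ht a" using mono[OF cS a(1)] by blast
  moreover have "v (dv {#} c) = ereal (ht c)" using nw[OF cS] by (simp add: newt_def)
  ultimately show False using c(3) by simp
qed

end

theorem theorem1p5:
  fixes K :: "('a, 'm) ring_scheme" and v :: "'a \<Rightarrow> ereal" and \<sigma> :: "'a \<Rightarrow> 'a" and \<rho> :: real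
    and f :: "nat multiset \<Rightarrow> 'a" and b :: 'a
  assumes "multiplicative_valued_difference_field K v \<sigma> \<rho>"
    and "char_zero K"
    and "spherically_complete K v"
    and "ACFA (residue_field K v) (residue_map \<sigma>)"
    and "char_zero (residue_field K v)"
    and "rat_adjoin_module \<rho> (value_group K v)"
    and "\<not> Polynomial.algebraic \<rho>"
    and "f \<in> diff_polys K"
    and "f \<notin> ring.indexed_const K ` carrier K"
    and "b \<in> carrier K"
    and "diff_eval K \<sigma> f b \<noteq> \<zero>\<^bsub>K\<^esub>"
  shows "\<exists>a\<in>carrier K. diff_eval K \<sigma> f a = \<zero>\<^bsub>K\<^esub> \<and>
           v (a \<ominus>\<^bsub>K\<^esub> b) = newton_radius K v \<sigma> \<rho> f b"
proof -
  interpret M: multiplicative_valued_difference_field K v \<sigma> \<rho> by (rule assms(1))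
  have "\<exists>M. M \<noteq> {#} \<and> f M \<noteq> \<zero>\<^bsub>K\<^esub>"
  proof (rule ccontr)
    assume "\<not> ?thesis"
    then have "f = ring.indexed_const K (f {#})" by (auto simp: M.indexed_const_def fun_eq_iff)
    moreover have "f {#} \<in> carrier K" using assms(8) by (simp add: M.mpoly_carrier_iff)
    ultimately show False using assms(9) by blast
  qed
  then interpret newton_setup K v \<sigma> \<rho> f
    by unfold_locales (use assms(2,5,8) in auto)
  have "dv {#} b \<noteq> \<zero>\<^bsub>K\<^esub>" using assms(11) by (simp add: dv_empty)
  then obtain \<epsilon> \<alpha> where n: "newt b \<epsilon> \<alpha>" "newton_radius K v \<sigma> \<rho> f b = ereal \<epsilon>"
    using newt_exists[OF assms(10)] by blast
  obtain a where a: "a \<in> carrier K" "dv {#} a = \<zero>\<^bsub>K\<^esub>" "ereal \<epsilon> \<le> v (a \<ominus>\<^bsub>K\<^esub> b)"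
    using newt_root_in_ball[OF assms(4,3,6,10) n(1)] by blast
  \<comment> \<open>Membership in the ball bounds the value of the difference only from below; a
    root strictly inside is excluded, which gives equality.\<close>
  have "\<not> ereal \<epsilon> < v (a \<ominus>\<^bsub>K\<^esub> b)" using newt_no_root_inside[OF n(1) assms(10) a(1)] a(2) by blast
  then have "v (a \<ominus>\<^bsub>K\<^esub> b) = ereal \<epsilon>" using a(3) by simp
  then show ?thesis using a(1,2) n(2) by (auto simp: dv_empty)
qed

end
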